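(* There is an absolute constant $C>0$ such that the following holds. Let $\mu$ be a positive finite Borel measure on $\mathbb D$ and $k\ge0$ an integer. Then $T^{(k)}_\mu$ is bounded if and only if $\mu$ is a Carleson measure, in which case $$\frac{C}{k+2}\,\|B_0(\mu)\|_\infty\le\|T^{(k)}_\mu\|\le4(k+2)\,\|B_0(\mu)\|_\infty.$$
   Context: $\mathbb D$ open unit disc, $dA$ normalized area measure, $A^2$ Bergman space with $\langle f,g\rangle=\int f\bar g\,dA$. $\varphi_z(w)=(z-w)/(1-\bar zw)$, $U_zf=(f\circ\varphi_z)\varphi_z'$, $e_k(w)=\sqrt{k+1}\,w^k$. For a finite measure $\mu$ and integer $k\ge0$, $T^{(k)}_\mu$ is the operator $\int U_zE_kU_z(1-|z|^2)^{-2}d\mu(z)$, $E_k=e_k\otimes e_k$, $(f\otimes g)h=\langle h,g\rangle f$; i.e. $\langle T^{(k)}_\mu f,g\rangle=\int\langle f,U_ze_k\rangle\overline{\langle g,U_ze_k\rangle}(1-|z|^2)^{-2}d\mu(z)$ for polynomials $f,g$, and "bounded" means this form extends to a bounded operator on $A^2$. $B_0(\mu)(z)=\int_{\mathbb D}\frac{(1-|\varphi_z(\zeta)|^2)^2}{(1-|\zeta|^2)^2}d\mu(\zeta)$. A positive measure $\mu$ on $\mathbb D$ is Carleson if $A^2\subset L^2(d\mu)$ (equivalently $\|B_0(\mu)\|_\infty<\infty$). *)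

theory Defs
  imports "HOL-Analysis.Analysis" "HOL-Computational_Algebra.Polynomial"
begin

definition dA :: "complex measure" where
  "dA = density lborel (\<lambda>w. ennreal (indicator (ball 0 1) w / pi))"

definition A2ip :: "(complex \<Rightarrow> complex) \<Rightarrow> (complex \<Rightarrow> complex) \<Rightarrow> complex" where
  "A2ip f g = (LINT w|dA. f w * cnj (g w))"

definition A2norm :: "(complex \<Rightarrow> complex) \<Rightarrow> real" where
  "A2norm f = sqrt (LINT w|dA. (cmod (f w))\<^sup>2)"

definition A2 :: "(complex \<Rightarrow> complex) set" where
  "A2 = {f. f holomorphic_on ball 0 1 \<and> (\<integral>\<^sup>+ w. ennreal ((cmod (f w))\<^sup>2) \<partial>dA) < \<infinity>}"

definition phi :: "complex \<Rightarrow> complex \<Rightarrow> complex" where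
  "phi z w = (z - w) / (1 - cnj z * w)"

definition U :: "complex \<Rightarrow> (complex \<Rightarrow> complex) \<Rightarrow> (complex \<Rightarrow> complex)" where
  "U z f = (\<lambda>w. f (phi z w) * deriv (phi z) w)"

definition ek :: "nat \<Rightarrow> complex \<Rightarrow> complex" where
  "ek k w = complex_of_real (sqrt (real k + 1)) * w ^ k"

definition Tform :: "complex measure \<Rightarrow> nat \<Rightarrow> (complex \<Rightarrow> complex) \<Rightarrow> (complex \<Rightarrow> complex) \<Rightarrow> complex" where
  "Tform \<mu> k f g = (LINT z|\<mu>. A2ip f (U z (ek k)) * cnj (A2ip g (U z (ek k)))
                              / complex_of_real ((1 - (cmod z)\<^sup>2)\<^sup>2))"

text \<open>T^(k)_mu is bounded: the form on polynomials extends to a bounded operator on A^2.\<close>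
definition Tbounded :: "complex measure \<Rightarrow> nat \<Rightarrow> bool" where
  "Tbounded \<mu> k \<longleftrightarrow> (\<exists>M. \<forall>p q :: complex poly.
      cmod (Tform \<mu> k (poly p) (poly q)) \<le> M * A2norm (poly p) * A2norm (poly q))"

text \<open>Operator norm of the (extended) operator; polynomials are dense in A^2.\<close>
definition Tnorm :: "complex measure \<Rightarrow> nat \<Rightarrow> real" where
  "Tnorm \<mu> k = Sup {cmod (Tform \<mu> k (poly p) (poly q)) | p q :: complex poly.
                       A2norm (poly p) \<le> 1 \<and> A2norm (poly q) \<le> 1}"

definition B0 :: "complex measure \<Rightarrow> complex \<Rightarrow> ennreal" where
  "B0 \<mu> z = (\<integral>\<^sup>+ \<zeta>. ennreal ((1 - (cmod (phi z \<zeta>))\<^sup>2)\<^sup>2 / (1 - (cmod \<zeta>)\<^sup>2)\<^sup>2) \<partial>\<mu>)"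

definition B0sup :: "complex measure \<Rightarrow> ennreal" where
  "B0sup \<mu> = (SUP z\<in>ball 0 1. B0 \<mu> z)"

definition Carleson :: "complex measure \<Rightarrow> bool" where
  "Carleson \<mu> \<longleftrightarrow> (\<forall>f\<in>A2. (\<integral>\<^sup>+ z. ennreal ((cmod (f z))\<^sup>2) \<partial>\<mu>) < \<infinity>)"

end

theory Submission
  imports Defs "HOL-Complex_Analysis.Complex_Analysis"
begin

text \<open>
  Upper bound: \<open>\<langle>f, U\<^sub>z e\<^sub>k\<rangle>\<close> is, up to a factor \<open>\<surd>(k+1)\<close>, the \<open>k\<close>-th Taylor coefficient of \<open>U\<^sub>z f\<close>, so
  for every radial weight \<open>h \<ge> 0\<close> orthogonality and the Moebius change of variables bound its
  square by a multiple of \<open>\<integral> |f(u)|\<^sup>2 h(|\<phi>\<^sub>z(u)|\<^sup>2) dA(u)\<close>. If \<open>h(|x|\<^sup>2)\<close> is the average of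
  \<open>(1 - |\<phi>\<^sub>v(x)|\<^sup>2)\<^sup>2\<close> over the circle \<open>|v|\<^sup>2 = s\<close>, then integrating \<open>h(|\<phi>\<^sub>z(u)|\<^sup>2) (1 - |z|\<^sup>2)\<^sup>-\<^sup>2\<close>
  against \<open>\<mu>\<close> gives an average of values of \<open>B\<^sub>0(\<mu>)\<close>. The choice \<open>s = k / (k + 4)\<close> yields the
  constant \<open>4 (k + 2)\<close>, with about one per cent to spare as \<open>k\<close> tends to infinity.

  Lower bound: test the form on the normalized reproducing kernels at the two points
  \<open>\<phi>\<^sub>z(\<plusminus>v)\<close>, \<open>v\<^sup>2 = (k + 1) / (k + 2)\<close>. For every \<open>\<zeta>\<close> one of the signs makes \<open>|1 - cnj(\<phi>\<^sub>z(\<zeta>)) (\<plusminus>v)|\<close>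
  at least \<open>1\<close>, and the corresponding density then dominates
  \<open>(1 - |\<phi>\<^sub>z(\<zeta>)|\<^sup>2)\<^sup>2\<close> up to a factor \<open>96 (k + 2)\<close>.

  That the embedding of \<open>A\<^sup>2\<close> in \<open>L\<^sup>2(\<mu>)\<close> forces \<open>B\<^sub>0(\<mu>)\<close> to be bounded follows from the Baire
  category theorem, applied to the coefficients of series of normalized kernels.
\<close>

section \<open>Change of variables for holomorphic maps\<close>

text \<open>Orthogonality of monomials needs a radial weight, but
  \<open>(1 - |\<phi>\<^sub>v(x)|\<^sup>2)\<^sup>2\<close> is not radial in \<open>x\<close>.
  Averaging over a circle of \<open>v\<close> repairs this, and Moebius invariance of
  \<open>phi_defect\<close> still turns the integral against \<mu> into values of \<open>B0\<close>.
  All that remains is the moment inequality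
  \<open>4 (k+1) (k+2) \<integral> t^k h(t) dt \<ge> 1\<close>. For \<open>s = k/(k+4)\<close> its
  left side tends to the integral of \<open>128 \<tau>^2 e^-\<tau> / (4+\<tau>)^3\<close> over
  positive \<tau>, about 1.008, so crude minorants of \<open>h\<close> fail.

  In the lower bound one test point \<open>\<phi>\<^sub>z(v)\<close> is not enough: for k > 0 the
  density \<open>(k+1) (1-d)^k d^2\<close>, \<open>d = phi_defect x v\<close>, vanishes at x = v,
  where d = 1. The opposite point -v covers that region. The density peaks at d = 2/(k+2), which
  explains the size of \<open>defect v\<close>.

  For this the diagonal of the form must be a genuine integral for every finite \<mu>, not the
  default value 0 of a Bochner integral; a Cauchy estimate provides it.\<close>

definition vec_complex :: "real^2 \<Rightarrow> complex" where
  "vec_complex x = Complex (vec_nth x 1) (vec_nth x 2)"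

definition complex_vec :: "complex \<Rightarrow> real^2" where
  "complex_vec z = vector [Re z, Im z]"

lemma vec_complex_inverse [simp]: "complex_vec (vec_complex x) = x"
  by (simp add: vec_complex_def complex_vec_def vec_eq_iff forall_2)

lemma complex_vec_inverse [simp]: "vec_complex (complex_vec z) = z"
  by (simp add: vec_complex_def complex_vec_def)

lemma linear_vec_complex: "linear vec_complex"
  by (intro linearI) (simp_all add: vec_complex_def complex_eq_iff)

lemma linear_complex_vec: "linear complex_vec"
  by (intro linearI) (simp_all add: complex_vec_def vec_eq_iff forall_2)

lemma norm_complex_vec [simp]: "norm (complex_vec z) = norm z"
  by (simp add: complex_vec_def norm_vec_def L2_set_def sum_2 cmod_def)

lemma measurable_vec_complex [measurable]: "vec_complex \<in> borel_measurable borel"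
  by (intro borel_measurable_continuous_onI linear_continuous_on linear_conv_bounded_linear[THEN iffD1] linear_vec_complex)

text \<open>Lebesgue measure is determined by its values on boxes, and \<open>vec_complex\<close>
  pulls boxes back to boxes with the same side lengths. This carries the change of variables, stated
  for \<open>real^'n\<close>, over to \<open>complex\<close>.\<close>

lemma lborel_complex_eq: "lborel = distr lborel borel vec_complex"
proof (rule lborel_eqI)
  fix l u :: complex
  assume lu: "\<And>b. b \<in> Basis \<Longrightarrow> l \<bullet> b \<le> u \<bullet> b"
  have le: "Re l \<le> Re u" "Im l \<le> Im u"
    using lu[of 1] lu[of \<i>] by (auto simp: Basis_complex_def)
  have vim: "vec_complex -` box l u = box (complex_vec l) (complex_vec u)"
    by (auto simp: mem_box_cart vec_complex_def complex_vec_def forall_2 in_box_complex_iff)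
  have "emeasure (distr lborel borel vec_complex) (box l u) = emeasure lborel (box (complex_vec l) (complex_vec u))"
    by (subst emeasure_distr) (simp_all add: vim)
  also have "\<dots> = ennreal (\<Prod>b\<in>Basis. (complex_vec u - complex_vec l) \<bullet> b)"
    using le by (intro emeasure_lborel_box) (auto simp: Basis_vec_def inner_axis complex_vec_def UNIV_2)
  also have "(\<Prod>b\<in>Basis. (complex_vec u - complex_vec l) \<bullet> b) = (Re u - Re l) * (Im u - Im l)"
    by (subst prod.UNION_disjoint[symmetric] | simp add: Basis_vec_def UNIV_2 inner_axis complex_vec_def axis_eq_axis)+
  also have "\<dots> = prod ((\<bullet>) (u - l)) Basis"
    by (simp add: Basis_complex_def)
  finally show "emeasure (distr lborel borel vec_complex) (box l u) = ennreal (prod ((\<bullet>) (u - l)) Basis)" .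
qed simp

text \<open>For c = p + iq the matrix has rows (p, -q) and (q, p); this is where the Cauchy-Riemann
  structure enters the Jacobian.\<close>

lemma det_complex_mult:
  "det (matrix (\<lambda>h. complex_vec (c * vec_complex h))) = (cmod c)\<^sup>2"
  unfolding det_2 matrix_def
  by (simp add: complex_vec_def vec_complex_def axis_def) (simp add: cmod_power2 flip: power2_eq_square)

lemma emeasure_lborel_complex:
  "A \<in> sets borel \<Longrightarrow> emeasure lborel A = emeasure lborel (vec_complex -` A)"
  by (subst lborel_complex_eq, subst emeasure_distr) auto

lemma nn_integral_lborel_complex:
  assumes "g \<in> borel_measurable borel"
  shows "(\<integral>\<^sup>+x. g (vec_complex x) \<partial>lborel) = (\<integral>\<^sup>+z. g z \<partial>lborel)"
  using assms by (subst lborel_complex_eq) (simp add: nn_integral_distr)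

text \<open>Area formula for \<open>real^2\<close> with Jacobian \<open>|f'|^2\<close>. The set
  \<open>S\<close> is merely Borel because it will be a preimage of a Borel set; boundedness of the
  image makes its measure a finite real number.\<close>

lemma emeasure_holomorphic_image:
  fixes f f' :: "complex \<Rightarrow> complex"
  assumes S: "S \<in> sets borel" and fS: "f ` S \<in> sets borel" "bounded (f ` S)"
    and der: "\<And>x. x \<in> S \<Longrightarrow> (f has_field_derivative f' x) (at x within S)"
    and inj: "inj_on f S" and meas: "f' \<in> borel_measurable (restrict_space borel S)"
  shows "emeasure lborel (f ` S) = (\<integral>\<^sup>+x\<in>S. ennreal ((cmod (f' x))\<^sup>2) \<partial>lborel)"
proof -
  define S' where "S' = vec_complex -` S"
  define F where "F x = complex_vec (f (vec_complex x))" for x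
  define F' where "F' x = (\<lambda>h. complex_vec (f' (vec_complex x) * vec_complex h))" for x
  have S'b: "S' \<in> sets borel"
    unfolding S'_def using measurable_sets[OF measurable_vec_complex S] by simp
  have FS': "F ` S' = vec_complex -` (f ` S)"
  proof (intro equalityI subsetI)
    fix x assume "x \<in> vec_complex -` (f ` S)"
    then obtain w where w: "w \<in> S" "vec_complex x = f w" by auto
    have "x = F (complex_vec w)"
      by (simp add: F_def flip: w(2))
    thus "x \<in> F ` S'" using w(1) by (auto simp: S'_def)
  qed (auto simp: F_def S'_def)
  have FSb: "F ` S' \<in> sets borel"
    unfolding FS' using measurable_sets[OF measurable_vec_complex fS(1)] by simp
  obtain B where B: "\<And>x. x \<in> f ` S \<Longrightarrow> norm x \<le> B"
    using fS(2) unfolding bounded_iff by blast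
  have "bounded (F ` S')"
    unfolding bounded_iff
  proof (intro exI[of _ B] ballI)
    fix y assume "y \<in> F ` S'"
    hence "vec_complex y \<in> f ` S" by (simp add: FS')
    from B[OF this] show "norm y \<le> B"
      by (metis norm_complex_vec vec_complex_inverse)
  qed
  hence lm: "F ` S' \<in> lmeasurable"
    using FSb by (intro bounded_set_imp_lmeasurable) auto
  have derF: "(F has_derivative F' x) (at x within S')" if "x \<in> S'" for x
  proof -
    have 1: "(f has_derivative (\<lambda>h. f' (vec_complex x) * h)) (at (vec_complex x) within vec_complex ` S')"
      using der[of "vec_complex x"] that has_derivative_subset[of f "(*) (f' (vec_complex x))" _ S "vec_complex ` S'"]
      by (auto simp: S'_def has_field_derivative_def)
    have 2: "(vec_complex has_derivative vec_complex) (at x within S')"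
      by (intro bounded_linear_imp_has_derivative linear_conv_bounded_linear[THEN iffD1] linear_vec_complex)
    have 3: "((\<lambda>x. f (vec_complex x)) has_derivative (\<lambda>h. f' (vec_complex x) * vec_complex h)) (at x within S')"
      using diff_chain_within[OF 2 1] by (simp add: o_def)
    show ?thesis
      unfolding F_def F'_def
      by (rule bounded_linear.has_derivative[OF _ 3]) (intro linear_conv_bounded_linear[THEN iffD1] linear_complex_vec)
  qed
  have injF: "inj_on F S'"
  proof (rule inj_onI)
    fix x y assume xy: "x \<in> S'" "y \<in> S'" "F x = F y"
    hence "f (vec_complex x) = f (vec_complex y)"
      unfolding F_def by (metis complex_vec_inverse)
    hence "vec_complex x = vec_complex y"
      using inj xy by (auto simp: S'_def inj_on_def)
    thus "x = y" by (metis vec_complex_inverse)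
  qed
  have "((\<lambda>x. \<bar>det (matrix (F' x))\<bar>) has_integral measure lebesgue (F ` S')) S'"
    using has_measure_differentiable_image[of S' F F' "measure lebesgue (F ` S')"] S'b derF injF lm by auto
  hence hi: "((\<lambda>x. (cmod (f' (vec_complex x)))\<^sup>2) has_integral measure lebesgue (F ` S')) S'"
    by (simp add: F'_def det_complex_mult)
  have mS: "(\<lambda>z. indicator S z *\<^sub>R f' z) \<in> borel_measurable borel"
    using meas S by (simp add: borel_measurable_restrict_space_iff)
  have mm: "(\<lambda>x. indicator S' x *\<^sub>R f' (vec_complex x)) \<in> borel_measurable borel"
    using measurable_compose[OF measurable_vec_complex mS]
    by (simp add: S'_def indicator_vimage o_def)
  have mm2: "(\<lambda>x. indicator S' x *\<^sub>R (cmod (f' (vec_complex x)))\<^sup>2) \<in> borel_measurable borel"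
  proof -
    have eq: "(\<lambda>x. indicator S' x *\<^sub>R (cmod (f' (vec_complex x)))\<^sup>2) = (\<lambda>x. (cmod (indicator S' x *\<^sub>R f' (vec_complex x)))\<^sup>2)"
      by (auto simp: indicator_def)
    show ?thesis unfolding eq by (intro borel_measurable_power measurable_compose[OF mm borel_measurable_norm])
  qed
  have "emeasure lborel (f ` S) = emeasure lborel (F ` S')"
    unfolding FS' using emeasure_lborel_complex[OF fS(1)] .
  also have "\<dots> = ennreal (measure lebesgue (F ` S'))"
    using emeasure_eq_measure2[OF lm] FSb by simp
  also have "\<dots> = (\<integral>\<^sup>+x. ennreal (indicator S' x *\<^sub>R (cmod (f' (vec_complex x)))\<^sup>2) \<partial>lborel)"
  proof (rule nn_integral_has_integral_lborel[symmetric, OF mm2])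
    have "((\<lambda>x. if x \<in> S' then (cmod (f' (vec_complex x)))\<^sup>2 else 0) has_integral measure lebesgue (F ` S')) UNIV"
      using hi by (simp only: has_integral_restrict_UNIV)
    thus "((\<lambda>x. indicator S' x *\<^sub>R (cmod (f' (vec_complex x)))\<^sup>2) has_integral measure lebesgue (F ` S')) UNIV"
      by (rule has_integral_eq[rotated]) (simp add: indicator_def)
  qed simp
  also have "\<dots> = (\<integral>\<^sup>+x. (\<lambda>z. ennreal ((cmod (indicator S z *\<^sub>R f' z))\<^sup>2)) (vec_complex x) \<partial>lborel)"
    by (intro nn_integral_cong) (auto simp: S'_def indicator_def)
  also have "\<dots> = (\<integral>\<^sup>+z. ennreal ((cmod (indicator S z *\<^sub>R f' z))\<^sup>2) \<partial>lborel)"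
    by (intro nn_integral_lborel_complex measurable_compose[OF _ measurable_ennreal] borel_measurable_power measurable_compose[OF mS borel_measurable_norm])
  also have "\<dots> = (\<integral>\<^sup>+x\<in>S. ennreal ((cmod (f' x))\<^sup>2) \<partial>lborel)"
    by (intro nn_integral_cong) (auto simp: indicator_def)
  finally show ?thesis .
qed

section \<open>Disc automorphisms\<close>

definition defect :: "complex \<Rightarrow> real" where "defect z = 1 - (cmod z)\<^sup>2"

text \<open>One minus the squared pseudohyperbolic distance: the Moebius invariant in which all
  later estimates are phrased.\<close>

definition phi_defect :: "complex \<Rightarrow> complex \<Rightarrow> real" where "phi_defect a b = 1 - (cmod (phi a b))\<^sup>2"

lemma of_real_defect: "of_real (defect z) = 1 - z * cnj z"
  unfolding defect_def of_real_diff of_real_1 by (simp only: complex_norm_square)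

lemma defect_pos: "cmod z < 1 \<Longrightarrow> 0 < defect z"
  by (simp add: defect_def power_less_one_iff abs_square_less_1)

lemma defect_le_1: "defect z \<le> 1"
  by (simp add: defect_def)

lemma one_minus_cnj_mult_nonzero: "cmod z < 1 \<Longrightarrow> cmod w \<le> 1 \<Longrightarrow> 1 - cnj z * w \<noteq> 0"
proof
  assume zw: "cmod z < 1" "cmod w \<le> 1" "1 - cnj z * w = 0"
  have "cmod (cnj z * w) \<le> cmod z"
    using mult_left_le[of "cmod w" "cmod z"] zw by (simp only: norm_mult complex_mod_cnj norm_ge_zero)
  moreover have "cnj z * w = 1" using zw(3) by (simp add: algebra_simps)
  ultimately have "1 \<le> cmod z" by simp
  thus False using zw(1) by simp
qed

lemma defect_mult_defect: "(cmod (1 - cnj a * b))\<^sup>2 - (cmod (a - b))\<^sup>2 = defect a * defect b"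
  unfolding defect_def cmod_power2 by (simp add: power2_eq_square algebra_simps)

lemma phi_defect_eq:
  assumes "cmod a < 1" "cmod b \<le> 1"
  shows "phi_defect a b = defect a * defect b / (cmod (1 - cnj a * b))\<^sup>2"
proof -
  have "(cmod (1 - cnj a * b))\<^sup>2 \<noteq> 0" using one_minus_cnj_mult_nonzero[OF assms] by simp
  thus ?thesis
    by (simp add: phi_defect_def phi_def norm_divide power_divide defect_mult_defect[symmetric] field_simps)
qed

lemma phi_defect_pos: "cmod a < 1 \<Longrightarrow> cmod b < 1 \<Longrightarrow> 0 < phi_defect a b"
  using one_minus_cnj_mult_nonzero[of a b] by (simp add: phi_defect_eq defect_pos)

lemma phi_defect_commute: "cmod a < 1 \<Longrightarrow> cmod b < 1 \<Longrightarrow> phi_defect a b = phi_defect b a"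
  by (simp add: phi_defect_eq) (metis cmod_diff_squared complex_cnj_cnj complex_cnj_diff complex_cnj_mult complex_cnj_one complex_mod_cnj mult.commute)

lemma phi_defect_le_1: "phi_defect a b \<le> 1" by (simp add: phi_defect_def)

lemma cmod_phi_less_1: "cmod z < 1 \<Longrightarrow> cmod w < 1 \<Longrightarrow> cmod (phi z w) < 1"
  using phi_defect_pos[of z w] by (simp add: phi_defect_def abs_square_less_1)

lemma cmod_phi_le_1: "cmod z < 1 \<Longrightarrow> cmod w \<le> 1 \<Longrightarrow> cmod (phi z w) \<le> 1"
proof -
  assume "cmod z < 1" "cmod w \<le> 1"
  hence "0 \<le> phi_defect z w" by (simp add: phi_defect_eq defect_def power_le_one abs_square_le_1 less_imp_le)
  thus ?thesis by (simp add: phi_defect_def abs_square_le_1)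
qed

lemma cmod_phi_power2: "(cmod (phi a b))\<^sup>2 = 1 - phi_defect a b" by (simp add: phi_defect_def)

lemma defect_phi: "defect (phi a b) = phi_defect a b" by (simp add: defect_def phi_defect_def)

lemma one_minus_cnj_phi_mult:
  assumes "cmod z < 1" "cmod w \<le> 1" "cmod v \<le> 1"
  shows "1 - cnj (phi z v) * phi z w = of_real (defect z) * (1 - cnj v * w) / (cnj (1 - cnj z * v) * (1 - cnj z * w))"
proof -
  have nz: "1 - cnj z * w \<noteq> 0" "1 - z * cnj v \<noteq> 0"
    using one_minus_cnj_mult_nonzero[OF assms(1,2)] one_minus_cnj_mult_nonzero[OF assms(1,3)]
    by auto (metis complex_cnj_cnj complex_cnj_mult complex_cnj_one)
  show ?thesis using nz
    by (simp add: phi_def of_real_defect divide_simps) (simp add: algebra_simps)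
qed

text \<open>In the closed form of \<open>phi_defect\<close> the factors \<open>defect z\<close>,
  \<open>|1 - cnj z a|\<close> and \<open>|1 - cnj z b|\<close> produced by the two images
  cancel.\<close>

lemma phi_defect_phi_phi:
  assumes z: "cmod z < 1" and a: "cmod a < 1" and b: "cmod b < 1"
  shows "phi_defect (phi z a) (phi z b) = phi_defect a b"
proof -
  have nz: "1 - cnj z * a \<noteq> 0" "1 - cnj z * b \<noteq> 0" "1 - cnj a * b \<noteq> 0" "defect z \<noteq> 0"
    using assms one_minus_cnj_mult_nonzero defect_pos[OF z] by (auto simp: less_imp_le)
  have *: "cmod (1 - z * cnj a) = cmod (1 - cnj z * a)"
    by (metis complex_cnj_cnj complex_cnj_diff complex_cnj_mult complex_cnj_one complex_mod_cnj)
  show ?thesis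
    using assms nz
    by (simp add: phi_defect_eq cmod_phi_less_1 less_imp_le defect_phi one_minus_cnj_phi_mult norm_mult norm_divide
         power_mult_distrib power_divide * )
       (simp add: field_simps power2_eq_square)
qed

lemma phi_phi: 
  assumes z: "cmod z < 1" and w: "cmod w \<le> 1"
  shows "phi z (phi z w) = w"
proof -
  have nz: "1 - cnj z * w \<noteq> 0" "1 - cnj z * z \<noteq> 0"
    using assms one_minus_cnj_mult_nonzero by auto
  have e: "1 - cnj z * phi z w = (1 - cnj z * z) / (1 - cnj z * w)"
    using nz by (simp add: phi_def field_simps)
  have f: "z - phi z w = w * (1 - cnj z * z) / (1 - cnj z * w)"
    using nz by (simp add: phi_def field_simps)
  show ?thesis unfolding phi_def[of z "phi z w"] e f using nz by simp
qed

text \<open>An explicit substitute for \<open>deriv (phi z)\<close>: it agrees with it away from the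
  pole and is visibly Borel in both arguments.\<close>

definition dphi :: "complex \<Rightarrow> complex \<Rightarrow> complex" where
  "dphi z w = - of_real (defect z) / (1 - cnj z * w)\<^sup>2"

lemma phi_has_field_derivative:
  assumes "1 - cnj z * w \<noteq> 0"
  shows "(phi z has_field_derivative dphi z w) (at w within A)"
proof -
  show ?thesis
    unfolding phi_def[abs_def] dphi_def of_real_defect
    using assms by (auto intro!: derivative_eq_intros simp: power2_eq_square) (simp_all add: divide_simps algebra_simps)
qed

lemma deriv_phi: "1 - cnj z * w \<noteq> 0 \<Longrightarrow> deriv (phi z) w = dphi z w"
  by (intro DERIV_imp_deriv phi_has_field_derivative)

text \<open>Equality case of Schwarz-Pick. It rewrites the integrand of \<open>B0\<close> as
  \<open>|dphi|^2\<close> and evaluates the form on reproducing kernels.\<close>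

lemma norm_dphi_mult_defect: 
  assumes "cmod z < 1" "cmod w < 1"
  shows "cmod (dphi z w) * defect w = phi_defect z w"
  using assms defect_pos[of z]
  by (simp add: phi_defect_eq less_imp_le dphi_def norm_divide norm_power)

text \<open>Chain rule for the involution \<open>phi z\<close>.\<close>

lemma dphi_phi:
  assumes z: "cmod z < 1" and w: "cmod w \<le> 1"
  shows "dphi z (phi z w) * dphi z w = 1"
proof -
  have nz: "1 - cnj z * w \<noteq> 0" "1 - cnj z * z \<noteq> 0"
    using assms one_minus_cnj_mult_nonzero by auto
  have e: "1 - cnj z * phi z w = of_real (defect z) / (1 - cnj z * w)"
    using nz by (simp add: phi_def of_real_defect) (simp add: field_simps)
  show ?thesis unfolding dphi_def e using nz defect_pos[OF z] by (simp add: power_divide flip: power2_eq_square)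
qed

lemma measurable_cnj [measurable]: "cnj \<in> borel_measurable borel"
  by (intro borel_measurable_continuous_onI continuous_intros)

lemma measurable_phi [measurable]: "phi z \<in> borel_measurable borel" "(\<lambda>z. phi z w) \<in> borel_measurable borel"
  unfolding phi_def[abs_def] by measurable

lemma measurable_dphi [measurable]: "dphi z \<in> borel_measurable borel"
  unfolding dphi_def[abs_def] by measurable

lemma measurable_defect [measurable]: "defect \<in> borel_measurable borel"
  unfolding defect_def[abs_def] by measurable

section \<open>The normalized area measure\<close>

lemma sets_dA [simp, measurable_cong]: "sets dA = sets borel"
  by (simp add: dA_def)

lemma space_dA [simp]: "space dA = UNIV"
  by (simp add: dA_def)

lemma nn_integral_dA:
  assumes "f \<in> borel_measurable borel"
  shows "(\<integral>\<^sup>+w. f w \<partial>dA) = (\<integral>\<^sup>+w\<in>ball 0 1. f w \<partial>lborel) / ennreal pi"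
proof -
  have [measurable]: "(\<lambda>w::complex. indicator (ball 0 1) w / pi :: real) \<in> borel_measurable borel"
    by (intro borel_measurable_divide borel_measurable_indicator borel_open) auto
  have "(\<integral>\<^sup>+w. f w \<partial>dA) = (\<integral>\<^sup>+w. ennreal (indicator (ball 0 1) w / pi) * f w \<partial>lborel)"
    unfolding dA_def using assms by (intro nn_integral_density) auto
  also have "\<dots> = (\<integral>\<^sup>+w. f w * indicator (ball 0 1) w / ennreal pi \<partial>lborel)"
    by (intro nn_integral_cong) (auto simp: indicator_def divide_ennreal_def inverse_ennreal field_simps)
  also have "\<dots> = (\<integral>\<^sup>+w\<in>ball 0 1. f w \<partial>lborel) / ennreal pi"
    using assms by (intro nn_integral_divide) (auto intro!: borel_measurable_times_ennreal borel_measurable_indicator)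
  finally show ?thesis .
qed

lemma emeasure_dA:
  assumes "A \<in> sets borel"
  shows "emeasure dA A = emeasure lborel (A \<inter> ball 0 1) / ennreal pi"
  using nn_integral_dA[of "indicator A"] assms
  by (simp add: indicator_inter_arith[symmetric] flip: nn_integral_indicator)

lemma AE_dA: "AE w in dA. w \<in> ball 0 1"
  unfolding dA_def by (subst AE_density) (auto simp: indicator_def)

lemma AE_dA_I: "(\<And>w. cmod w < 1 \<Longrightarrow> P w) \<Longrightarrow> AE w in dA. P w"
  using AE_dA by eventually_elim auto

lemma emeasure_dA_ball:
  assumes "0 \<le> r" "r \<le> 1"
  shows "emeasure dA (ball 0 r) = ennreal (r\<^sup>2)"
proof -
  have "ball 0 r \<inter> ball 0 1 = (ball 0 r :: complex set)" using assms by auto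
  thus ?thesis using assms
    by (simp add: emeasure_dA emeasure_ball unit_ball_vol_2 divide_ennreal)
qed

lemma emeasure_dA_UNIV: "emeasure dA UNIV = 1"
proof -
  have "emeasure dA (UNIV) = emeasure dA (ball 0 1)"
    using AE_dA by (intro emeasure_eq_AE) auto
  thus ?thesis using emeasure_dA_ball[of 1] by simp
qed

interpretation dA: finite_measure dA
  by standard (simp add: emeasure_dA_UNIV)

text \<open>The part of the preimage of \<open>B\<close> inside the disc is mapped bijectively onto
  the part of \<open>B\<close> inside the disc, so the area formula applies. The two instances are
  \<open>phi z\<close> and rotations.\<close>

lemma distr_dA_holomorphic:
  assumes f [measurable]: "f \<in> borel_measurable borel" and f' [measurable]: "f' \<in> borel_measurable borel"
    and der: "\<And>w. cmod w < 1 \<Longrightarrow> (f has_field_derivative f' w) (at w)"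
    and inj: "inj_on f (ball 0 1)" and im: "f ` ball 0 1 = ball 0 1"
  shows "distr (density dA (\<lambda>w. ennreal ((cmod (f' w))\<^sup>2))) borel f = dA"
proof (rule measure_eqI)
  fix B :: "complex set"
  assume "B \<in> sets (distr (density dA (\<lambda>w. ennreal ((cmod (f' w))\<^sup>2))) borel f)"
  hence B [measurable]: "B \<in> sets borel" by simp
  define X where "X = f -` B \<inter> ball 0 1"
  have fB: "f -` B \<in> sets borel" using measurable_sets[OF f B] by simp
  have X [measurable]: "X \<in> sets borel" using fB by (simp add: X_def)
  have "f ` X = B \<inter> f ` ball 0 1" by (auto simp: X_def)
  hence fX: "f ` X = B \<inter> ball 0 1" by (simp only: im)
  have "emeasure (distr (density dA (\<lambda>w. ennreal ((cmod (f' w))\<^sup>2))) borel f) B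
      = (\<integral>\<^sup>+w. ennreal ((cmod (f' w))\<^sup>2) * indicator (f -` B) w \<partial>dA)"
    using fB by (subst emeasure_distr) (auto simp: emeasure_density)
  also have "\<dots> = (\<integral>\<^sup>+w. ennreal ((cmod (f' w))\<^sup>2) * indicator (f -` B) w * indicator (ball 0 1) w \<partial>lborel) / ennreal pi"
    using fB by (subst nn_integral_dA) auto
  also have "(\<integral>\<^sup>+w. ennreal ((cmod (f' w))\<^sup>2) * indicator (f -` B) w * indicator (ball 0 1) w \<partial>lborel)
     = (\<integral>\<^sup>+w\<in>X. ennreal ((cmod (f' w))\<^sup>2) \<partial>lborel)"
    by (intro nn_integral_cong) (auto simp: X_def indicator_def)
  also have "\<dots> = emeasure lborel (f ` X)"
  proof (rule emeasure_holomorphic_image[symmetric])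
    show "f ` X \<in> sets borel" "bounded (f ` X)" by (auto simp: fX)
    show "inj_on f X" by (rule inj_on_subset[OF inj]) (auto simp: X_def)
    show "(f has_field_derivative f' x) (at x within X)" if "x \<in> X" for x
      using der[of x] that by (auto simp: X_def intro: has_field_derivative_at_within)
  qed (auto intro: measurable_restrict_space1)
  also have "emeasure lborel (f ` X) / ennreal pi = emeasure dA B"
    by (simp add: fX emeasure_dA)
  finally show "emeasure (distr (density dA (\<lambda>w. ennreal ((cmod (f' w))\<^sup>2))) borel f) B = emeasure dA B" .
qed simp

lemma distr_dA_phi:
  assumes z: "cmod z < 1"
  shows "distr (density dA (\<lambda>w. ennreal ((cmod (dphi z w))\<^sup>2))) borel (phi z) = dA"
proof (rule distr_dA_holomorphic)
  show "inj_on (phi z) (ball 0 1)"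
    by (rule inj_on_inverseI[of _ "phi z"]) (simp add: phi_phi z)
  show "phi z ` ball 0 1 = ball 0 1"
  proof (intro equalityI subsetI)
    fix w :: complex assume "w \<in> ball 0 1"
    thus "w \<in> phi z ` ball 0 1"
      using z cmod_phi_less_1[OF z, of w] by (intro image_eqI[of _ _ "phi z w"]) (auto simp: phi_phi)
  qed (use cmod_phi_less_1[OF z] in auto)
  show "(phi z has_field_derivative dphi z w) (at w)" if "cmod w < 1" for w
    using that z by (intro phi_has_field_derivative one_minus_cnj_mult_nonzero) auto
qed (rule measurable_phi measurable_dphi)+

lemma distr_dA_rotate:
  assumes c: "cmod c = 1"
  shows "distr dA borel ((*) c) = dA"
proof -
  have "distr (density dA (\<lambda>w. ennreal ((cmod ((\<lambda>_. c) w))\<^sup>2))) borel ((*) c) = dA"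
  proof (rule distr_dA_holomorphic)
    show "inj_on ((*) c) (ball 0 1)" using c by (auto simp: inj_on_def)
    have "w \<in> (*) c ` ball 0 1" if "cmod w < 1" for w
      using that c by (intro image_eqI[of _ _ "w / c"]) (auto simp: norm_divide)
    thus "(*) c ` ball 0 1 = ball 0 1" using c by (auto simp: norm_mult)
    show "((*) c has_field_derivative c) (at w)" for w
      by (auto intro!: derivative_eq_intros)
  qed (auto intro: borel_measurable_times borel_measurable_const measurable_ident_sets)
  moreover have "density dA (\<lambda>w. ennreal ((cmod ((\<lambda>_. c) w))\<^sup>2)) = dA"
    using c by (simp only: power_one ennreal_1 density_1)
  ultimately show ?thesis by (simp only:)
qed

text \<open>The disc of radius \<open>sqrt x\<close> has normalized area \<open>x\<close>, so the
  squared modulus is uniformly distributed; half-lines are an intersection-stable generator.\<close>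

lemma distr_dA_cmod2:
  "distr dA borel (\<lambda>w. (cmod w)\<^sup>2) = density lborel (indicator {0..1::real})"
proof -
  let ?M = "distr dA borel (\<lambda>w. (cmod w)\<^sup>2)" and ?N = "density lborel (indicator {0..1::real})"
  have vim: "(\<lambda>w::complex. (cmod w)\<^sup>2) -` {..<x} \<in> sets borel" for x
    using measurable_sets[of "\<lambda>w::complex. (cmod w)\<^sup>2" borel borel "{..<x}"] by simp
  have eq: "emeasure ?M {..<x} = emeasure ?N {..<x}" for x :: real
  proof -
    have M: "emeasure ?M {..<x} = emeasure dA ((\<lambda>w. (cmod w)\<^sup>2) -` {..<x})"
      by (subst emeasure_distr) auto
    have N: "emeasure ?N {..<x} = emeasure lborel ({0..1} \<inter> {..<x})"
      by (subst emeasure_density) (auto simp: indicator_inter_arith[symmetric])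
    consider "x \<le> 0" | "0 < x" "x \<le> 1" | "1 < x" by linarith
    thus ?thesis
    proof cases
      case 1
      hence "(\<lambda>w::complex. (cmod w)\<^sup>2) -` {..<x} = {}" "{0..1} \<inter> {..<x} = {}"
        by (auto simp: not_less dest: order.strict_trans2)
      thus ?thesis by (simp only: M N) simp
    next
      case 2
      have "(\<lambda>w::complex. (cmod w)\<^sup>2) -` {..<x} = ball 0 (sqrt x)"
        using 2 real_sqrt_less_iff[of "(cmod w)\<^sup>2" x for w :: complex] by auto
      moreover have "{0..1} \<inter> {..<x} = {0..<x}" using 2 by auto
      ultimately show ?thesis unfolding M N using 2 by (simp add: emeasure_dA_ball)
    next
      case 3
      have "emeasure dA ((\<lambda>w. (cmod w)\<^sup>2) -` {..<x}) = emeasure dA (space dA)"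
      proof (intro emeasure_eq_AE AE_dA_I)
        fix w :: complex assume "cmod w < 1"
        hence "(cmod w)\<^sup>2 \<le> 1" by (simp add: power_le_one)
        thus "w \<in> (\<lambda>w. (cmod w)\<^sup>2) -` {..<x} \<longleftrightarrow> w \<in> space dA" using 3 by simp
      qed (auto simp: vim)
      moreover have "{0..1} \<inter> {..<x} = {0..1}" using 3 by auto
      ultimately show ?thesis unfolding M N by (simp add: emeasure_dA_UNIV)
    qed
  qed
  show ?thesis
  proof (rule measure_eqI_generator_eq[where E="range lessThan" and \<Omega>=UNIV and A="\<lambda>i. {..<real i}"])
    show "Int_stable (range (lessThan :: real \<Rightarrow> _))"
    proof (rule Int_stableI)
      fix a b :: "real set" assume "a \<in> range lessThan" "b \<in> range lessThan"
      then obtain x y where "a = {..<x}" "b = {..<y}" by auto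
      hence "a \<inter> b = {..<min x y}" by auto
      thus "a \<inter> b \<in> range lessThan" by blast
    qed
    show "(\<Union>i. {..<real i}) = UNIV" using reals_Archimedean2 by blast
    show "emeasure ?M {..<real i} \<noteq> \<infinity>" for i
      by (subst emeasure_distr) auto
    show "sets ?M = sigma_sets UNIV (range lessThan)"
      by (simp, subst borel_Iio, simp)
    show "sets ?N = sigma_sets UNIV (range lessThan)"
      by (simp, subst borel_Iio, simp)
  qed (use eq in auto)
qed

section \<open>The radial weight and its moments\<close>

text \<open>Closed form of the circle average \<open>h\<close> of the overview, with t the squared
  modulus of x.\<close>

definition annular_weight :: "real \<Rightarrow> real \<Rightarrow> real" where
  "annular_weight s t = (1 - s)\<^sup>2 * (1 - t)\<^sup>2 * (1 + s * t) / (1 - s * t) ^ 3"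

text \<open>The Beta function at (k+1, m+1).\<close>

definition beta_nat :: "nat \<Rightarrow> nat \<Rightarrow> real" where
  "beta_nat k m = fact k * fact m / fact (k + m + 1)"

text \<open>Induction on m through \<open>(1-t)^(m+1) = (1-t)^m - t (1-t)^m\<close>; the second term
  raises k, which therefore varies.\<close>

lemma has_integral_power_mult_power:
  "((\<lambda>t::real. t ^ k * (1 - t) ^ m) has_integral beta_nat k m) {0..1}"
proof (induction m arbitrary: k)
  case 0
  have "((\<lambda>t::real. t ^ k) has_integral (1 ^ Suc k / real (Suc k) - 0 ^ Suc k / real (Suc k))) {0..1}"
    by (intro fundamental_theorem_of_calculus)
       (auto intro!: derivative_eq_intros simp flip: has_real_derivative_iff_has_vector_derivative simp del: power_Suc of_nat_Suc)
  thus ?case by (simp add: beta_nat_def)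
next
  case (Suc m)
  have "((\<lambda>t::real. t ^ k * (1 - t) ^ m - t ^ Suc k * (1 - t) ^ m) has_integral (beta_nat k m - beta_nat (Suc k) m)) {0..1}"
    by (intro has_integral_diff Suc.IH)
  also have "(\<lambda>t::real. t ^ k * (1 - t) ^ m - t ^ Suc k * (1 - t) ^ m) = (\<lambda>t. t ^ k * (1 - t) ^ Suc m)"
    by (auto simp: algebra_simps)
  also have "beta_nat k m - beta_nat (Suc k) m = beta_nat k (Suc m)"
  proof -
    have e: "fact (k + m + 2) = real (k + m + 2) * fact (k + m + 1)"
      by (simp add: fact_reduce)
    have "beta_nat k m = real (k + m + 2) * (fact k * fact m) / fact (k + m + 2)"
      unfolding beta_nat_def e by simp
    moreover have "beta_nat (Suc k) m = real (Suc k) * (fact k * fact m) / fact (k + m + 2)"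
      by (simp add: beta_nat_def)
    moreover have "beta_nat k (Suc m) = real (Suc m) * (fact k * fact m) / fact (k + m + 2)"
      by (simp add: beta_nat_def)
    ultimately show ?thesis
      by (simp only: diff_divide_distrib[symmetric] left_diff_distrib[symmetric]) simp
  qed
  finally show ?case .
qed

text \<open>The polynomial interpolates \<open>1 / Y\<^sup>3\<close> to second order at the nodes \<open>5, 7, 10, 15\<close>, which makes
  the error a square times a positive quadratic. The nodes were tuned numerically for the limit weight
  \<open>\<tau>\<^sup>2 e\<^sup>-\<^sup>\<tau>\<close> in \<open>\<tau> = Y - 4 = k (1 - t)\<close>, where less than one per cent may be lost.\<close>

lemma inverse_cube_lower_bound:
  fixes Y :: real
  assumes "0 < Y"
  shows "105665000000 - 68795813125 * Y + 20012698750 * Y^2 - 3291221875 * Y^3 + 326198500 * Y^4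
     - 19332667 * Y^5 + 631262 * Y^6 - 8733 * Y^7 \<le> 405168750000 / Y ^ 3" (is "?p \<le> _")
proof -
  have "405168750000 - Y ^ 3 * ?p = ((Y - 5) * (Y - 7) * (Y - 10) * (Y - 15))\<^sup>2 * (14700 + 14980 * Y + 8733 * Y\<^sup>2)"
    by algebra
  also have "\<dots> \<ge> 0" using assms by simp
  finally show ?thesis using assms by (simp add: field_simps)
qed

text \<open>For s = k/(k+4) all powers of k+4 cancel and the weight is
  \<open>16 u^2 (2k+8-Y) / Y^3\<close> with \<open>Y = 4 + k u\<close>. The minorant of
  \<open>1/Y^3\<close> is inserted and re-expanded in \<open>k u\<close>, which leaves a polynomial
  in u whose moments are Beta integrals.\<close>

lemma annular_weight_lower_bound:
  fixes k t :: real
  assumes k: "0 \<le> k" and t: "0 \<le> t" "t \<le> 1"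
  defines "u \<equiv> 1 - t"
  shows "16 / 405168750000 * (u\<^sup>2 * (2 * k + 4 - k * u) * (6199460172 - 4283789733 * (k * u) + 1696437018 * (k * u)^2
    - 435504915 * (k * u)^3 + 71486120 * (k * u)^4 - 7116667 * (k * u)^5 + 386738 * (k * u)^6 - 8733 * (k * u)^7))
    \<le> annular_weight (k / (k + 4)) t" (is "_ * (_ * _ * ?r) \<le> _")
proof -
  define Y where "Y = 4 + k * u"
  have u: "0 \<le> u" "u \<le> 1" using t by (auto simp: u_def)
  have Y: "0 < Y" "Y \<le> 4 + k" using u k by (auto simp: Y_def mult_left_le intro: add_pos_nonneg)
  have e1: "1 - k / (k + 4) * t = Y / (k + 4)" "1 - k / (k + 4) = 4 / (k + 4)" "1 + k / (k + 4) * t = (2 * k + 8 - Y) / (k + 4)"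
    using k by (auto simp: Y_def u_def field_simps)
  have w: "annular_weight (k / (k + 4)) t = (4 / (k + 4))\<^sup>2 * u\<^sup>2 * ((2 * k + 8 - Y) / (k + 4)) / (Y / (k + 4)) ^ 3"
    unfolding annular_weight_def e1 by (simp add: u_def)
  also have "\<dots> = 16 * (u\<^sup>2 * (2 * k + 8 - Y)) / Y ^ 3"
    using k Y by (simp add: divide_simps) (simp add: power2_eq_square power3_eq_cube)
  finally have w: "annular_weight (k / (k + 4)) t = 16 / 405168750000 * (u\<^sup>2 * (2 * k + 8 - Y)) * (405168750000 / Y ^ 3)"
    by simp
  have r: "?r = 105665000000 - 68795813125 * Y + 20012698750 * Y^2 - 3291221875 * Y^3 + 326198500 * Y^4
     - 19332667 * Y^5 + 631262 * Y^6 - 8733 * Y^7"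
    unfolding Y_def by algebra
  have "2 * k + 4 - k * u = 2 * k + 8 - Y" by (simp add: Y_def)
  hence "16 / 405168750000 * (u\<^sup>2 * (2 * k + 4 - k * u) * ?r) = 16 / 405168750000 * (u\<^sup>2 * (2 * k + 8 - Y)) * ?r"
    by simp
  also have "\<dots> \<le> 16 / 405168750000 * (u\<^sup>2 * (2 * k + 8 - Y)) * (405168750000 / Y ^ 3)"
    unfolding r using Y k by (intro mult_left_mono inverse_cube_lower_bound) auto
  finally show ?thesis unfolding w .
qed

lemma annular_weight_nonneg: "0 \<le> s \<Longrightarrow> s < 1 \<Longrightarrow> 0 \<le> t \<Longrightarrow> t \<le> 1 \<Longrightarrow> 0 \<le> annular_weight s t"
  unfolding annular_weight_def
  by (intro divide_nonneg_nonneg mult_nonneg_nonneg zero_le_power) (auto simp: mult_le_one)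

lemma one_minus_mult_pos: "0 \<le> s \<Longrightarrow> s < 1 \<Longrightarrow> 0 \<le> t \<Longrightarrow> t \<le> 1 \<Longrightarrow> 0 < 1 - s * (t::real)"
  using mult_left_le[of t s] by simp

lemma continuous_on_annular_weight: "0 \<le> s \<Longrightarrow> s < 1 \<Longrightarrow> continuous_on {0..1} (annular_weight s)"
  unfolding annular_weight_def[abs_def]
  by (intro continuous_intros) (use one_minus_mult_pos in force)

text \<open>Exhibits the moments as rational functions of k, so that the moment inequality becomes
  one between polynomials in k.\<close>

lemma beta_nat_shift:
  "beta_nat k m = fact m / (\<Prod>i=1..m+1. (real k + real i))"
proof (induction m)
  case 0
  show ?case by (simp add: beta_nat_def fact_reduce[of "Suc k"] field_simps del: fact_Suc) (simp add: add_nonneg_eq_0_iff)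
next
  case (Suc m)
  have "beta_nat k (Suc m) = real (Suc m) * beta_nat k m / (real k + real (m + 2))"
    by (simp add: beta_nat_def field_simps)
  also have "\<dots> = fact (Suc m) / (\<Prod>i=1..Suc m+1. (real k + real i))"
    by (simp add: Suc.IH)
  finally show ?case .
qed

text \<open>With the polynomial minorant and denominators cleared, the difference of the two sides
  is a polynomial of degree 9 in k with positive coefficients, which settles all k at once.\<close>

lemma integral_annular_weight:
  fixes k :: nat
  defines "s \<equiv> real k / (real k + 4)"
  shows "1 \<le> 4 * (real k + 1) * (real k + 2) * integral {0..1} (\<lambda>t. t ^ k * annular_weight s t)"
proof -
  define x where "x = real k"
  have x: "0 \<le> x" by (simp add: x_def)
  have s: "0 \<le> s" "s < 1" by (auto simp: s_def)
  define L :: real where "L = 405168750000"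
  define c :: "nat \<Rightarrow> real" where "c m = [6199460172, -4283789733, 1696437018, -435504915, 71486120, -7116667, 386738, -8733] ! m" for m
  \<comment> \<open>\<open>C m\<close> is the coefficient of \<open>(x u)^m\<close> in the product
    of \<open>2x + 4 - x u\<close> with the minorant of degree 7.\<close>
  define C where "C m = (2 * x + 4) * (if m < 8 then c m else 0) - (if m = 0 then 0 else c (m - 1))" for m
  have C: "C 0 = 6199460172 * (2 * x + 4)" "C 1 = -4283789733 * (2 * x + 4) + (-6199460172)" "C 2 = 1696437018 * (2 * x + 4) + (4283789733)" "C 3 = -435504915 * (2 * x + 4) + (-1696437018)" "C 4 = 71486120 * (2 * x + 4) + (435504915)" "C 5 = -7116667 * (2 * x + 4) + (-71486120)" "C 6 = 386738 * (2 * x + 4) + (7116667)" "C 7 = -8733 * (2 * x + 4) + (-386738)" "C 8 = (8733)"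
    by (simp_all add: C_def c_def eval_nat_numeral algebra_simps)
  have sum8: "(\<Sum>m\<le>8. f m) = f 0 + f 1 + f 2 + f 3 + f 4 + f 5 + f 6 + f 7 + f 8" for f :: "nat \<Rightarrow> real"
    by (simp add: eval_nat_numeral)
  have "((\<lambda>t. \<Sum>m\<le>8. 16 / L * C m * x ^ m * (t ^ k * (1 - t) ^ (m + 2))) has_integral (\<Sum>m\<le>8. 16 / L * C m * x ^ m * beta_nat k (m + 2))) {0..1}"
    by (intro has_integral_sum has_integral_mult_right has_integral_power_mult_power) auto
  moreover have "((\<lambda>t. t ^ k * annular_weight s t) has_integral integral {0..1} (\<lambda>t. t ^ k * annular_weight s t)) {0..1}"
    by (intro integrable_integral integrable_continuous_real continuous_intros continuous_on_annular_weight s)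
  ultimately have le: "(\<Sum>m\<le>8. 16 / L * C m * x ^ m * beta_nat k (m + 2)) \<le> integral {0..1} (\<lambda>t. t ^ k * annular_weight s t)"
  proof (rule has_integral_le)
    fix t :: real assume t: "t \<in> {0..1}"
    define u where "u = 1 - t"
    have ur: "(\<Sum>m\<le>8. C m * x ^ m * u ^ (m + 2)) = u\<^sup>2 * (2 * x + 4 - x * u) *
      (6199460172 - 4283789733 * (x * u) + 1696437018 * (x * u)^2 - 435504915 * (x * u)^3
       + 71486120 * (x * u)^4 - 7116667 * (x * u)^5 + 386738 * (x * u)^6 - 8733 * (x * u)^7)" (is "_ = ?r")
      unfolding sum8 C by (simp only: add_0_left arith_simps one_plus_numeral power_0 power_one_right mult_1_right) algebra
    have "(\<Sum>m\<le>8. 16 / L * C m * x ^ m * (t ^ k * u ^ (m + 2))) = t ^ k * (16 / L * ?r)"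
      unfolding ur[symmetric] by (simp add: sum_distrib_left mult_ac)
    also have "\<dots> \<le> t ^ k * annular_weight s t"
      using t annular_weight_lower_bound[of x t] x unfolding s_def x_def L_def u_def
      by (intro mult_left_mono) auto
    finally show "(\<Sum>m\<le>8. 16 / L * C m * x ^ m * (t ^ k * (1 - t) ^ (m + 2))) \<le> t ^ k * annular_weight s t"
      unfolding u_def .
  qed
  \<comment> \<open>The prefactor \<open>(x+1) (x+2)\<close> cancels the first two factors of each
    denominator, so the common denominator \<open>D\<close> starts at x+3; \<open>P m\<close> is the
    cofactor left by the m-th term.\<close>
  define P where "P m = (\<Prod>i=m+4..11. x + real i)" for m
  define D where "D = (\<Prod>i=3..11. x + real i)"
  have D: "D > 0" unfolding D_def using x by (intro prod_pos) auto
  have b: "4 * (x + 1) * (x + 2) * beta_nat k (m + 2) = 4 * fact (m + 2) * P m / D" if "m \<le> 8" for m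
  proof -
    have "{1..m+3} \<union> {m+4..11} = {1,2} \<union> {3..11}" "{1..m+3} \<inter> {m+4..11} = {}" using that by auto
    hence "(\<Prod>i=1..m+3. x + real i) * P m = (\<Prod>i\<in>{1,2} \<union> {3..11}. x + real i)"
      unfolding P_def by (metis finite_atLeastAtMost prod.union_disjoint)
    also have "\<dots> = (x + 1) * (x + 2) * D"
      unfolding D_def by (subst prod.union_disjoint) auto
    finally have e: "(\<Prod>i=1..m+3. x + real i) * P m = (x + 1) * (x + 2) * D" .
    have "(\<Prod>i=1..m+3. x + real i) > 0" using x by (intro prod_pos) auto
    moreover have "beta_nat k (m + 2) = fact (m + 2) / (\<Prod>i=1..m+3. x + real i)"
      unfolding x_def beta_nat_shift by (simp only: add.assoc) simp
    moreover have "4 * (x + 1) * (x + 2) * (F / Q) = 4 * F * P m / D" if "Q > 0" "Q * P m = (x + 1) * (x + 2) * D" for F Q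
    proof -
      have "4 * (x + 1) * (x + 2) * (F / Q) = 4 * F * ((x + 1) * (x + 2) * D) / (Q * D)"
        using D by simp
      also have "\<dots> = 4 * F * P m / D" unfolding that(2)[symmetric] using that(1) by simp
      finally show ?thesis .
    qed
    ultimately show ?thesis using e by simp
  qed
  have "4 * (x + 1) * (x + 2) * (\<Sum>m\<le>8. 16 / L * C m * x ^ m * beta_nat k (m + 2)) =
    (\<Sum>m\<le>8. 16 / L * C m * x ^ m * (4 * (x + 1) * (x + 2) * beta_nat k (m + 2)))"
    by (simp add: sum_distrib_left mult_ac)
  also have "\<dots> = (\<Sum>m\<le>8. 64 / L * C m * x ^ m * fact (m + 2) * P m) / D"
    unfolding sum_divide_distrib by (intro sum.cong refl, subst b) auto
  finally have e: "4 * (x + 1) * (x + 2) * (\<Sum>m\<le>8. 16 / L * C m * x ^ m * beta_nat k (m + 2)) = \<dots>" .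
  have P: "P 0 = (x + 4) * (x + 5) * (x + 6) * (x + 7) * (x + 8) * (x + 9) * (x + 10) * (x + 11)" "P 1 = (x + 5) * (x + 6) * (x + 7) * (x + 8) * (x + 9) * (x + 10) * (x + 11)" "P 2 = (x + 6) * (x + 7) * (x + 8) * (x + 9) * (x + 10) * (x + 11)" "P 3 = (x + 7) * (x + 8) * (x + 9) * (x + 10) * (x + 11)" "P 4 = (x + 8) * (x + 9) * (x + 10) * (x + 11)" "P 5 = (x + 9) * (x + 10) * (x + 11)" "P 6 = (x + 10) * (x + 11)" "P 7 = (x + 11)" "P 8 = 1"
    by (simp_all add: P_def numeral_eq_Suc atLeastAtMostSuc_conv)
  have D': "D = (x + 3) * P 0"
    unfolding P by (simp add: D_def numeral_eq_Suc atLeastAtMostSuc_conv)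
  have F: "fact (0 + 2) = (2 :: real)" "fact (1 + 2) = (6 :: real)" "fact (2 + 2) = (24 :: real)" "fact (3 + 2) = (120 :: real)" "fact (4 + 2) = (720 :: real)" "fact (5 + 2) = (5040 :: real)" "fact (6 + 2) = (40320 :: real)" "fact (7 + 2) = (362880 :: real)" "fact (8 + 2) = (3628800 :: real)"
    by (simp_all add: fact_numeral)
  \<comment> \<open>The coefficient of \<open>x^9\<close> is about 0.35 per cent of
    \<open>L\<close>: the margin that survives as k grows.\<close>
  have "(\<Sum>m\<le>8. 64 * C m * x ^ m * fact (m + 2) * P m) - L * D = 13030289559728179200 * x ^ 0 + 8420816974035260160 * x ^ 1 + 3445857300235869504 * x ^ 2 + 800306338263222528 * x ^ 3 + 130310163579126960 * x ^ 4 + 12073145203778256 * x ^ 5 + 908972149117536 * x ^ 6 + 28606811016672 * x ^ 7 + 697932569520 * x ^ 8 + 1401543504 * x ^ 9"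
    unfolding sum8 D' L_def F by (simp only: C P power_0 power_one_right) algebra
  also have "\<dots> \<ge> 0" using x by simp
  finally have "L * D \<le> (\<Sum>m\<le>8. 64 * C m * x ^ m * fact (m + 2) * P m)" by simp
  hence "1 \<le> (\<Sum>m\<le>8. 64 * C m * x ^ m * fact (m + 2) * P m) / L / D"
    using D by (simp add: L_def pos_le_divide_eq mult.commute)
  also have "\<dots> = (\<Sum>m\<le>8. 64 / L * C m * x ^ m * fact (m + 2) * P m) / D"
    by (simp only: sum_divide_distrib times_divide_eq_left)
  also have "\<dots> \<le> 4 * (x + 1) * (x + 2) * integral {0..1} (\<lambda>t. t ^ k * annular_weight s t)"
    unfolding e[symmetric] using le x by (intro mult_left_mono) auto
  finally show ?thesis by (simp add: x_def)
qed

section \<open>Circle averages of the Berezin kernel\<close>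

text \<open>For |e| = 1 the conjugate of \<open>1 - y e\<close> is \<open>(e - cnj y) / e\<close>.
  The integrand is therefore \<open>e F(e) / (e - cnj y)^2\<close> with
  \<open>F w = w / (1 - y w)^2\<close> holomorphic across the closed disc, and Cauchy's formula for
  the derivative gives \<open>F'\<close> at \<open>cnj y\<close>.\<close>

lemma circle_average_inverse_power4:
  assumes y: "cmod y < 1"
  shows "((\<lambda>t. 1 / cmod (1 - y * exp (2 * of_real pi * \<i> * of_real t)) ^ 4) has_integral
           (1 + (cmod y)\<^sup>2) / (1 - (cmod y)\<^sup>2) ^ 3) {0..1}"
proof -
  define e where "e t = exp (2 * of_real pi * \<i> * of_real t)" for t :: real
  define F where "F w = w / (1 - y * w)\<^sup>2" for w
  have ne: "cmod (e t) = 1" for t by (simp add: e_def norm_exp_eq_Re)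
  have nz: "1 - y * w \<noteq> 0" if "cmod w \<le> 1" for w
    using one_minus_cnj_mult_nonzero[of "cnj y" w] y that by simp
  have F: "(F has_field_derivative ((1 + y * w) / (1 - y * w) ^ 3)) (at w)" if "cmod w \<le> 1" for w
  proof -
    have "(F has_field_derivative (1 * (1 - y * w)\<^sup>2 - w * (2 * (1 - y * w) * (- y))) / ((1 - y * w)\<^sup>2 * (1 - y * w)\<^sup>2)) (at w)"
      unfolding F_def using nz[OF that] by (auto intro!: derivative_eq_intros simp: power2_eq_square)
    also have "(1 * (1 - y * w)\<^sup>2 - w * (2 * (1 - y * w) * (- y))) / ((1 - y * w)\<^sup>2 * (1 - y * w)\<^sup>2) = (1 + y * w) / (1 - y * w) ^ 3"
    proof -
      define b where "b = 1 - y * w"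
      have yw: "y * w = 1 - b" by (simp add: b_def)
      have "b \<noteq> 0" using nz[OF that] by (simp add: b_def)
      hence "(1 * b\<^sup>2 - w * (2 * b * (- y))) / (b\<^sup>2 * b\<^sup>2) = (b\<^sup>2 + 2 * b * (y * w)) / (b\<^sup>2 * b\<^sup>2)"
        by simp
      also have "\<dots> = (1 + y * w) / b ^ 3"
        using \<open>b \<noteq> 0\<close> unfolding yw by (simp add: divide_simps) (simp add: eval_nat_numeral algebra_simps)
      finally show ?thesis by (simp add: b_def)
    qed
    finally show ?thesis .
  qed
  have cont: "continuous_on (cball 0 1) F"
    using F by (intro continuous_at_imp_continuous_on ballI) (auto intro: DERIV_isCont)
  have hol: "F holomorphic_on ball 0 1"
    by (subst holomorphic_on_open) (auto intro!: F exI)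
  have yb: "cnj y \<in> ball 0 1" using y by simp
  note C = Cauchy_derivative_integral_circlepath[OF cont hol yb]
  have nn: "y * cnj y = of_real ((cmod y)\<^sup>2)" by (simp only: complex_norm_square)
  have "1 / (2 * of_real pi * \<i>) * contour_integral (circlepath 0 1) (\<lambda>u. F u / (u - cnj y)\<^sup>2) = (1 + y * cnj y) / (1 - y * cnj y) ^ 3"
    using DERIV_unique[OF C(2) F[of "cnj y"]] y by simp
  hence "((\<lambda>u. F u / (u - cnj y)\<^sup>2) has_contour_integral (2 * of_real pi * \<i>) * ((1 + y * cnj y) / (1 - y * cnj y) ^ 3)) (circlepath 0 1)"
    using has_contour_integral_integral[OF C(1)] by (simp add: field_simps)
  hence "((\<lambda>t. F (circlepath 0 1 t) / (circlepath 0 1 t - cnj y)\<^sup>2 * vector_derivative (circlepath 0 1) (at t)) has_integral (2 * of_real pi * \<i>) * ((1 + y * cnj y) / (1 - y * cnj y) ^ 3)) {0..1}"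
    by (simp only: has_contour_integral)
  hence "((\<lambda>t. F (e t) / (e t - cnj y)\<^sup>2 * (2 * of_real pi * \<i> * e t)) has_integral (2 * of_real pi * \<i>) * ((1 + y * cnj y) / (1 - y * cnj y) ^ 3)) {0..1}"
    by (rule has_integral_eq[rotated]) (simp add: vector_derivative_circlepath, simp add: e_def circlepath)
  hence "((\<lambda>t. 1 / (2 * of_real pi * \<i>) * (F (e t) / (e t - cnj y)\<^sup>2 * (2 * of_real pi * \<i> * e t))) has_integral 1 / (2 * of_real pi * \<i>) * ((2 * of_real pi * \<i>) * ((1 + y * cnj y) / (1 - y * cnj y) ^ 3))) {0..1}"
    by (rule has_integral_mult_right)
  moreover have "1 / (2 * of_real pi * \<i>) * (F (e t) / (e t - cnj y)\<^sup>2 * (2 * of_real pi * \<i> * e t)) = of_real (1 / cmod (1 - y * e t) ^ 4)" for t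
  proof -
    define E where "E = e t"
    have "E * cnj E = of_real ((cmod E)\<^sup>2)" by (simp only: complex_norm_square)
    hence E: "cnj E * E = 1" "E \<noteq> 0" using ne[of t] by (auto simp: E_def mult.commute)
    have nz1: "1 - y * E \<noteq> 0" using nz[of E] ne[of t] by (simp add: E_def)
    have "E - cnj y = E * cnj (1 - y * E)" using E by (simp add: algebra_simps)
    hence "F E / (E - cnj y)\<^sup>2 * E = E\<^sup>2 / ((1 - y * E)\<^sup>2 * (E * cnj (1 - y * E))\<^sup>2)"
      by (simp add: F_def power2_eq_square)
    also have "\<dots> = 1 / ((1 - y * E) * cnj (1 - y * E))\<^sup>2"
      using E by (simp add: power_mult_distrib)
    also have "(1 - y * E) * cnj (1 - y * E) = of_real ((cmod (1 - y * E))\<^sup>2)"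
      by (simp only: complex_norm_square)
    finally have "F E / (E - cnj y)\<^sup>2 * E = of_real (1 / cmod (1 - y * E) ^ 4)" by simp
    moreover have "1 / c * (A * (c * E)) = A * E" if "c \<noteq> 0" for c A :: complex
      using that by simp
    from this[of "2 * of_real pi * \<i>"]
    have "1 / (2 * of_real pi * \<i>) * (A * (2 * of_real pi * \<i> * E)) = A * E" for A
      by simp
    ultimately show ?thesis by (simp only: E_def)
  qed
  ultimately have "((\<lambda>t. of_real (1 / cmod (1 - y * e t) ^ 4) :: complex) has_integral (1 + y * cnj y) / (1 - y * cnj y) ^ 3) {0..1}"
    by simp
  from has_integral_linear[OF this bounded_linear_Re]
  have "((\<lambda>t. 1 / cmod (1 - y * e t) ^ 4) has_integral Re ((1 + y * cnj y) / (1 - y * cnj y) ^ 3)) {0..1}"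
    by (simp add: o_def)
  also have "(1 + y * cnj y) / (1 - y * cnj y) ^ 3 = of_real ((1 + (cmod y)\<^sup>2) / (1 - (cmod y)\<^sup>2) ^ 3)"
    unfolding nn by simp
  finally show ?thesis by (simp add: e_def)
qed

text \<open>In the closed form of \<open>phi_defect\<close> only \<open>|1 - cnj v x|\<close> varies
  along the circle; conjugating it gives \<open>|1 - y e|\<close> with
  \<open>y = sqrt s * cnj x\<close>.\<close>

lemma annular_weight_eq_circle_average:
  assumes s: "0 \<le> s" "s < 1" and x: "cmod x < 1"
  shows "(\<integral>\<^sup>+t\<in>{0..1}. ennreal ((phi_defect (of_real (sqrt s) * exp (2 * of_real pi * \<i> * of_real t)) x)\<^sup>2) \<partial>lborel)
    = ennreal (annular_weight s ((cmod x)\<^sup>2))"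
proof -
  define e where "e t = exp (2 * of_real pi * \<i> * of_real t)" for t :: real
  have ne: "cmod (e t) = 1" for t by (simp add: e_def norm_exp_eq_Re)
  define y where "y = of_real (sqrt s) * cnj x"
  have rs: "0 \<le> sqrt s" "sqrt s < 1" using s by auto
  have y2: "(cmod y)\<^sup>2 = s * (cmod x)\<^sup>2" using s by (simp add: y_def norm_mult power_mult_distrib)
  have y1: "cmod y < 1"
    using mult_strict_mono'[of "sqrt s" 1 "cmod x" 1] rs x by (simp add: y_def norm_mult)
  have Sq: "(phi_defect (of_real (sqrt s) * e t) x)\<^sup>2 = ((1 - s) * defect x)\<^sup>2 * (1 / cmod (1 - y * e t) ^ 4)" for t
  proof -
    have 1: "cmod (of_real (sqrt s) * e t) < 1" using rs by (simp add: norm_mult ne)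
    have "cnj (1 - cnj (of_real (sqrt s) * e t) * x) = 1 - y * e t" by (simp add: y_def)
    hence 2: "cmod (1 - cnj (of_real (sqrt s) * e t) * x) = cmod (1 - y * e t)"
      by (metis complex_mod_cnj)
    have 3: "defect (of_real (sqrt s) * e t) = 1 - s" using s by (simp add: defect_def norm_mult ne)
    show ?thesis
      using phi_defect_eq[OF 1, of x] x unfolding 2 3 by (simp add: power_divide power_mult_distrib flip: power_mult)
  qed
  have "((\<lambda>t. (phi_defect (of_real (sqrt s) * e t) x)\<^sup>2) has_integral ((1 - s) * defect x)\<^sup>2 * ((1 + (cmod y)\<^sup>2) / (1 - (cmod y)\<^sup>2) ^ 3)) {0..1}"
    unfolding Sq by (unfold e_def, intro has_integral_mult_right circle_average_inverse_power4 y1)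
  also have "((1 - s) * defect x)\<^sup>2 * ((1 + (cmod y)\<^sup>2) / (1 - (cmod y)\<^sup>2) ^ 3) = annular_weight s ((cmod x)\<^sup>2)"
    unfolding y2 annular_weight_def by (simp add: defect_def power_mult_distrib)
  finally have hi: "((\<lambda>t. (phi_defect (of_real (sqrt s) * e t) x)\<^sup>2) has_integral annular_weight s ((cmod x)\<^sup>2)) {0..1}" .
  have me: "(\<lambda>t. (phi_defect (of_real (sqrt s) * e t) x)\<^sup>2) \<in> borel_measurable borel"
    unfolding phi_defect_def[abs_def] e_def phi_def by measurable
  show ?thesis
  proof -
    have "(\<integral>\<^sup>+t. ennreal (indicator {0..1} t *\<^sub>R (phi_defect (of_real (sqrt s) * e t) x)\<^sup>2) \<partial>lborel) = ennreal (annular_weight s ((cmod x)\<^sup>2))"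
    proof (rule nn_integral_has_integral_lborel)
      show "(\<lambda>t. indicator {0..1} t *\<^sub>R (phi_defect (of_real (sqrt s) * e t) x)\<^sup>2) \<in> borel_measurable borel"
        by (intro borel_measurable_scaleR borel_measurable_indicator me) auto
      have "((\<lambda>t. if t \<in> {0..1} then (phi_defect (of_real (sqrt s) * e t) x)\<^sup>2 else 0) has_integral annular_weight s ((cmod x)\<^sup>2)) UNIV"
        using hi by (simp only: has_integral_restrict_UNIV)
      thus "((\<lambda>t. indicator {0..1} t *\<^sub>R (phi_defect (of_real (sqrt s) * e t) x)\<^sup>2) has_integral annular_weight s ((cmod x)\<^sup>2)) UNIV"
        by (rule has_integral_eq[rotated]) (simp add: indicator_def)
    qed simp
    also have "(\<integral>\<^sup>+t. ennreal (indicator {0..1} t *\<^sub>R (phi_defect (of_real (sqrt s) * e t) x)\<^sup>2) \<partial>lborel) =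
       (\<integral>\<^sup>+t\<in>{0..1}. ennreal ((phi_defect (of_real (sqrt s) * e t) x)\<^sup>2) \<partial>lborel)"
      by (intro nn_integral_cong) (auto simp: indicator_def)
    finally show ?thesis by (simp add: e_def)
  qed
qed

text \<open>By invariance \<open>phi_defect v (phi u z)\<close> equals
  \<open>phi_defect (phi u v) z\<close>. After Tonelli the inner integral over z is the value of
  \<open>B0\<close> at \<open>phi u v\<close>, and the circle carries total mass 1.\<close>

lemma integral_annular_weight_le_B0sup:
  assumes \<mu>: "sets \<mu> = sets borel" "finite_measure \<mu>" "emeasure \<mu> (UNIV - ball 0 1) = 0"
    and s: "0 \<le> s" "s < 1" and u: "cmod u < 1"
  shows "(\<integral>\<^sup>+z. ennreal (annular_weight s ((cmod (phi z u))\<^sup>2) / (defect z)\<^sup>2) \<partial>\<mu>) \<le> B0sup \<mu>"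
proof -
  interpret finite_measure \<mu> by fact
  note [measurable_cong] = \<mu>(1)
  define v where "v t = of_real (sqrt s) * exp (2 * of_real pi * \<i> * of_real t)" for t :: real
  have v: "cmod (v t) < 1" for t using s by (simp add: v_def norm_mult norm_exp_eq_Re)
  have AE: "AE z in \<mu>. cmod z < 1"
    using \<mu> by (intro AE_I[of _ _ "UNIV - ball 0 1"]) auto
  have vm [measurable]: "v \<in> borel_measurable borel" unfolding v_def by measurable
  have "(\<integral>\<^sup>+z. ennreal (annular_weight s ((cmod (phi z u))\<^sup>2) / (defect z)\<^sup>2) \<partial>\<mu>)
    = (\<integral>\<^sup>+z. (\<integral>\<^sup>+t. ennreal ((phi_defect (phi u (v t)) z)\<^sup>2 / (defect z)\<^sup>2) * indicator {0..1} t \<partial>lborel) \<partial>\<mu>)"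
  proof (rule nn_integral_cong_AE, use AE in eventually_elim)
    fix z assume z: "cmod z < 1"
    have 1: "cmod (phi u z) < 1" by (rule cmod_phi_less_1[OF u z])
    have 2: "(cmod (phi z u))\<^sup>2 = (cmod (phi u z))\<^sup>2"
      unfolding cmod_phi_power2 using phi_defect_commute[OF u z] by simp
    have 3: "phi_defect (phi u (v t)) z = phi_defect (v t) (phi u z)" for t
      using phi_defect_phi_phi[OF u cmod_phi_less_1[OF u v[of t]] z] phi_phi[OF u, of "v t"] v[of t] by simp
    have "ennreal (annular_weight s ((cmod (phi z u))\<^sup>2) / (defect z)\<^sup>2) = ennreal (annular_weight s ((cmod (phi u z))\<^sup>2)) * ennreal (1 / (defect z)\<^sup>2)"
      unfolding 2 by (subst ennreal_mult''[symmetric]) auto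
    also have "\<dots> = (\<integral>\<^sup>+t. ennreal ((phi_defect (v t) (phi u z))\<^sup>2) * indicator {0..1} t \<partial>lborel) * ennreal (1 / (defect z)\<^sup>2)"
      using annular_weight_eq_circle_average[OF s 1] by (simp add: v_def)
    also have "\<dots> = (\<integral>\<^sup>+t. ennreal ((phi_defect (v t) (phi u z))\<^sup>2) * indicator {0..1} t * ennreal (1 / (defect z)\<^sup>2) \<partial>lborel)"
      by (intro nn_integral_multc[symmetric]) (unfold phi_defect_def phi_def, measurable)
    also have "\<dots> = (\<integral>\<^sup>+t. ennreal ((phi_defect (phi u (v t)) z)\<^sup>2 / (defect z)\<^sup>2) * indicator {0..1} t \<partial>lborel)"
      unfolding 3 by (intro nn_integral_cong) (auto simp: indicator_def ennreal_mult''[symmetric])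
    finally show "ennreal (annular_weight s ((cmod (phi z u))\<^sup>2) / (defect z)\<^sup>2) = \<dots>" .
  qed
  also have "\<dots> = (\<integral>\<^sup>+t. (\<integral>\<^sup>+z. ennreal ((phi_defect (phi u (v t)) z)\<^sup>2 / (defect z)\<^sup>2) * indicator {0..1} t \<partial>\<mu>) \<partial>lborel)"
  proof (rule pair_sigma_finite.Fubini')
    show "pair_sigma_finite lborel \<mu>" 
      by (intro pair_sigma_finite.intro sigma_finite_measure_axioms sigma_finite_lborel)
  qed (unfold phi_defect_def phi_def defect_def, measurable)
  also have "\<dots> \<le> (\<integral>\<^sup>+t\<in>{0..1}. B0sup \<mu> \<partial>(lborel :: real measure))"
  proof (intro nn_integral_mono)
    fix t :: real
    have "(\<integral>\<^sup>+z. ennreal ((phi_defect (phi u (v t)) z)\<^sup>2 / (defect z)\<^sup>2) \<partial>\<mu>) = B0 \<mu> (phi u (v t))"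
      by (simp add: B0_def phi_defect_def defect_def)
    also have "\<dots> \<le> B0sup \<mu>"
      unfolding B0sup_def using cmod_phi_less_1[OF u v[of t]] by (intro SUP_upper) auto
    finally show "(\<integral>\<^sup>+z. ennreal ((phi_defect (phi u (v t)) z)\<^sup>2 / (defect z)\<^sup>2) * indicator {0..1} t \<partial>\<mu>) \<le> B0sup \<mu> * indicator {0..1} t"
      by (auto simp: indicator_def)
  qed
  also have "\<dots> = B0sup \<mu>"
    by (subst nn_integral_cmult_indicator) auto
  finally show ?thesis .
qed

section \<open>Taylor coefficients and radial weights\<close>

text \<open>A class containing polynomials and stable under \<open>U z\<close> up to values at the
  pole, with bounded members and absolutely summable Taylor coefficients. Global measurability is
  included because \<open>dA\<close> is a measure on all of \<open>complex\<close>.\<close>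

definition holo_near_disc :: "(complex \<Rightarrow> complex) \<Rightarrow> bool" where
  "holo_near_disc f \<longleftrightarrow> (\<exists>R>1. f holomorphic_on ball 0 R) \<and> f \<in> borel_measurable borel"

lemma holo_near_disc_entire:
  assumes "f holomorphic_on UNIV" shows "holo_near_disc f"
  unfolding holo_near_disc_def
proof
  show "\<exists>R>1. f holomorphic_on ball 0 R"
    using holomorphic_on_subset[OF assms] by (intro exI[of _ 2]) auto
  show "f \<in> borel_measurable borel"
    using assms by (intro borel_measurable_continuous_onI holomorphic_on_imp_continuous_on)
qed

lemma holo_near_disc_poly: "holo_near_disc (poly p)"
proof (rule holo_near_disc_entire)
  show "poly p holomorphic_on UNIV"
    unfolding holomorphic_on_def field_differentiable_def
    by (rule ballI, rule exI, rule has_field_derivative_at_within, rule poly_DERIV)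
qed

definition taylor_coeff :: "(complex \<Rightarrow> complex) \<Rightarrow> nat \<Rightarrow> complex" where
  "taylor_coeff f n = (deriv ^^ n) f 0 / fact n"

lemma holo_near_disc_sums:
  assumes "holo_near_disc f"
  shows "cmod w \<le> 1 \<Longrightarrow> (\<lambda>n. taylor_coeff f n * w ^ n) sums f w" "summable (\<lambda>n. cmod (taylor_coeff f n))"
proof -
  obtain R where R: "R > 1" "f holomorphic_on ball 0 R" using assms by (auto simp: holo_near_disc_def)
  have s: "(\<lambda>n. taylor_coeff f n * w ^ n) sums f w" if "cmod w < R" for w
    using holomorphic_power_series[OF R(2), of w] that by (simp add: taylor_coeff_def)
  show "cmod w \<le> 1 \<Longrightarrow> (\<lambda>n. taylor_coeff f n * w ^ n) sums f w" using s[of w] R by simp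
  \<comment> \<open>Convergence at a radius beyond 1 yields absolute summability of the coefficients
    themselves.\<close>
  obtain r where r: "1 < r" "r < R" using R dense by blast
  have "summable (\<lambda>n. taylor_coeff f n * of_real r ^ n)"
    using s[of "of_real r"] r by (auto intro: sums_summable)
  from powser_insidea[OF this, of 1] show "summable (\<lambda>n. cmod (taylor_coeff f n))" using r by simp
qed

lemma holo_near_disc_bounded:
  assumes "holo_near_disc f"
  obtains B where "0 < B" "\<And>w. cmod w \<le> 1 \<Longrightarrow> cmod (f w) \<le> B"
proof -
  obtain R where R: "R > 1" "f holomorphic_on ball 0 R" using assms by (auto simp: holo_near_disc_def)
  have "compact (f ` cball 0 1)"
    using R by (intro compact_continuous_image holomorphic_on_imp_continuous_on holomorphic_on_subset[OF R(2)]) auto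
  then obtain B where B: "\<And>w. w \<in> f ` cball 0 1 \<Longrightarrow> cmod w \<le> B" "0 < B"
    using compact_imp_bounded bounded_pos by metis
  thus ?thesis by (intro that[of B]) auto
qed

text \<open>The open set on which the composition is holomorphic contains the closed disc, hence by
  compactness a neighbourhood of uniform width; a point outside the disc is compared with its radial
  projection.\<close>

lemma holo_near_disc_phi:
  assumes f: "holo_near_disc f" and z: "cmod z < 1"
  shows "holo_near_disc (\<lambda>w. f (phi z w) * dphi z w)"
  unfolding holo_near_disc_def
proof
  have [measurable]: "f \<in> borel_measurable borel" using f by (simp add: holo_near_disc_def)
  show "(\<lambda>w. f (phi z w) * dphi z w) \<in> borel_measurable borel" by measurable
  obtain R where R: "R > 1" "f holomorphic_on ball 0 R" using f by (auto simp: holo_near_disc_def)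
  define A where "A = {w. 1 - cnj z * w \<noteq> 0}"
  have A: "open A" unfolding A_def by (intro open_Collect_neq continuous_intros)
  have hphi: "phi z holomorphic_on A"
    unfolding phi_def[abs_def] A_def by (intro holomorphic_intros) auto
  define V where "V = A \<inter> phi z -` ball 0 R"
  have V: "open V" unfolding V_def
    by (intro continuous_open_preimage A holomorphic_on_imp_continuous_on hphi) auto
  have "cball 0 1 \<subseteq> V"
  proof
    fix w :: complex assume "w \<in> cball 0 1"
    hence w: "cmod w \<le> 1" by simp
    show "w \<in> V" using one_minus_cnj_mult_nonzero[OF z w] cmod_phi_le_1[OF z w] R(1)
      by (auto simp: V_def A_def)
  qed
  then obtain e where e: "0 < e" "(\<Union>x\<in>cball 0 1. ball x e) \<subseteq> V"
    using compact_subset_open_imp_ball_epsilon_subset[OF compact_cball V] by metis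
  have sub: "ball 0 (1 + e) \<subseteq> V"
  proof
    fix w :: complex assume w: "w \<in> ball 0 (1 + e)"
    show "w \<in> V"
    proof (cases "cmod w \<le> 1")
      case True
      thus ?thesis using \<open>cball 0 1 \<subseteq> V\<close> by auto
    next
      case False
      define x where "x = w / of_real (cmod w)"
      have w0: "w \<noteq> 0" using False by auto
      hence "cmod x = 1" by (simp add: x_def norm_divide)
      moreover have "dist x w < e"
      proof -
        have "w = of_real (cmod w) * x" using w0 by (simp add: x_def)
        hence "x - w = of_real (1 - cmod w) * x" by (simp add: algebra_simps)
        hence "dist x w = \<bar>1 - cmod w\<bar> * cmod x"
          unfolding dist_norm by (simp add: norm_mult del: of_real_diff)
        thus ?thesis using False w \<open>cmod x = 1\<close> by simp
      qed
      ultimately show ?thesis using e(2) by (force simp: subset_iff)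
    qed
  qed
  have "(\<lambda>w. f (phi z w)) holomorphic_on V"
    using holomorphic_on_compose_gen[OF holomorphic_on_subset[OF hphi] R(2), of V]
    by (auto simp: V_def o_def)
  moreover have "dphi z holomorphic_on V"
    unfolding dphi_def[abs_def] V_def A_def by (intro holomorphic_intros) auto
  ultimately have "(\<lambda>w. f (phi z w) * dphi z w) holomorphic_on V" by (intro holomorphic_intros)
  thus "\<exists>R>1. (\<lambda>w. f (phi z w) * dphi z w) holomorphic_on ball 0 R"
    using e(1) sub holomorphic_on_subset by (intro exI[of _ "1 + e"]) auto
qed

definition bdd_weight :: "(real \<Rightarrow> real) \<Rightarrow> bool" where
  "bdd_weight h \<longleftrightarrow> h \<in> borel_measurable borel \<and> (\<exists>H. \<forall>t\<in>{0..1}. 0 \<le> h t \<and> h t \<le> H)"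

definition disc_moment :: "(real \<Rightarrow> real) \<Rightarrow> nat \<Rightarrow> real" where
  "disc_moment h k = (LINT w|dA. (cmod w) ^ (2 * k) * h ((cmod w)\<^sup>2))"

lemma dA_integrable_bounded:
  fixes F :: "complex \<Rightarrow> 'b::{banach, second_countable_topology}"
  assumes "F \<in> borel_measurable borel" "\<And>w. cmod w < 1 \<Longrightarrow> norm (F w) \<le> B"
  shows "integrable dA F"
proof (rule dA.integrable_const_bound[of _ B])
  show "AE w in dA. norm (F w) \<le> B" by (rule AE_dA_I) (rule assms(2))
  show "F \<in> borel_measurable dA" using assms(1) by simp
qed

text \<open>For distinct exponents, rotation by the angle \<open>pi / (j - k)\<close> preserves
  \<open>dA\<close> and the weight but multiplies the monomial by -1.\<close>

lemma integral_monomial_radial: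
  assumes "bdd_weight h"
  shows "(LINT w|dA. w ^ j * cnj w ^ k * of_real (h ((cmod w)\<^sup>2))) = (if j = k then of_real (disc_moment h k) else 0)"
proof (cases "j = k")
  case True
  have "w ^ k * cnj w ^ k * of_real (h ((cmod w)\<^sup>2)) = of_real ((cmod w) ^ (2 * k) * h ((cmod w)\<^sup>2))" for w
  proof -
    have "w ^ k * cnj w ^ k = (w * cnj w) ^ k" by (simp add: power_mult_distrib)
    also have "w * cnj w = of_real ((cmod w)\<^sup>2)" by (simp only: complex_norm_square)
    finally show ?thesis by (simp add: power_mult)
  qed
  hence "(LINT w|dA. w ^ k * cnj w ^ k * of_real (h ((cmod w)\<^sup>2))) = of_real (disc_moment h k)"
    unfolding disc_moment_def by (simp only: integral_complex_of_real)
  thus ?thesis using True by simp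
next
  case False
  have [measurable]: "h \<in> borel_measurable borel" using assms by (simp add: bdd_weight_def)
  define c where "c = cis (pi / (real j - real k))"
  have c: "cmod c = 1" by (simp add: c_def)
  have "c ^ j * cnj c ^ k = cis (real j * (pi / (real j - real k)) - real k * (pi / (real j - real k)))"
    unfolding c_def cis_cnj Complex.DeMoivre cis_mult by (simp add: algebra_simps)
  also have "real j * (pi / (real j - real k)) - real k * (pi / (real j - real k)) = pi"
    using False by (subst left_diff_distrib[symmetric]) simp
  finally have cc: "c ^ j * cnj c ^ k = -1" by simp
  let ?F = "\<lambda>w. w ^ j * cnj w ^ k * of_real (h ((cmod w)\<^sup>2)) :: complex"
  have "(LINT w|dA. ?F w) = (LINT w|distr dA borel ((*) c). ?F w)"
    by (simp only: distr_dA_rotate[OF c])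
  also have "\<dots> = (LINT w|dA. ?F (c * w))"
    by (subst integral_distr) auto
  also have "\<dots> = (LINT w|dA. - ?F w)"
  proof (intro Bochner_Integration.integral_cong refl)
    fix w
    have "?F (c * w) = (c ^ j * cnj c ^ k) * ?F w" using c by (simp add: power_mult_distrib norm_mult)
    thus "?F (c * w) = - ?F w" unfolding cc by simp
  qed
  also have "\<dots> = - (LINT w|dA. ?F w)" by (rule Bochner_Integration.integral_minus)
  finally show ?thesis using False by simp
qed

text \<open>Termwise integration of the Taylor series, dominated by
  \<open>|taylor_coeff g n| * H\<close>; only the k-th term survives.\<close>

lemma integral_radial_coeff:
  assumes h: "bdd_weight h" and g: "holo_near_disc g"
  shows "(LINT w|dA. g w * cnj w ^ k * of_real (h ((cmod w)\<^sup>2))) = taylor_coeff g k * of_real (disc_moment h k)"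
proof -
  have [measurable]: "h \<in> borel_measurable borel" "g \<in> borel_measurable borel"
    using assms by (auto simp: bdd_weight_def holo_near_disc_def)
  obtain H where H: "\<And>t. t \<in> {0..1} \<Longrightarrow> 0 \<le> h t \<and> h t \<le> H"
    using h unfolding bdd_weight_def by blast
  define F where "F n w = taylor_coeff g n * (w ^ n * cnj w ^ k * of_real (h ((cmod w)\<^sup>2)))" for n w
  have Fb: "cmod (F n w) \<le> cmod (taylor_coeff g n) * H" if "cmod w < 1" for n w
  proof -
    have h': "0 \<le> h ((cmod w)\<^sup>2)" "h ((cmod w)\<^sup>2) \<le> H"
      using H[of "(cmod w)\<^sup>2"] that by (auto simp: power_le_one)
    have "cmod (w ^ n * cnj w ^ k) * h ((cmod w)\<^sup>2) \<le> 1 * H"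
      using h' that by (intro mult_mono) (auto simp: norm_mult norm_power intro!: mult_le_one power_le_one)
    thus ?thesis using h'(1) by (simp add: F_def norm_mult mult_left_mono mult.assoc)
  qed
  have Fm [measurable]: "F n \<in> borel_measurable borel" for n unfolding F_def by measurable
  have int: "integrable dA (F n)" for n by (rule dA_integrable_bounded[OF Fm Fb])
  have sm: "summable (\<lambda>n. cmod (taylor_coeff g n) * H)"
    by (intro summable_mult2 holo_near_disc_sums g)
  have "(\<lambda>n. integral\<^sup>L dA (F n)) sums (LINT w|dA. (\<Sum>n. F n w))"
  proof (rule sums_integral[OF int])
    show "AE w in dA. summable (\<lambda>n. norm (F n w))"
      by (intro AE_dA_I summable_comparison_test[OF _ sm]) (use Fb in auto)
    show "summable (\<lambda>n. LINT w|dA. norm (F n w))"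
    proof (rule summable_comparison_test[OF _ sm], intro exI allI impI)
      fix n :: nat
      have "(LINT w|dA. norm (F n w)) \<le> (LINT w|dA. cmod (taylor_coeff g n) * H)"
        using int[of n] Fb by (intro integral_mono_AE AE_dA_I) auto
      thus "norm (LINT w|dA. norm (F n w)) \<le> cmod (taylor_coeff g n) * H"
        by (simp add: measure_def emeasure_dA_UNIV)
    qed
  qed
  moreover have "(LINT w|dA. (\<Sum>n. F n w)) = (LINT w|dA. g w * cnj w ^ k * of_real (h ((cmod w)\<^sup>2)))"
  proof (intro integral_cong_AE AE_dA_I)
    fix w :: complex assume "cmod w < 1"
    hence "(\<lambda>n. taylor_coeff g n * w ^ n) sums g w" using holo_near_disc_sums(1)[OF g, of w] by simp
    from sums_mult2[OF this, of "cnj w ^ k * of_real (h ((cmod w)\<^sup>2))"]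
    show "(\<Sum>n. F n w) = g w * cnj w ^ k * of_real (h ((cmod w)\<^sup>2))"
      by (simp add: F_def sums_iff mult_ac)
  qed simp_all
  moreover have "integral\<^sup>L dA (F n) = (if n = k then taylor_coeff g k * of_real (disc_moment h k) else 0)" for n
    unfolding F_def using integral_monomial_radial[OF h, of n k] by simp
  ultimately have "(\<lambda>n. if n = k then taylor_coeff g k * of_real (disc_moment h k) else 0) sums (LINT w|dA. g w * cnj w ^ k * of_real (h ((cmod w)\<^sup>2)))"
    by simp
  from sums_unique2[OF this sums_single[of k "\<lambda>_. taylor_coeff g k * of_real (disc_moment h k)"]]
  show ?thesis .
qed

text \<open>Expand \<open>\<integral> |g - b w\<^sup>k|\<^sup>2 h \<ge> 0\<close>, where \<open>b\<close> is the \<open>k\<close>-th coefficient of \<open>g\<close>.\<close>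

lemma coeff_square_le_integral:
  assumes h: "bdd_weight h" and g: "holo_near_disc g"
  shows "ennreal ((cmod (taylor_coeff g k))\<^sup>2 * disc_moment h k) \<le> (\<integral>\<^sup>+w. ennreal ((cmod (g w))\<^sup>2 * h ((cmod w)\<^sup>2)) \<partial>dA)"
proof -
  have [measurable]: "h \<in> borel_measurable borel" "g \<in> borel_measurable borel"
    using assms by (auto simp: bdd_weight_def holo_near_disc_def)
  obtain H where H: "\<And>t. t \<in> {0..1} \<Longrightarrow> 0 \<le> h t \<and> h t \<le> H"
    using h unfolding bdd_weight_def by blast
  obtain B where B: "0 < B" "\<And>w. cmod w \<le> 1 \<Longrightarrow> cmod (g w) \<le> B"
    using holo_near_disc_bounded[OF g] by metis
  have h': "0 \<le> h ((cmod w)\<^sup>2)" "h ((cmod w)\<^sup>2) \<le> H" if "cmod w < 1" for w :: complex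
    using H[of "(cmod w)\<^sup>2"] that by (auto simp: power_le_one)
  define b where "b = taylor_coeff g k"
  define G where "G w = g w * cnj w ^ k * of_real (h ((cmod w)\<^sup>2))" for w
  have i1: "integrable dA (\<lambda>w. (cmod (g w))\<^sup>2 * h ((cmod w)\<^sup>2))"
    using B h' by (intro dA_integrable_bounded[of _ "B\<^sup>2 * H"]) (auto simp: abs_mult intro!: mult_mono power_mono)
  have i2: "integrable dA G"
    unfolding G_def
  proof (intro dA_integrable_bounded[of _ "B * 1 * H"])
    fix w :: complex assume w: "cmod w < 1"
    show "cmod (g w * cnj w ^ k * of_real (h ((cmod w)\<^sup>2))) \<le> B * 1 * H"
      unfolding norm_mult using B h'[OF w] w by (intro mult_mono) (auto simp: norm_power power_le_one)
  qed measurable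
  have i3: "integrable dA (\<lambda>w. (cmod w) ^ (2 * k) * h ((cmod w)\<^sup>2))"
  proof (intro dA_integrable_bounded[of _ "1 * H"])
    fix w :: complex assume w: "cmod w < 1"
    show "norm ((cmod w) ^ (2 * k) * h ((cmod w)\<^sup>2)) \<le> 1 * H"
      unfolding norm_mult using h'[OF w] w by (intro mult_mono) (auto simp: power_le_one)
  qed measurable
  have exp: "(cmod (g w - b * w ^ k))\<^sup>2 * h ((cmod w)\<^sup>2) =
     (cmod (g w))\<^sup>2 * h ((cmod w)\<^sup>2) - 2 * Re (cnj b * G w) + (cmod b)\<^sup>2 * ((cmod w) ^ (2 * k) * h ((cmod w)\<^sup>2))" for w
  proof -
    have "(cmod (x - y))\<^sup>2 = (cmod x)\<^sup>2 - 2 * Re (cnj y * x) + (cmod y)\<^sup>2" for x y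
      unfolding cmod_power2 by (simp add: power2_eq_square algebra_simps)
    from this[of "g w" "b * w ^ k"]
    have 1: "(cmod (g w - b * w ^ k))\<^sup>2 = (cmod (g w))\<^sup>2 - 2 * Re (cnj b * (g w * cnj w ^ k)) + (cmod b)\<^sup>2 * (cmod w) ^ (2 * k)"
      by (simp add: norm_mult norm_power power_mult_distrib power_mult[symmetric] mult_ac)
    have 2: "Re (cnj b * G w) = Re (cnj b * (g w * cnj w ^ k)) * h ((cmod w)\<^sup>2)"
      by (simp add: G_def flip: mult.assoc)
    show ?thesis unfolding 1 2 by (simp only: algebra_simps)
  qed
  have "0 \<le> (LINT w|dA. (cmod (g w - b * w ^ k))\<^sup>2 * h ((cmod w)\<^sup>2))"
    using h' by (intro integral_nonneg_AE AE_dA_I) auto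
  also have "\<dots> = (LINT w|dA. (cmod (g w))\<^sup>2 * h ((cmod w)\<^sup>2)) - 2 * Re (cnj b * (LINT w|dA. G w)) + (cmod b)\<^sup>2 * disc_moment h k"
    unfolding exp disc_moment_def using i1 i2 i3 by simp
  also have "(LINT w|dA. G w) = b * of_real (disc_moment h k)"
    unfolding G_def b_def by (rule integral_radial_coeff[OF h g])
  also have "Re (cnj b * (b * of_real (disc_moment h k))) = (cmod b)\<^sup>2 * disc_moment h k"
    unfolding cmod_power2 by (simp add: power2_eq_square algebra_simps)
  finally have "(cmod b)\<^sup>2 * disc_moment h k \<le> (LINT w|dA. (cmod (g w))\<^sup>2 * h ((cmod w)\<^sup>2))"
    by linarith
  thus ?thesis
    using i1 h' by (subst nn_integral_eq_integral) (auto simp: b_def intro!: ennreal_leI AE_dA_I)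
qed

text \<open>The preceding bound for \<open>U z f\<close>, followed by the substitution
  \<open>u = phi z w\<close>: \<open>|dphi z w|^2\<close> is the Jacobian, and the involution turns
  the weight in w into a weight in \<open>phi z u\<close>.\<close>

lemma coeff_phi_square_le_integral:
  assumes h: "bdd_weight h" and f: "holo_near_disc f" and z: "cmod z < 1"
  shows "ennreal ((cmod (taylor_coeff (\<lambda>w. f (phi z w) * dphi z w) k))\<^sup>2 * disc_moment h k)
    \<le> (\<integral>\<^sup>+u. ennreal ((cmod (f u))\<^sup>2 * h ((cmod (phi z u))\<^sup>2)) \<partial>dA)"
proof -
  have [measurable]: "h \<in> borel_measurable borel" "f \<in> borel_measurable borel"
    using assms by (auto simp: bdd_weight_def holo_near_disc_def)
  have "ennreal ((cmod (taylor_coeff (\<lambda>w. f (phi z w) * dphi z w) k))\<^sup>2 * disc_moment h k)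
     \<le> (\<integral>\<^sup>+w. ennreal ((cmod (f (phi z w) * dphi z w))\<^sup>2 * h ((cmod w)\<^sup>2)) \<partial>dA)"
    by (intro coeff_square_le_integral h holo_near_disc_phi f z)
  also have "\<dots> = (\<integral>\<^sup>+w. ennreal ((cmod (dphi z w))\<^sup>2) * ennreal ((cmod (f (phi z w)))\<^sup>2 * h ((cmod (phi z (phi z w)))\<^sup>2)) \<partial>dA)"
    by (intro nn_integral_cong_AE AE_dA_I)
       (simp add: phi_phi[OF z] ennreal_mult'[symmetric] norm_mult power_mult_distrib mult_ac)
  also have "\<dots> = (\<integral>\<^sup>+u. ennreal ((cmod (f u))\<^sup>2 * h ((cmod (phi z u))\<^sup>2)) \<partial>distr (density dA (\<lambda>w. ennreal ((cmod (dphi z w))\<^sup>2))) borel (phi z))"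
    by (subst nn_integral_distr, simp_all, subst nn_integral_density) simp_all
  also have "\<dots> = (\<integral>\<^sup>+u. ennreal ((cmod (f u))\<^sup>2 * h ((cmod (phi z u))\<^sup>2)) \<partial>dA)"
    by (simp only: distr_dA_phi[OF z])
  finally show ?thesis .
qed

lemma disc_moment_eq:
  assumes "continuous_on {0..1} h" "h \<in> borel_measurable borel"
  shows "disc_moment h k = integral {0..1} (\<lambda>t. t ^ k * h t)"
proof -
  note [measurable] = assms(2)
  have "disc_moment h k = (LINT t|distr dA borel (\<lambda>w. (cmod w)\<^sup>2). t ^ k * h t)"
    unfolding disc_moment_def by (subst integral_distr) (auto simp: power_mult)
  also have "\<dots> = (LINT t:{0..1}|lborel. t ^ k * h t)"
  proof -
    have "(indicator {0..1} :: real \<Rightarrow> ennreal) = (\<lambda>x. ennreal (indicator {0..1} x))"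
      by (auto simp: indicator_def)
    thus ?thesis
      unfolding distr_dA_cmod2 set_lebesgue_integral_def
      by (simp only:) (subst integral_density, auto)
  qed
  also have "\<dots> = integral {0..1} (\<lambda>t. t ^ k * h t)"
    by (intro set_borel_integral_eq_integral borel_integrable_atLeastAtMost' continuous_intros assms)
  finally show ?thesis .
qed

section \<open>The coefficient embedding\<close>

text \<open>Measurability is needed for all \<open>z\<close>, also off the disc, where \<open>phi z\<close> can have a pole and \<open>deriv\<close>
  is an unspecified value there.\<close>

lemma borel_measurable_deriv_phi [measurable]: "deriv (phi z) \<in> borel_measurable borel"
proof -
  have "deriv (phi z) = (\<lambda>w. if 1 - cnj z * w = 0 then deriv (phi z) (1 / cnj z) else dphi z w)"
  proof
    fix w
    show "deriv (phi z) w = (if 1 - cnj z * w = 0 then deriv (phi z) (1 / cnj z) else dphi z w)"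
    proof (cases "1 - cnj z * w = 0")
      case True
      hence "w = 1 / cnj z" by (cases "z = 0") (auto simp: field_simps)
      thus ?thesis using True by simp
    qed (simp add: deriv_phi)
  qed
  also have "\<dots> \<in> borel_measurable borel" by measurable
  finally show ?thesis .
qed

text \<open>The pole is a single point, hence null. For z = 0 the convention 1/0 = 0 only excludes
  the origin, which is harmless.\<close>

lemma AE_deriv_phi: "AE w in dA. deriv (phi z) w = dphi z w"
proof -
  have "emeasure dA {1 / cnj z} = 0"
    by (simp add: emeasure_dA Int_insert_left)
  hence "AE w in dA. w \<notin> {1 / cnj z}"
    by (intro AE_not_in) (auto simp: null_sets_def)
  thus ?thesis
  proof eventually_elim
    case (elim w)
    hence "1 - cnj z * w \<noteq> 0" by (cases "z = 0") (auto simp: field_simps)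
    thus ?case by (rule deriv_phi)
  qed
qed

lemma measurable_ek [measurable]: "ek k \<in> borel_measurable borel"
  unfolding ek_def[abs_def] by measurable

lemma A2ip_U_eq:
  assumes [measurable]: "f \<in> borel_measurable borel" "g \<in> borel_measurable borel"
  shows "A2ip f (U z g) = (LINT w|dA. f w * cnj (g (phi z w) * dphi z w))"
  unfolding A2ip_def U_def
  by (intro integral_cong_AE, measurable, use AE_deriv_phi[of z] in eventually_elim, simp)

lemma disc_moment_one: "disc_moment (\<lambda>_. 1) k = 1 / (real k + 1)"
proof -
  have "((\<lambda>t::real. t ^ k * 1) has_integral 1 / (real k + 1)) {0..1}"
    using has_integral_power_mult_power[of k 0] by (simp add: beta_nat_def add.commute)
  thus ?thesis by (subst disc_moment_eq) (auto intro: integral_unique)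
qed

text \<open>\<open>U z\<close> is self-adjoint, so this is the inner product of \<open>U z f\<close>
  with \<open>ek k\<close>: the k-th coefficient times \<open>sqrt (k+1)\<close> times the moment
  \<open>1/(k+1)\<close>.\<close>

lemma A2ip_U_ek:
  assumes f: "holo_near_disc f" and z: "cmod z < 1"
  shows "A2ip f (U z (ek k)) = taylor_coeff (\<lambda>w. f (phi z w) * dphi z w) k / of_real (sqrt (real k + 1))"
proof -
  have [measurable]: "f \<in> borel_measurable borel" using f by (simp add: holo_near_disc_def)
  define G where "G w = f w * cnj (ek k (phi z w) * dphi z w)" for w
  have [measurable]: "G \<in> borel_measurable borel" unfolding G_def by measurable
  have "A2ip f (U z (ek k)) = (LINT w|dA. G w)"
    unfolding G_def by (intro A2ip_U_eq) measurable
  also have "\<dots> = (LINT w|distr (density dA (\<lambda>w. ennreal ((cmod (dphi z w))\<^sup>2))) borel (phi z). G w)"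
    by (simp only: distr_dA_phi[OF z])
  also have "\<dots> = (LINT w|dA. (cmod (dphi z w))\<^sup>2 *\<^sub>R G (phi z w))"
    by (subst integral_distr, simp_all, subst integral_density) simp_all
  also have "\<dots> = (LINT w|dA. of_real (sqrt (real k + 1)) * (f (phi z w) * dphi z w * cnj w ^ k * of_real 1))"
  proof (intro integral_cong_AE AE_dA_I)
    fix w :: complex assume w: "cmod w < 1"
    have nz: "dphi z (phi z w) * dphi z w = 1" using dphi_phi[OF z] w by simp
    \<comment> \<open>Of the Jacobian \<open>dphi * cnj dphi\<close> the conjugate factor cancels by
      the chain rule; the other becomes the factor in \<open>U z f\<close>.\<close>
    have "of_real ((cmod (dphi z w))\<^sup>2) * cnj (dphi z (phi z w)) = dphi z w * cnj (dphi z (phi z w) * dphi z w)"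
      by (simp only: complex_norm_square complex_cnj_mult mult_ac)
    also have "\<dots> = dphi z w" unfolding nz by simp
    finally have "of_real ((cmod (dphi z w))\<^sup>2) * cnj (dphi z (phi z w)) = dphi z w" .
    moreover have "phi z (phi z w) = w" using phi_phi[OF z] w by simp
    ultimately show "(cmod (dphi z w))\<^sup>2 *\<^sub>R G (phi z w) = of_real (sqrt (real k + 1)) * (f (phi z w) * dphi z w * cnj w ^ k * of_real 1)"
      by (simp add: G_def ek_def scaleR_conv_of_real mult_ac)
  qed measurable
  also have "\<dots> = of_real (sqrt (real k + 1)) * (taylor_coeff (\<lambda>w. f (phi z w) * dphi z w) k * of_real (disc_moment (\<lambda>_. 1) k))"
    using integral_radial_coeff[of "\<lambda>_. 1", OF _ holo_near_disc_phi[OF f z], of k]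
    by (simp add: bdd_weight_def) (metis order_refl zero_less_one_class.zero_le_one)
  also have "\<dots> = taylor_coeff (\<lambda>w. f (phi z w) * dphi z w) k * (of_real (sqrt (real k + 1)) / of_real (real k + 1))"
    by (simp add: disc_moment_one)
  also have "of_real (sqrt (real k + 1)) / of_real (real k + 1) = (1 / of_real (sqrt (real k + 1)) :: complex)"
  proof -
    have "real k + 1 = sqrt (real k + 1) * sqrt (real k + 1)" by simp
    hence "of_real (real k + 1) = (of_real (sqrt (real k + 1)) * of_real (sqrt (real k + 1)) :: complex)"
      by (metis of_real_mult)
    thus ?thesis by (simp add: field_simps)
  qed
  finally show ?thesis by simp
qed

lemma cmod_A2ip_U_ek_power2:
  assumes f: "holo_near_disc f" and z: "cmod z < 1"
  shows "(cmod (A2ip f (U z (ek k))))\<^sup>2 = (cmod (taylor_coeff (\<lambda>w. f (phi z w) * dphi z w) k))\<^sup>2 / (real k + 1)"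
  unfolding A2ip_U_ek[OF f z] by (simp add: norm_divide power_divide)

text \<open>On the circle of radius 1/2 one has \<open>|dphi z w| \<le> 4 * defect z\<close>, and
  Cauchy's estimate passes this to the k-th coefficient. The factor \<open>defect z\<close> offsets
  the singular denominator of the form.\<close>

lemma A2ip_U_ek_bound:
  assumes f: "holo_near_disc f"
  obtains B where "\<And>z. cmod z < 1 \<Longrightarrow> cmod (A2ip f (U z (ek k))) \<le> B * defect z"
proof -
  obtain B where B: "0 < B" "\<And>w. cmod w \<le> 1 \<Longrightarrow> cmod (f w) \<le> B"
    using holo_near_disc_bounded[OF f] by metis
  have "cmod (A2ip f (U z (ek k))) \<le> (B * 4 * 2 ^ k) * defect z" if z: "cmod z < 1" for z
  proof -
    define g where "g w = f (phi z w) * dphi z w" for w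
    have g: "holo_near_disc g" unfolding g_def[abs_def] by (rule holo_near_disc_phi[OF f z])
    then obtain R where R: "R > 1" "g holomorphic_on ball 0 R" by (auto simp: holo_near_disc_def)
    have "cmod ((deriv ^^ k) g 0) \<le> fact k * (B * (defect z * 4)) / (1/2) ^ k"
    proof (rule Cauchy_inequality)
      show "g holomorphic_on ball 0 (1/2)" using R by (auto intro: holomorphic_on_subset)
      show "continuous_on (cball 0 (1/2)) g" 
        using R by (auto intro!: holomorphic_on_imp_continuous_on intro: holomorphic_on_subset)
      fix w :: complex assume "cmod (0 - w) = 1/2"
      hence w: "cmod w = 1/2" by simp
      have "cmod (cnj z * w) \<le> 1/2" using z by (simp add: norm_mult w)
      hence "1/2 \<le> cmod (1 - cnj z * w)" using norm_triangle_ineq2[of 1 "cnj z * w"] by simp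
      hence "(1/2)\<^sup>2 \<le> (cmod (1 - cnj z * w))\<^sup>2" by (intro power_mono) auto
      hence "defect z / (cmod (1 - cnj z * w))\<^sup>2 \<le> defect z / (1/2)\<^sup>2"
        using defect_pos[OF z] \<open>1/2 \<le> cmod (1 - cnj z * w)\<close>
        by (intro divide_left_mono mult_pos_pos zero_less_power) auto
      hence "cmod (dphi z w) \<le> defect z * 4"
        using defect_pos[OF z] by (simp add: dphi_def norm_divide norm_power power_divide)
      moreover have "cmod (f (phi z w)) \<le> B" using cmod_phi_le_1[OF z, of w] w by (intro B) auto
      ultimately show "norm (g w) \<le> B * (defect z * 4)"
        unfolding g_def norm_mult using B(1) by (intro mult_mono) auto
    qed auto
    hence "cmod (taylor_coeff g k) \<le> B * 4 * 2 ^ k * defect z"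
      by (simp add: taylor_coeff_def norm_divide power_one_over field_simps)
    moreover have "cmod (A2ip f (U z (ek k))) \<le> cmod (taylor_coeff g k)"
      unfolding A2ip_U_ek[OF f z] g_def[abs_def] norm_divide by (simp add: divide_le_eq_1 mult_left_le divide_le_eq)
        (simp add: mult_left_le mult_le_cancel_left1)
    ultimately show ?thesis by linarith
  qed
  thus ?thesis by (rule that)
qed

lemma borel_measurable_A2ip_U_ek:
  assumes [measurable]: "f \<in> borel_measurable borel"
  shows "(\<lambda>z. A2ip f (U z (ek k))) \<in> borel_measurable borel"
proof -
  have "(\<lambda>z. LINT w|dA. f w * cnj (ek k (phi z w) * dphi z w)) \<in> borel_measurable borel"
    unfolding dphi_def phi_def ek_def defect_def by measurable
  thus ?thesis by (simp add: A2ip_U_eq)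
qed

lemma bdd_weight_annular:
  assumes "0 \<le> s" "s < 1" shows "bdd_weight (annular_weight s)"
  unfolding bdd_weight_def
proof
  show "annular_weight s \<in> borel_measurable borel" unfolding annular_weight_def[abs_def] by measurable
  have "compact (annular_weight s ` {0..1})"
    by (intro compact_continuous_image continuous_on_annular_weight assms) auto
  then obtain H where "\<And>y. y \<in> annular_weight s ` {0..1} \<Longrightarrow> norm y \<le> H"
    using compact_imp_bounded bounded_iff by metis
  thus "\<exists>H. \<forall>t\<in>{0..1}. 0 \<le> annular_weight s t \<and> annular_weight s t \<le> H"
    using annular_weight_nonneg[OF assms] by (intro exI[of _ H]) fastforce
qed

text \<open>The heart of the upper bound: weighted coefficient estimate, moment inequality, Tonelli,
  then the circle average for each fixed u. Working in \<open>ennreal\<close> keeps it valid for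
  infinite \<open>B0sup\<close>.\<close>

lemma coeff_embedding:
  assumes \<mu>: "sets \<mu> = sets borel" "finite_measure \<mu>" "emeasure \<mu> (UNIV - ball 0 1) = 0"
    and f: "holo_near_disc f"
  shows "(\<integral>\<^sup>+z. ennreal ((cmod (taylor_coeff (\<lambda>w. f (phi z w) * dphi z w) k))\<^sup>2 / ((real k + 1) * (defect z)\<^sup>2)) \<partial>\<mu>)
    \<le> ennreal (4 * (real k + 2)) * B0sup \<mu> * (\<integral>\<^sup>+u. ennreal ((cmod (f u))\<^sup>2) \<partial>dA)"
proof -
  interpret finite_measure \<mu> by fact
  note [measurable_cong] = \<mu>(1)
  have [measurable]: "f \<in> borel_measurable borel" using f by (simp add: holo_near_disc_def)
  define s where "s = real k / (real k + 4)"
  have s: "0 \<le> s" "s < 1" by (auto simp: s_def)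
  define h where "h = annular_weight s"
  have h: "bdd_weight h" unfolding h_def by (rule bdd_weight_annular[OF s])
  hence hm [measurable]: "h \<in> borel_measurable borel" by (simp add: bdd_weight_def)
  have h0: "0 \<le> h t" if "0 \<le> t" "t \<le> 1" for t using annular_weight_nonneg[OF s] that by (simp add: h_def)
  define m where "m = disc_moment h k"
  have m: "1 \<le> 4 * (real k + 1) * (real k + 2) * m"
    using integral_annular_weight[of k]
    unfolding m_def by (subst disc_moment_eq) (auto simp: h_def s_def[symmetric] intro: continuous_on_annular_weight s hm[unfolded h_def])
  have AE: "AE z in \<mu>. cmod z < 1"
    using \<mu> by (intro AE_I[of _ _ "UNIV - ball 0 1"]) auto
  have "(\<integral>\<^sup>+z. ennreal ((cmod (taylor_coeff (\<lambda>w. f (phi z w) * dphi z w) k))\<^sup>2 / ((real k + 1) * (defect z)\<^sup>2)) \<partial>\<mu>)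
    \<le> (\<integral>\<^sup>+z. ennreal (4 * (real k + 2)) * (\<integral>\<^sup>+u. ennreal ((cmod (f u))\<^sup>2) * ennreal (h ((cmod (phi z u))\<^sup>2) / (defect z)\<^sup>2) \<partial>dA) \<partial>\<mu>)"
  proof (intro nn_integral_mono_AE, use AE in eventually_elim)
    fix z assume z: "cmod z < 1"
    define b where "b = (cmod (taylor_coeff (\<lambda>w. f (phi z w) * dphi z w) k))\<^sup>2"
    have b: "0 \<le> b" by (simp add: b_def)
    have qz: "0 < defect z" by (rule defect_pos[OF z])
    have "1 / (real k + 1) \<le> 4 * (real k + 2) * m" using m by (simp add: field_simps)
    from mult_left_mono[OF this, of "b / (defect z)\<^sup>2"]
    have "b / ((real k + 1) * (defect z)\<^sup>2) \<le> 4 * (real k + 2) * ((b * m) * (1 / (defect z)\<^sup>2))"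
      using b by (simp add: mult_ac)
    moreover have m0: "0 < m"
    proof (rule ccontr)
      assume "\<not> 0 < m"
      hence "4 * (real k + 1) * (real k + 2) * m \<le> 0" by (intro mult_nonneg_nonpos) auto
      thus False using m by linarith
    qed
    moreover have "ennreal x * (ennreal y * ennreal w) = ennreal (x * (y * w))" if "0 \<le> x" "0 \<le> y" "0 \<le> w" for x y w
      using that by (simp add: ennreal_mult)
    from this[of "4 * (real k + 2)" "b * m" "1 / (defect z)\<^sup>2"]
    have "ennreal (4 * (real k + 2)) * (ennreal (b * m) * ennreal (1 / (defect z)\<^sup>2)) = ennreal (4 * (real k + 2) * ((b * m) * (1 / (defect z)\<^sup>2)))"
      using b m0 by simp
    ultimately have "ennreal (b / ((real k + 1) * (defect z)\<^sup>2)) \<le> ennreal (4 * (real k + 2)) * (ennreal (b * m) * ennreal (1 / (defect z)\<^sup>2))"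
      by (simp only: ennreal_leI)
    also have "\<dots> \<le> ennreal (4 * (real k + 2)) * ((\<integral>\<^sup>+u. ennreal ((cmod (f u))\<^sup>2 * h ((cmod (phi z u))\<^sup>2)) \<partial>dA) * ennreal (1 / (defect z)\<^sup>2))"
      using coeff_phi_square_le_integral[OF h f z, of k] unfolding b_def m_def
      by (intro mult_left_mono mult_right_mono) auto
    also have "(\<integral>\<^sup>+u. ennreal ((cmod (f u))\<^sup>2 * h ((cmod (phi z u))\<^sup>2)) \<partial>dA) * ennreal (1 / (defect z)\<^sup>2)
       = (\<integral>\<^sup>+u. ennreal ((cmod (f u))\<^sup>2 * h ((cmod (phi z u))\<^sup>2)) * ennreal (1 / (defect z)\<^sup>2) \<partial>dA)"
      by (intro nn_integral_multc[symmetric]) measurable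
    also have "\<dots> = (\<integral>\<^sup>+u. ennreal ((cmod (f u))\<^sup>2) * ennreal (h ((cmod (phi z u))\<^sup>2) / (defect z)\<^sup>2) \<partial>dA)"
    proof (intro nn_integral_cong_AE AE_dA_I)
      fix u :: complex assume u: "cmod u < 1"
      have "0 \<le> h ((cmod (phi z u))\<^sup>2)" using cmod_phi_less_1[OF z u] by (intro h0) (auto simp: power_le_one)
      thus "ennreal ((cmod (f u))\<^sup>2 * h ((cmod (phi z u))\<^sup>2)) * ennreal (1 / (defect z)\<^sup>2) = ennreal ((cmod (f u))\<^sup>2) * ennreal (h ((cmod (phi z u))\<^sup>2) / (defect z)\<^sup>2)"
        by (simp add: ennreal_mult[symmetric])
    qed
    finally show "ennreal ((cmod (taylor_coeff (\<lambda>w. f (phi z w) * dphi z w) k))\<^sup>2 / ((real k + 1) * (defect z)\<^sup>2)) \<le> 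
        ennreal (4 * (real k + 2)) * (\<integral>\<^sup>+u. ennreal ((cmod (f u))\<^sup>2) * ennreal (h ((cmod (phi z u))\<^sup>2) / (defect z)\<^sup>2) \<partial>dA)"
      by (simp add: b_def)
  qed
  also have "\<dots> = ennreal (4 * (real k + 2)) * (\<integral>\<^sup>+z. (\<integral>\<^sup>+u. ennreal ((cmod (f u))\<^sup>2) * ennreal (h ((cmod (phi z u))\<^sup>2) / (defect z)\<^sup>2) \<partial>dA) \<partial>\<mu>)"
    unfolding phi_def defect_def by (intro nn_integral_cmult) measurable
  also have "\<dots> \<le> ennreal (4 * (real k + 2)) * ((\<integral>\<^sup>+u. ennreal ((cmod (f u))\<^sup>2) \<partial>dA) * B0sup \<mu>)"
  proof (rule mult_left_mono)
    have "(\<integral>\<^sup>+z. (\<integral>\<^sup>+u. ennreal ((cmod (f u))\<^sup>2) * ennreal (h ((cmod (phi z u))\<^sup>2) / (defect z)\<^sup>2) \<partial>dA) \<partial>\<mu>)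
      = (\<integral>\<^sup>+u. (\<integral>\<^sup>+z. ennreal ((cmod (f u))\<^sup>2) * ennreal (h ((cmod (phi z u))\<^sup>2) / (defect z)\<^sup>2) \<partial>\<mu>) \<partial>dA)"
    proof (rule pair_sigma_finite.Fubini')
      show "pair_sigma_finite dA \<mu>"
        by (intro pair_sigma_finite.intro sigma_finite_measure_axioms dA.sigma_finite_measure_axioms)
    qed (unfold phi_def defect_def, measurable)
    also have "\<dots> \<le> (\<integral>\<^sup>+u. ennreal ((cmod (f u))\<^sup>2) * B0sup \<mu> \<partial>dA)"
    proof (intro nn_integral_mono_AE AE_dA_I)
      fix u :: complex assume u: "cmod u < 1"
      have "(\<integral>\<^sup>+z. ennreal ((cmod (f u))\<^sup>2) * ennreal (h ((cmod (phi z u))\<^sup>2) / (defect z)\<^sup>2) \<partial>\<mu>)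
        = ennreal ((cmod (f u))\<^sup>2) * (\<integral>\<^sup>+z. ennreal (h ((cmod (phi z u))\<^sup>2) / (defect z)\<^sup>2) \<partial>\<mu>)"
        unfolding phi_def defect_def by (intro nn_integral_cmult) measurable
      also have "\<dots> \<le> ennreal ((cmod (f u))\<^sup>2) * B0sup \<mu>"
        unfolding h_def by (intro mult_left_mono integral_annular_weight_le_B0sup \<mu> s u) auto
      finally show "(\<integral>\<^sup>+z. ennreal ((cmod (f u))\<^sup>2) * ennreal (h ((cmod (phi z u))\<^sup>2) / (defect z)\<^sup>2) \<partial>\<mu>) \<le> ennreal ((cmod (f u))\<^sup>2) * B0sup \<mu>" .
    qed
    also have "\<dots> = (\<integral>\<^sup>+u. ennreal ((cmod (f u))\<^sup>2) \<partial>dA) * B0sup \<mu>"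
      by (intro nn_integral_multc) measurable
    finally show "(\<integral>\<^sup>+z. (\<integral>\<^sup>+u. ennreal ((cmod (f u))\<^sup>2) * ennreal (h ((cmod (phi z u))\<^sup>2) / (defect z)\<^sup>2) \<partial>dA) \<partial>\<mu>)
      \<le> (\<integral>\<^sup>+u. ennreal ((cmod (f u))\<^sup>2) \<partial>dA) * B0sup \<mu>" .
  qed simp
  finally show ?thesis by (simp only: mult_ac)
qed

section \<open>The upper bound\<close>

lemma measurable_poly [measurable]: "poly p \<in> borel_measurable borel" for p :: "complex poly"
  using holo_near_disc_poly[of p] by (simp add: holo_near_disc_def)

lemma measurable_A2ip [measurable]: "(\<lambda>z. A2ip (poly p) (U z (ek k))) \<in> borel_measurable borel"
  by (intro borel_measurable_A2ip_U_ek measurable_poly)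

lemma nn_integral_dA_poly: "(\<integral>\<^sup>+u. ennreal ((cmod (poly p u))\<^sup>2) \<partial>dA) = ennreal ((A2norm (poly p))\<^sup>2)"
proof -
  obtain B where B: "0 < B" "\<And>w. cmod w \<le> 1 \<Longrightarrow> cmod (poly p w) \<le> B"
    using holo_near_disc_bounded[OF holo_near_disc_poly] by metis
  have "integrable dA (\<lambda>u. (cmod (poly p u))\<^sup>2)"
    using B by (intro dA_integrable_bounded[of _ "B\<^sup>2"]) (auto intro!: power_mono)
  thus ?thesis
    by (subst nn_integral_eq_integral) (auto simp: A2norm_def)
qed

lemma A2norm_nonneg: "0 \<le> A2norm f"
  by (simp add: A2norm_def)

locale disc_measure = finite_measure \<mu> for \<mu> :: "complex measure" +
  assumes sets_mu [measurable_cong, simp]: "sets \<mu> = sets borel"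
    and null_mu: "emeasure \<mu> (UNIV - ball 0 1) = 0"
begin

lemma AE_disc: "AE z in \<mu>. cmod z < 1"
  using null_mu by (intro AE_I[of _ _ "UNIV - ball 0 1"]) auto

definition form_density :: "nat \<Rightarrow> complex poly \<Rightarrow> complex \<Rightarrow> real" where
  "form_density k p z = (cmod (A2ip (poly p) (U z (ek k))))\<^sup>2 / (defect z)\<^sup>2"

lemma Tform_eq:
  "Tform \<mu> k (poly p) (poly r) =
    (LINT z|\<mu>. A2ip (poly p) (U z (ek k)) * cnj (A2ip (poly r) (U z (ek k))) / of_real ((defect z)\<^sup>2))"
  by (simp add: Tform_def defect_def)

text \<open>The density is bounded on the disc and \<mu> is finite, so the Bochner integral is the
  true one and never the default 0. This is why a bound on the form carries information about
  \<mu>.\<close>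

lemma nn_integral_form_density:
  "(\<integral>\<^sup>+z. ennreal (form_density k p z) \<partial>\<mu>) = ennreal (cmod (Tform \<mu> k (poly p) (poly p)))"
proof -
  obtain B where B: "\<And>z. cmod z < 1 \<Longrightarrow> cmod (A2ip (poly p) (U z (ek k))) \<le> B * defect z"
    using A2ip_U_ek_bound[OF holo_near_disc_poly] by metis
  have d: "form_density k p z \<le> B\<^sup>2" if "cmod z < 1" for z
  proof -
    have "(cmod (A2ip (poly p) (U z (ek k))))\<^sup>2 \<le> (B * defect z)\<^sup>2"
      using B[OF that] by (intro power_mono) auto
    thus ?thesis using defect_pos[OF that] by (simp add: form_density_def divide_le_eq power_mult_distrib)
  qed
  have d0: "0 \<le> form_density k p z" for z by (simp add: form_density_def)
  have dm [measurable]: "form_density k p \<in> borel_measurable borel"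
    unfolding form_density_def[abs_def] by measurable
  have i: "integrable \<mu> (form_density k p)"
  proof (rule integrable_const_bound[of _ "B\<^sup>2"])
    show "AE z in \<mu>. norm (form_density k p z) \<le> B\<^sup>2"
      using AE_disc by eventually_elim (use d d0 in auto)
  qed simp
  have "A2ip (poly p) (U z (ek k)) * cnj (A2ip (poly p) (U z (ek k))) / of_real ((defect z)\<^sup>2) = of_real (form_density k p z)" for z
    unfolding complex_norm_square[symmetric] form_density_def by simp
  hence "Tform \<mu> k (poly p) (poly p) = of_real (LINT z|\<mu>. form_density k p z)"
    unfolding Tform_eq by (simp only: integral_complex_of_real)
  moreover have "0 \<le> (LINT z|\<mu>. form_density k p z)" using d0 by simp
  ultimately have "cmod (Tform \<mu> k (poly p) (poly p)) = (LINT z|\<mu>. form_density k p z)" by simp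
  thus ?thesis using nn_integral_eq_integral[OF i] d0 by simp
qed

text \<open>Reduces every estimate of the form to its diagonal.\<close>

lemma Tform_Cauchy_Schwarz:
  "(ennreal (cmod (Tform \<mu> k (poly p) (poly r))))\<^sup>2 \<le> (\<integral>\<^sup>+z. ennreal (form_density k p z) \<partial>\<mu>) * (\<integral>\<^sup>+z. ennreal (form_density k r z) \<partial>\<mu>)"
proof -
  define a where "a p z = ennreal (cmod (A2ip (poly p) (U z (ek k))) / \<bar>defect z\<bar>)" for p z
  have am [measurable]: "a p \<in> borel_measurable borel" for p unfolding a_def[abs_def] by measurable
  let ?I = "\<lambda>z. A2ip (poly p) (U z (ek k)) * cnj (A2ip (poly r) (U z (ek k))) / of_real ((defect z)\<^sup>2)"
  have "ennreal (cmod (Tform \<mu> k (poly p) (poly r))) \<le> (\<integral>\<^sup>+z. ennreal (cmod (?I z)) \<partial>\<mu>)"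
  proof (cases "integrable \<mu> ?I")
    case True
    thus ?thesis unfolding Tform_eq by (intro integral_norm_bound_ennreal)
  next
    \<comment> \<open>The Bochner integral is 0 by convention here, and the bound is
      trivial.\<close>
    case False
    thus ?thesis unfolding Tform_eq by (simp add: not_integrable_integral_eq)
  qed
  also have "\<dots> = (\<integral>\<^sup>+z. a p z * a r z \<partial>\<mu>)"
    by (intro nn_integral_cong) (simp add: a_def norm_mult norm_divide power2_eq_square ennreal_mult[symmetric] abs_mult)
  finally have "(ennreal (cmod (Tform \<mu> k (poly p) (poly r))))\<^sup>2 \<le> (\<integral>\<^sup>+z. a p z * a r z \<partial>\<mu>)\<^sup>2"
    by (rule power_mono) simp
  also have "\<dots> \<le> (\<integral>\<^sup>+z. (a p z)\<^sup>2 \<partial>\<mu>) * (\<integral>\<^sup>+z. (a r z)\<^sup>2 \<partial>\<mu>)"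
    by (rule Cauchy_Schwarz_nn_integral) simp_all
  also have "(\<lambda>z. (a p z)\<^sup>2) = (\<lambda>z. ennreal (form_density k p z))"
    by (simp add: fun_eq_iff a_def form_density_def ennreal_power power_divide)
  also have "(\<lambda>z. (a r z)\<^sup>2) = (\<lambda>z. ennreal (form_density k r z))"
    by (simp add: fun_eq_iff a_def form_density_def ennreal_power power_divide)
  finally show ?thesis .
qed

lemma nn_integral_form_density_le:
  "(\<integral>\<^sup>+z. ennreal (form_density k p z) \<partial>\<mu>) \<le> ennreal (4 * (real k + 2)) * B0sup \<mu> * ennreal ((A2norm (poly p))\<^sup>2)"
proof -
  have "(\<integral>\<^sup>+z. ennreal (form_density k p z) \<partial>\<mu>) = 
     (\<integral>\<^sup>+z. ennreal ((cmod (taylor_coeff (\<lambda>w. poly p (phi z w) * dphi z w) k))\<^sup>2 / ((real k + 1) * (defect z)\<^sup>2)) \<partial>\<mu>)"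
    by (intro nn_integral_cong_AE, use AE_disc in eventually_elim)
       (simp add: form_density_def cmod_A2ip_U_ek_power2[OF holo_near_disc_poly])
  also have "\<dots> \<le> ennreal (4 * (real k + 2)) * B0sup \<mu> * (\<integral>\<^sup>+u. ennreal ((cmod (poly p u))\<^sup>2) \<partial>dA)"
    by (intro coeff_embedding sets_mu finite_measure_axioms null_mu holo_near_disc_poly)
  finally show ?thesis unfolding nn_integral_dA_poly .
qed

lemma Tform_bound:
  assumes B: "B0sup \<mu> = ennreal B" "0 \<le> B"
  shows "cmod (Tform \<mu> k (poly p) (poly r)) \<le> 4 * (real k + 2) * B * A2norm (poly p) * A2norm (poly r)"
proof -
  define N where "N = 4 * (real k + 2) * B"
  have N: "0 \<le> N" using B by (simp add: N_def)
  have d: "(\<integral>\<^sup>+z. ennreal (form_density k p z) \<partial>\<mu>) \<le> ennreal (N * (A2norm (poly p))\<^sup>2)" for p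
    using nn_integral_form_density_le[of k p] B unfolding N_def
    by (simp only: B ennreal_mult''[symmetric] zero_le_power2)
  have "ennreal ((cmod (Tform \<mu> k (poly p) (poly r)))\<^sup>2) = (ennreal (cmod (Tform \<mu> k (poly p) (poly r))))\<^sup>2"
    by (simp add: ennreal_power)
  also have "\<dots> \<le> ennreal (N * (A2norm (poly p))\<^sup>2) * ennreal (N * (A2norm (poly r))\<^sup>2)"
    by (rule order_trans[OF Tform_Cauchy_Schwarz mult_mono[OF d d]]) auto
  also have "\<dots> = ennreal ((N * A2norm (poly p) * A2norm (poly r))\<^sup>2)"
    using N by (subst ennreal_mult[symmetric]) (auto simp: power2_eq_square mult_ac)
  finally have "(cmod (Tform \<mu> k (poly p) (poly r)))\<^sup>2 \<le> (N * A2norm (poly p) * A2norm (poly r))\<^sup>2"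
    by (simp add: ennreal_le_iff)
  thus ?thesis unfolding N_def[symmetric]
    by (rule power2_le_imp_le) (intro mult_nonneg_nonneg N A2norm_nonneg)
qed

section \<open>From a bounded Berezin transform to the Carleson property\<close>

lemma embedding_holo_near_disc:
  assumes f: "holo_near_disc f"
  shows "(\<integral>\<^sup>+z. ennreal ((cmod (f z))\<^sup>2) \<partial>\<mu>) \<le> 8 * B0sup \<mu> * (\<integral>\<^sup>+u. ennreal ((cmod (f u))\<^sup>2) \<partial>dA)"
proof -
  have "(\<integral>\<^sup>+z. ennreal ((cmod (f z))\<^sup>2) \<partial>\<mu>) = 
     (\<integral>\<^sup>+z. ennreal ((cmod (taylor_coeff (\<lambda>w. f (phi z w) * dphi z w) 0))\<^sup>2 / ((real 0 + 1) * (defect z)\<^sup>2)) \<partial>\<mu>)"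
  proof (intro nn_integral_cong_AE, use AE_disc in eventually_elim)
    \<comment> \<open>Since \<open>phi z 0 = z\<close> and \<open>dphi z 0 = - defect z\<close>, the
      case k = 0 of the coefficient embedding is point evaluation; its constant 4(0+2) is the 8 of
      the statement.\<close>
    fix z assume z: "cmod z < 1"
    show "ennreal ((cmod (f z))\<^sup>2) = ennreal ((cmod (taylor_coeff (\<lambda>w. f (phi z w) * dphi z w) 0))\<^sup>2 / ((real 0 + 1) * (defect z)\<^sup>2))"
      using defect_pos[OF z] by (simp add: taylor_coeff_def phi_def dphi_def norm_mult power_mult_distrib)
  qed
  also have "\<dots> \<le> ennreal (4 * (real 0 + 2)) * B0sup \<mu> * (\<integral>\<^sup>+u. ennreal ((cmod (f u))\<^sup>2) \<partial>dA)"
    by (intro coeff_embedding sets_mu finite_measure_axioms null_mu f)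
  finally show ?thesis by simp
qed

text \<open>A member of \<open>A2\<close> need not extend beyond the disc, so the embedding is
  applied to the dilates f(r w) and Fatou is used as r tends to 1.\<close>

lemma Carleson_if_B0sup_finite:
  assumes B: "B0sup \<mu> < \<infinity>"
  shows "Carleson \<mu>"
  unfolding Carleson_def
proof
  fix f assume "f \<in> A2"
  hence f: "f holomorphic_on ball 0 1" and fi: "(\<integral>\<^sup>+ w. ennreal ((cmod (f w))\<^sup>2) \<partial>dA) < \<infinity>"
    by (auto simp: A2_def)
  \<comment> \<open>Off the disc \<open>f\<close> is arbitrary; the extension by zero is Borel
    measurable everywhere.\<close>
  define F where "F w = indicator (ball 0 1) w *\<^sub>R f w" for w
  have Fm [measurable]: "F \<in> borel_measurable borel"
    unfolding F_def
    by (intro borel_measurable_continuous_on_indicator holomorphic_on_imp_continuous_on f) auto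
  define J where "J = (\<integral>\<^sup>+w. ennreal ((cmod (F w))\<^sup>2) \<partial>lborel)"
  have FJ: "(\<integral>\<^sup>+ w. ennreal ((cmod (f w))\<^sup>2) \<partial>dA) = J / ennreal pi"
  proof -
    have "(\<integral>\<^sup>+ w. ennreal ((cmod (f w))\<^sup>2) \<partial>dA) = (\<integral>\<^sup>+ w. ennreal ((cmod (F w))\<^sup>2) \<partial>dA)"
      by (intro nn_integral_cong_AE AE_dA_I) (simp add: F_def)
    also have "\<dots> = (\<integral>\<^sup>+w\<in>ball 0 1. ennreal ((cmod (F w))\<^sup>2) \<partial>lborel) / ennreal pi"
      by (intro nn_integral_dA) measurable
    also have "(\<integral>\<^sup>+w\<in>ball 0 1. ennreal ((cmod (F w))\<^sup>2) \<partial>lborel) = J"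
      unfolding J_def by (intro nn_integral_cong) (auto simp: F_def indicator_def)
    finally show ?thesis .
  qed
  \<comment> \<open>Scaling the plane by r costs the factor \<open>1 / r^2\<close>, at most
    4.\<close>
  have dil: "(\<integral>\<^sup>+w. ennreal ((cmod (F (of_real r * w)))\<^sup>2) \<partial>dA) \<le> 4 * (J / ennreal pi)" if r: "1/2 \<le> r" "r < 1" for r
  proof -
    have "J = (\<integral>\<^sup>+w. ennreal ((cmod (F w))\<^sup>2) \<partial>density (distr lborel borel (\<lambda>x. 0 + r *\<^sub>R x)) (\<lambda>_. \<bar>r\<bar> ^ DIM(complex)))"
      using r unfolding J_def by (subst lborel_affine[symmetric]) auto
    also have "\<dots> = (\<integral>\<^sup>+w. ennreal (r\<^sup>2) * ennreal ((cmod (F (of_real r * w)))\<^sup>2) \<partial>lborel)"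
      using r by (subst nn_integral_density, simp, simp, subst nn_integral_distr) (auto simp: scaleR_conv_of_real)
    also have "\<dots> = ennreal (r\<^sup>2) * (\<integral>\<^sup>+w. ennreal ((cmod (F (of_real r * w)))\<^sup>2) \<partial>lborel)"
      by (intro nn_integral_cmult) measurable
    finally have J: "J = ennreal (r\<^sup>2) * (\<integral>\<^sup>+w. ennreal ((cmod (F (of_real r * w)))\<^sup>2) \<partial>lborel)" .
    have "(1/2)\<^sup>2 \<le> r\<^sup>2" using r by (intro power_mono) auto
    hence "1 \<le> 4 * r\<^sup>2" by (simp add: power2_eq_square)
    hence "1 \<le> 4 * ennreal (r\<^sup>2)" 
      by (metis ennreal_1 ennreal_leI ennreal_mult'' ennreal_numeral zero_le_numeral zero_le_power2)
    hence "1 * (\<integral>\<^sup>+w. ennreal ((cmod (F (of_real r * w)))\<^sup>2) \<partial>lborel) \<le> 4 * ennreal (r\<^sup>2) * (\<integral>\<^sup>+w. ennreal ((cmod (F (of_real r * w)))\<^sup>2) \<partial>lborel)"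
      by (rule mult_right_mono) simp
    hence *: "(\<integral>\<^sup>+w. ennreal ((cmod (F (of_real r * w)))\<^sup>2) \<partial>lborel) \<le> 4 * J"
      by (simp add: J mult.assoc)
    have "(\<integral>\<^sup>+w. ennreal ((cmod (F (of_real r * w)))\<^sup>2) \<partial>dA) = (\<integral>\<^sup>+w\<in>ball 0 1. ennreal ((cmod (F (of_real r * w)))\<^sup>2) \<partial>lborel) / ennreal pi"
      by (intro nn_integral_dA) measurable
    also have "(\<integral>\<^sup>+w\<in>ball 0 1. ennreal ((cmod (F (of_real r * w)))\<^sup>2) \<partial>lborel) \<le> (\<integral>\<^sup>+w. ennreal ((cmod (F (of_real r * w)))\<^sup>2) \<partial>lborel)"
      by (intro nn_integral_mono) (auto simp: indicator_def)
    also note *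
    finally show ?thesis by (simp add: divide_right_mono_ennreal ennreal_times_divide)
  qed
  have emb: "(\<integral>\<^sup>+z. ennreal ((cmod (F (of_real r * z)))\<^sup>2) \<partial>\<mu>) \<le> 8 * B0sup \<mu> * (4 * (J / ennreal pi))" if r: "1/2 \<le> r" "r < 1" for r
  proof -
    have "holo_near_disc (\<lambda>w. F (of_real r * w))"
      unfolding holo_near_disc_def
    proof
      have "(\<lambda>w. f (of_real r * w)) holomorphic_on ball 0 (1 / r)"
        using r by (intro holomorphic_on_compose_gen[OF _ f, unfolded o_def] holomorphic_intros) (auto simp: norm_mult field_simps)
      hence "(\<lambda>w. F (of_real r * w)) holomorphic_on ball 0 (1 / r)"
        by (rule holomorphic_transform) (use r in \<open>auto simp: F_def indicator_def norm_mult field_simps\<close>)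
      thus "\<exists>R>1. (\<lambda>w. F (of_real r * w)) holomorphic_on ball 0 R"
        using r by (intro exI[of _ "1/r"]) auto
    qed measurable
    from embedding_holo_near_disc[OF this] show ?thesis
      by (rule order_trans) (intro mult_left_mono dil r, simp)
  qed
  \<comment> \<open>Two successors make the sequence start at 1/2.\<close>
  define r where "r n = 1 - inverse (real (Suc (Suc n)))" for n
  have r: "1/2 \<le> r n" "r n < 1" for n by (auto simp: r_def field_simps)
  have "(\<integral>\<^sup>+z. ennreal ((cmod (f z))\<^sup>2) \<partial>\<mu>) = (\<integral>\<^sup>+z. liminf (\<lambda>n. ennreal ((cmod (F (of_real (r n) * z)))\<^sup>2)) \<partial>\<mu>)"
  proof (intro nn_integral_cong_AE, use AE_disc in eventually_elim)
    fix z :: complex assume z: "cmod z < 1"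
    have "r \<longlonglongrightarrow> 1 - 0"
      unfolding r_def by (intro tendsto_diff tendsto_const LIMSEQ_Suc[OF LIMSEQ_inverse_real_of_nat])
    hence "(\<lambda>n. of_real (r n) * z) \<longlonglongrightarrow> of_real 1 * z" by (intro tendsto_intros) auto
    moreover have "isCont f z"
      using holomorphic_on_imp_continuous_on[OF f] z by (simp add: continuous_on_eq_continuous_at)
    ultimately have "(\<lambda>n. f (of_real (r n) * z)) \<longlonglongrightarrow> f z"
      using isCont_tendsto_compose[of z f "\<lambda>n. of_real (r n) * z" sequentially] by simp
    moreover have "F (of_real (r n) * z) = f (of_real (r n) * z)" for n
    proof -
      have "cmod (of_real (r n) * z) \<le> 1 * cmod z"
        unfolding norm_mult using r[of n] by (intro mult_right_mono) auto
      thus ?thesis using z by (simp add: F_def)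
    qed
    ultimately have "(\<lambda>n. ennreal ((cmod (F (of_real (r n) * z)))\<^sup>2)) \<longlonglongrightarrow> ennreal ((cmod (f z))\<^sup>2)"
      by (intro tendsto_intros) auto
    from lim_imp_Liminf[OF trivial_limit_sequentially this]
    show "ennreal ((cmod (f z))\<^sup>2) = liminf (\<lambda>n. ennreal ((cmod (F (of_real (r n) * z)))\<^sup>2))"
      by (rule sym)
  qed
  also have "\<dots> \<le> liminf (\<lambda>n. \<integral>\<^sup>+z. ennreal ((cmod (F (of_real (r n) * z)))\<^sup>2) \<partial>\<mu>)"
    by (intro nn_integral_liminf) measurable
  also have "\<dots> \<le> liminf (\<lambda>n::nat. 8 * B0sup \<mu> * (4 * (J / ennreal pi)))"
    by (intro Liminf_mono always_eventually allI emb r)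
  also have "\<dots> = 8 * B0sup \<mu> * (4 * (J / ennreal pi))" by (simp add: Liminf_const)
  also have "\<dots> < \<infinity>" using B fi unfolding FJ by (simp add: ennreal_mult_less_top)
  finally show "(\<integral>\<^sup>+ z. ennreal ((cmod (f z))\<^sup>2) \<partial>\<mu>) < \<infinity>" .
qed

end

section \<open>The lower bound\<close>

lemma integral_poly_cnj:
  assumes G: "holo_near_disc G"
  shows "(LINT w|dA. (\<Sum>j\<le>n. c j * w ^ j) * cnj (G w)) = (\<Sum>j\<le>n. c j * cnj (taylor_coeff G j) / (of_nat j + 1))"
proof -
  have [measurable]: "G \<in> borel_measurable borel" using G by (simp add: holo_near_disc_def)
  obtain B where B: "0 < B" "\<And>w. cmod w \<le> 1 \<Longrightarrow> cmod (G w) \<le> B"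
    using holo_near_disc_bounded[OF G] by metis
  have i: "integrable dA (\<lambda>w. w ^ j * cnj (G w))" for j
  proof (rule dA_integrable_bounded)
    fix w :: complex assume w: "cmod w < 1"
    show "cmod (w ^ j * cnj (G w)) \<le> 1 * B"
      unfolding norm_mult using B w by (intro mult_mono) (auto simp: norm_power power_le_one)
  qed measurable
  have b: "bdd_weight (\<lambda>_. 1)" unfolding bdd_weight_def by (intro conjI exI[of _ 1]) auto
  have "(LINT w|dA. w ^ j * cnj (G w)) = cnj (taylor_coeff G j) / (of_nat j + 1)" for j
  proof -
    have "(LINT w|dA. w ^ j * cnj (G w)) = (LINT w|dA. cnj (G w * cnj w ^ j * of_real 1))"
      by (simp add: mult.commute)
    also have "\<dots> = cnj (taylor_coeff G j * of_real (disc_moment (\<lambda>_. 1) j))"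
      unfolding Bochner_Integration.integral_cnj integral_radial_coeff[OF b G, of j] ..
    finally show ?thesis by (simp add: disc_moment_one)
  qed
  note m = this
  have "(LINT w|dA. (\<Sum>j\<le>n. c j * w ^ j) * cnj (G w)) = (LINT w|dA. (\<Sum>j\<le>n. c j * (w ^ j * cnj (G w))))"
    by (simp add: sum_distrib_right mult.assoc)
  also have "\<dots> = (\<Sum>j\<le>n. c j * (LINT w|dA. w ^ j * cnj (G w)))"
    using i by (subst Bochner_Integration.integral_sum) auto
  finally show ?thesis unfolding m by simp
qed

lemma poly_sum_monom: "poly (\<Sum>j\<le>n. monom (c j) j) w = (\<Sum>j\<le>n. c j * w ^ j)" for c :: "nat \<Rightarrow> complex"
  by (simp add: poly_sum poly_monom)

lemma A2norm_poly_power2: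
  "(A2norm (poly (\<Sum>j\<le>n. monom (c j) j)))\<^sup>2 = (\<Sum>j\<le>n. (cmod (c j))\<^sup>2 / (real j + 1))"
proof -
  let ?P = "\<lambda>w. \<Sum>j\<le>n. c j * w ^ j"
  have b: "bdd_weight (\<lambda>_. 1)" unfolding bdd_weight_def by (intro conjI exI[of _ 1]) auto
  have P: "holo_near_disc ?P"
    using holo_near_disc_poly[of "\<Sum>j\<le>n. monom (c j) j"] by (simp add: poly_sum_monom[abs_def])
  \<comment> \<open>The coefficients are read off from orthogonality instead of from iterated
    derivatives.\<close>
  have co: "taylor_coeff ?P j = c j" if "j \<le> n" for j
  proof -
    have "taylor_coeff ?P j / (of_nat j + 1) = (LINT w|dA. ?P w * cnj w ^ j * of_real 1)"
      using integral_radial_coeff[OF b P, of j] by (simp add: disc_moment_one)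
    also have "\<dots> = (LINT w|dA. (\<Sum>i\<le>n. c i * (w ^ i * cnj w ^ j * of_real 1)))"
      by (simp add: sum_distrib_right mult.assoc)
    also have "\<dots> = (\<Sum>i\<le>n. c i * (LINT w|dA. w ^ i * cnj w ^ j * of_real 1))"
    proof -
      have "integrable dA (\<lambda>w::complex. w ^ i * cnj w ^ j * of_real 1)" for i
      proof (rule dA_integrable_bounded[of _ 1])
        fix w :: complex assume "cmod w < 1"
        thus "cmod (w ^ i * cnj w ^ j * of_real 1) \<le> 1"
          by (simp add: norm_mult norm_power mult_le_one power_le_one)
      qed measurable
      thus ?thesis by (subst Bochner_Integration.integral_sum) auto
    qed
    also have "\<dots> = (\<Sum>i\<le>n. if i = j then c i / (of_nat j + 1) else 0)"
      by (intro sum.cong refl, subst integral_monomial_radial[OF b]) (simp add: disc_moment_one)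
    also have "\<dots> = c j / (of_nat j + 1)" using that by simp
    finally have "taylor_coeff ?P j / (of_nat j + 1) = c j / (of_nat j + 1)" .
    moreover have "(of_nat j + 1 :: complex) \<noteq> 0" by (metis of_nat_Suc of_nat_neq_0 add.commute)
    ultimately show ?thesis by simp
  qed
  have "of_real ((A2norm (poly (\<Sum>j\<le>n. monom (c j) j)))\<^sup>2) = (of_real (LINT w|dA. (cmod (?P w))\<^sup>2) :: complex)"
    by (simp add: A2norm_def poly_sum_monom)
  also have "\<dots> = (LINT w|dA. ?P w * cnj (?P w))"
    by (simp only: complex_norm_square flip: integral_complex_of_real)
  also have "\<dots> = (\<Sum>j\<le>n. c j * cnj (taylor_coeff ?P j) / (of_nat j + 1))"
    by (rule integral_poly_cnj[OF P])
  also have "\<dots> = (\<Sum>j\<le>n. of_real ((cmod (c j))\<^sup>2 / (real j + 1)))"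
  proof (intro sum.cong refl)
    fix j assume "j \<in> {..n}"
    hence "c j * cnj (taylor_coeff ?P j) = of_real ((cmod (c j))\<^sup>2)"
      by (simp only: co atMost_iff complex_norm_square)
    thus "c j * cnj (taylor_coeff ?P j) / (of_nat j + 1) = of_real ((cmod (c j))\<^sup>2 / (real j + 1))"
      by simp
  qed
  also have "\<dots> = of_real (\<Sum>j\<le>n. (cmod (c j))\<^sup>2 / (real j + 1))" by simp
  finally show ?thesis by (simp only: of_real_eq_iff)
qed

text \<open>Taylor polynomials of the normalized reproducing kernel \<open>(1 - |a|\<^sup>2) / (1 - cnj a w)\<^sup>2\<close>.\<close>

definition kernel_poly :: "complex \<Rightarrow> nat \<Rightarrow> complex poly" where
  "kernel_poly a n = (\<Sum>j\<le>n. monom (of_real (defect a) * (of_nat j + 1) * cnj a ^ j) j)"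

text \<open>The squared norm is \<open>(1-x)^2\<close> times a partial sum of the series of
  \<open>(j+1) x^j\<close>, whose sum is \<open>1/(1-x)^2\<close>.\<close>

lemma A2norm_kernel_poly_le_1:
  assumes a: "cmod a < 1"
  shows "A2norm (poly (kernel_poly a n)) \<le> 1"
proof -
  define x where "x = (cmod a)\<^sup>2"
  have x: "0 \<le> x" "x < 1" using a by (auto simp: x_def abs_square_less_1)
  have qa: "defect a = 1 - x" by (simp add: defect_def x_def)
  have "(A2norm (poly (kernel_poly a n)))\<^sup>2 = (\<Sum>j\<le>n. (cmod (of_real (defect a) * (of_nat j + 1) * cnj a ^ j))\<^sup>2 / (real j + 1))"
    unfolding kernel_poly_def by (rule A2norm_poly_power2)
  also have "\<dots> = (\<Sum>j\<le>n. (defect a)\<^sup>2 * (of_nat (Suc j) * x ^ j))"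
  proof (intro sum.cong refl)
    fix j
    have "cmod (of_nat j + 1) = real j + 1" by (metis norm_of_nat of_nat_1 of_nat_add)
    thus "(cmod (of_real (defect a) * (of_nat j + 1) * cnj a ^ j))\<^sup>2 / (real j + 1) = (defect a)\<^sup>2 * (of_nat (Suc j) * x ^ j)"
      by (simp add: norm_mult norm_power power_mult_distrib x_def power_mult[symmetric] mult.commute[of 2])
         (simp add: power2_eq_square)
  qed
  also have "\<dots> = (defect a)\<^sup>2 * (\<Sum>j\<le>n. of_nat (Suc j) * x ^ j)" by (simp add: sum_distrib_left)
  also have "\<dots> \<le> (defect a)\<^sup>2 * (1 / (1 - x)\<^sup>2)"
  proof (rule mult_left_mono)
    have s: "(\<lambda>j. of_nat (Suc j) * x ^ j) sums (1 / (1 - x)\<^sup>2)"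
      using x by (intro geometric_deriv_sums) auto
    show "(\<Sum>j\<le>n. of_nat (Suc j) * x ^ j) \<le> 1 / (1 - x)\<^sup>2"
      using sum_le_suminf[OF sums_summable[OF s], of "{..n}"] x sums_unique[OF s] by simp
  qed simp
  also have "\<dots> = 1" using x by (simp add: qa)
  finally show ?thesis using power2_le_imp_le[of "A2norm (poly (kernel_poly a n))" 1] by simp
qed

lemma holo_near_disc_ek: "holo_near_disc (ek k)"
  unfolding ek_def[abs_def] by (intro holo_near_disc_entire holomorphic_intros)

text \<open>The reproducing property in the limit: pairing with the truncated kernel gives a partial
  sum, at \<open>a\<close>, of the Taylor series of \<open>U z (ek k)\<close>.\<close>

lemma A2ip_kernel_poly_tendsto:
  assumes a: "cmod a < 1" and z: "cmod z < 1"
  shows "(\<lambda>n. A2ip (poly (kernel_poly a n)) (U z (ek k))) \<longlonglongrightarrow> of_real (defect a) * cnj (ek k (phi z a) * dphi z a)"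
proof -
  define G where "G w = ek k (phi z w) * dphi z w" for w
  have G: "holo_near_disc G" unfolding G_def[abs_def] by (intro holo_near_disc_phi holo_near_disc_ek z)
  have eq: "A2ip (poly (kernel_poly a n)) (U z (ek k)) = of_real (defect a) * cnj (\<Sum>j\<le>n. taylor_coeff G j * a ^ j)" for n
  proof -
    have m: "poly (kernel_poly a n) \<in> borel_measurable borel"
      using holo_near_disc_poly by (simp add: holo_near_disc_def)
    have "A2ip (poly (kernel_poly a n)) (U z (ek k)) = (LINT w|dA. poly (kernel_poly a n) w * cnj (G w))"
      unfolding G_def by (intro A2ip_U_eq m measurable_ek)
    also have "\<dots> = (LINT w|dA. (\<Sum>j\<le>n. (of_real (defect a) * (of_nat j + 1) * cnj a ^ j) * w ^ j) * cnj (G w))"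
      by (simp only: kernel_poly_def poly_sum_monom)
    also have "\<dots> = (\<Sum>j\<le>n. (of_real (defect a) * (of_nat j + 1) * cnj a ^ j) * cnj (taylor_coeff G j) / (of_nat j + 1))"
      by (rule integral_poly_cnj[OF G])
    also have "\<dots> = (\<Sum>j\<le>n. of_real (defect a) * cnj (taylor_coeff G j * a ^ j))"
    proof (intro sum.cong refl)
      fix j
      have "(of_nat j + 1 :: complex) \<noteq> 0" by (metis of_nat_Suc of_nat_neq_0 add.commute)
      thus "(of_real (defect a) * (of_nat j + 1) * cnj a ^ j) * cnj (taylor_coeff G j) / (of_nat j + 1) = of_real (defect a) * cnj (taylor_coeff G j * a ^ j)"
        by simp
    qed
    finally show ?thesis by (simp add: sum_distrib_left)
  qed
  have "(\<lambda>n. \<Sum>j\<le>n. taylor_coeff G j * a ^ j) \<longlonglongrightarrow> G a"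
    using holo_near_disc_sums(1)[OF G, of a] a unfolding sums_def_le by simp
  thus ?thesis unfolding eq G_def by (intro tendsto_intros)
qed

text \<open>The right side is the reciprocal of \<open>(1 + 1/(k+1))^k\<close>, which is at most e
  and hence at most 3.\<close>

lemma inverse_three_le_power: "1 / 3 \<le> (1 - 1 / (real k + 2)) ^ k"
proof -
  have "(1 + 1 / (real k + 1)) ^ k \<le> exp (1 / (real k + 1)) ^ k"
    by (intro power_mono exp_ge_add_one_self) (auto intro: add_nonneg_nonneg)
  also have "\<dots> = exp (real k / (real k + 1))" by (simp flip: exp_of_nat_mult)
  also have "\<dots> \<le> exp 1" by simp
  also have "\<dots> \<le> 3" by (rule exp_le)
  finally have "(1 + 1 / (real k + 1)) ^ k \<le> 3" .
  moreover have "1 - 1 / (real k + 2) = 1 / (1 + 1 / (real k + 1))"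
    by (simp add: field_simps)
  hence "(1 - 1 / (real k + 2)) ^ k = 1 / (1 + 1 / (real k + 1)) ^ k"
    by (simp add: power_one_over)
  moreover have "0 < (1 + 1 / (real k + 1)) ^ k" by (intro zero_less_power) (auto intro: add_pos_nonneg)
  ultimately show ?thesis by (simp add: field_simps)
qed

text \<open>For \<open>d = phi_defect z a\<close> this is the squared modulus of the inner product
  of the normalized kernel at \<open>a\<close> with \<open>U z (ek k)\<close>.\<close>

definition kernel_density :: "nat \<Rightarrow> real \<Rightarrow> real" where
  "kernel_density k d = (real k + 1) * (1 - d) ^ k * d\<^sup>2"

text \<open>The sign condition gives \<open>1 \<le> |1 - cnj x v| \<le> 2\<close>, so
  \<open>phi_defect x v\<close> lies between \<open>defect x / (4 N)\<close> and
  \<open>1 / N\<close>. The constant is 96 = 16 * 3 * 2: the square of 4, the power being at least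
  1/3, and k + 1 being at least N/2.\<close>

lemma square_le_kernel_density:
  assumes x: "cmod x < 1" and v: "cmod v < 1" "defect v = 1 / (real k + 2)" and re: "Re (cnj x * v) \<le> 0"
  shows "(defect x)\<^sup>2 \<le> 96 * (real k + 2) * kernel_density k (phi_defect x v)"
proof -
  define N where "N = real k + 2"
  have N: "2 \<le> N" by (simp add: N_def)
  define d where "d = cmod (1 - cnj x * v)"
  have "1 \<le> Re (1 - cnj x * v)" using re by simp
  hence d1: "1 \<le> d" unfolding d_def using complex_Re_le_cmod order_trans by blast
  have "cmod (cnj x * v) \<le> 1" using x v by (simp add: norm_mult mult_le_one)
  hence d2: "d \<le> 2" unfolding d_def using norm_triangle_ineq4[of 1 "cnj x * v"] by simp
  have Sx: "phi_defect x v = defect x / N / d\<^sup>2" using phi_defect_eq[OF x, of v] v by (simp add: d_def N_def)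
  have qx: "0 < defect x" "defect x \<le> 1" using defect_pos[OF x] defect_le_1 by auto
  have dd: "1 \<le> d\<^sup>2" "d\<^sup>2 \<le> 4" using d1 power_mono[OF d2, of 2] by auto
  have "phi_defect x v \<le> defect x / N / 1" unfolding Sx using qx N dd by (intro divide_left_mono) auto
  also have "\<dots> \<le> 1 / N" using qx N by (simp add: divide_right_mono)
  finally have "(1 - 1 / N) ^ k \<le> (1 - phi_defect x v) ^ k" using N by (intro power_mono) auto
  hence p: "1 / 3 \<le> (1 - phi_defect x v) ^ k" using inverse_three_le_power[of k] by (simp add: N_def)
  have "defect x / N / 4 \<le> phi_defect x v" unfolding Sx using qx N dd by (intro divide_left_mono mult_pos_pos) auto
  hence s: "(defect x / N / 4)\<^sup>2 \<le> (phi_defect x v)\<^sup>2" using qx N by (intro power_mono) auto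
  have "(real k + 1) * (1 / 3) * (defect x / N / 4)\<^sup>2 \<le> (real k + 1) * (1 - phi_defect x v) ^ k * (phi_defect x v)\<^sup>2"
    by (intro mult_mono p s) (use p in \<open>auto intro: order_trans[of 0 "1/3"]\<close>)
  hence *: "(real k + 1) * (1 / 3) * (defect x / N / 4)\<^sup>2 \<le> kernel_density k (phi_defect x v)"
    by (simp add: kernel_density_def)
  have "1 \<le> 2 * (N - 1) / N" using N by (simp add: field_simps)
  from mult_right_mono[OF this, of "(defect x)\<^sup>2"]
  have "(defect x)\<^sup>2 \<le> 2 * (N - 1) / N * (defect x)\<^sup>2" by simp
  also have "\<dots> = 96 * N * ((N - 1) * (1 / 3) * (defect x / N / 4)\<^sup>2)"
    using N by (simp add: power2_eq_square field_simps)
  also have "\<dots> = 96 * N * ((real k + 1) * (1 / 3) * (defect x / N / 4)\<^sup>2)" by (simp add: N_def)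
  also have "\<dots> \<le> 96 * N * kernel_density k (phi_defect x v)" using * N by (intro mult_left_mono) auto
  finally show ?thesis by (simp add: N_def)
qed

context disc_measure begin

text \<open>Fatou along the Taylor polynomials of the kernel at \<open>a\<close>, all of norm at
  most 1. Only the diagonal of the form is used.\<close>

lemma kernel_density_integral_le:
  assumes M: "\<And>p. A2norm (poly p) \<le> 1 \<Longrightarrow> cmod (Tform \<mu> k (poly p) (poly p)) \<le> M"
    and a: "cmod a < 1"
  shows "(\<integral>\<^sup>+z. ennreal (kernel_density k (phi_defect z a) / (defect z)\<^sup>2) \<partial>\<mu>) \<le> ennreal M"
proof -
  have "(\<integral>\<^sup>+z. ennreal (kernel_density k (phi_defect z a) / (defect z)\<^sup>2) \<partial>\<mu>) = (\<integral>\<^sup>+z. liminf (\<lambda>n. ennreal (form_density k (kernel_poly a n) z)) \<partial>\<mu>)"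
  proof (intro nn_integral_cong_AE, use AE_disc in eventually_elim)
    fix z assume z: "cmod z < 1"
    have "(\<lambda>n. ennreal (form_density k (kernel_poly a n) z)) \<longlonglongrightarrow> ennreal ((cmod (of_real (defect a) * cnj (ek k (phi z a) * dphi z a)))\<^sup>2 / (defect z)\<^sup>2)"
      unfolding form_density_def using defect_pos[OF z] by (intro tendsto_intros A2ip_kernel_poly_tendsto a z) auto
    also have "(cmod (of_real (defect a) * cnj (ek k (phi z a) * dphi z a)))\<^sup>2 = kernel_density k (phi_defect z a)"
    proof -
      have "cmod (of_real (defect a) * cnj (ek k (phi z a) * dphi z a)) = sqrt (real k + 1) * cmod (phi z a) ^ k * (cmod (dphi z a) * defect a)"
        using defect_pos[OF a] by (simp add: norm_mult norm_power ek_def)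
      also have "cmod (dphi z a) * defect a = phi_defect z a" by (rule norm_dphi_mult_defect[OF z a])
      finally show ?thesis
        by (simp add: power_mult_distrib kernel_density_def power_mult[symmetric] mult.commute[of k])
           (simp add: power_mult cmod_phi_power2)
    qed
    finally show "ennreal (kernel_density k (phi_defect z a) / (defect z)\<^sup>2) = liminf (\<lambda>n. ennreal (form_density k (kernel_poly a n) z))"
      by (simp add: lim_imp_Liminf)
  qed
  also have "\<dots> \<le> liminf (\<lambda>n. \<integral>\<^sup>+z. ennreal (form_density k (kernel_poly a n) z) \<partial>\<mu>)"
    unfolding form_density_def by (intro nn_integral_liminf) measurable
  also have "\<dots> \<le> liminf (\<lambda>n::nat. ennreal M)"
    unfolding nn_integral_form_density
    by (intro Liminf_mono always_eventually allI ennreal_leI M A2norm_kernel_poly_le_1 a)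
  also have "\<dots> = ennreal M" by (simp add: Liminf_const)
  finally show ?thesis .
qed

text \<open>The densities at the two test points are added instead of choosing the good sign for
  each \<zeta>; this doubles 96 to 192.\<close>

lemma B0sup_le:
  assumes M: "\<And>p. A2norm (poly p) \<le> 1 \<Longrightarrow> cmod (Tform \<mu> k (poly p) (poly p)) \<le> M"
  shows "B0sup \<mu> \<le> ennreal (192 * (real k + 2)) * ennreal M"
  unfolding B0sup_def
proof (rule SUP_least)
  fix z :: complex assume "z \<in> ball 0 1"
  hence z: "cmod z < 1" by simp
  \<comment> \<open>The modulus is chosen so that \<open>defect v = 1 / (k + 2)\<close>, of the
    order of the point 2/(k+2) where \<open>kernel_density k\<close> peaks.\<close>
  define v where "v = complex_of_real (sqrt ((real k + 1) / (real k + 2)))"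
  have v: "cmod v < 1" "defect v = 1 / (real k + 2)" by (auto simp: v_def defect_def field_simps)
  have v': "cmod (- v) < 1" "defect (- v) = 1 / (real k + 2)" using v by (auto simp: defect_def)
  define a where "a = phi z v"
  define b where "b = phi z (- v)"
  have ab: "cmod a < 1" "cmod b < 1" using z v v' by (auto simp: a_def b_def cmod_phi_less_1)
  define E where "E a \<zeta> = ennreal (kernel_density k (phi_defect \<zeta> a) / (defect \<zeta>)\<^sup>2)" for a \<zeta>
  have kd: "0 \<le> kernel_density k (phi_defect \<zeta> a)" for \<zeta> a by (simp add: kernel_density_def phi_defect_le_1)
  have Em [measurable]: "E a \<in> borel_measurable borel" for a
    unfolding E_def[abs_def] kernel_density_def phi_defect_def by measurable
  have "B0 \<mu> z \<le> (\<integral>\<^sup>+\<zeta>. ennreal (96 * (real k + 2)) * (E a \<zeta> + E b \<zeta>) \<partial>\<mu>)"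
    unfolding B0_def
  proof (intro nn_integral_mono_AE, use AE_disc in eventually_elim)
    fix \<zeta> assume \<zeta>: "cmod \<zeta> < 1"
    define x where "x = phi z \<zeta>"
    have x: "cmod x < 1" using z \<zeta> by (simp add: x_def cmod_phi_less_1)
    \<comment> \<open>Applying \<open>phi z\<close> to both arguments moves \<zeta> to x and the two
      test points back to v and -v.\<close>
    have S1: "phi_defect \<zeta> a = phi_defect x v" "phi_defect \<zeta> b = phi_defect x (- v)"
      using phi_defect_phi_phi[OF z \<zeta>, of a] phi_defect_phi_phi[OF z \<zeta>, of b] ab v v' z by (auto simp: x_def a_def b_def phi_phi less_imp_le)
    have "(defect x)\<^sup>2 \<le> 96 * (real k + 2) * (kernel_density k (phi_defect \<zeta> a) + kernel_density k (phi_defect \<zeta> b))"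
    proof (cases "Re (cnj x * v) \<le> 0")
      case True
      have "(defect x)\<^sup>2 \<le> 96 * (real k + 2) * kernel_density k (phi_defect \<zeta> a)"
        unfolding S1 by (rule square_le_kernel_density[OF x v True])
      also have "\<dots> \<le> 96 * (real k + 2) * (kernel_density k (phi_defect \<zeta> a) + kernel_density k (phi_defect \<zeta> b))"
        using kd by (intro mult_left_mono) auto
      finally show ?thesis .
    next
      case False
      hence "Re (cnj x * - v) \<le> 0" by simp
      hence "(defect x)\<^sup>2 \<le> 96 * (real k + 2) * kernel_density k (phi_defect \<zeta> b)"
        unfolding S1 by (rule square_le_kernel_density[OF x v'])
      also have "\<dots> \<le> 96 * (real k + 2) * (kernel_density k (phi_defect \<zeta> a) + kernel_density k (phi_defect \<zeta> b))"
        using kd by (intro mult_left_mono) auto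
      finally show ?thesis .
    qed
    from divide_right_mono[OF this, of "(defect \<zeta>)\<^sup>2"]
    have "(defect x)\<^sup>2 / (defect \<zeta>)\<^sup>2 \<le> 96 * (real k + 2) * (kernel_density k (phi_defect \<zeta> a) / (defect \<zeta>)\<^sup>2 + kernel_density k (phi_defect \<zeta> b) / (defect \<zeta>)\<^sup>2)"
      by (simp only: add_divide_distrib[symmetric] times_divide_eq_right zero_le_power2 simp_thms)
    hence "ennreal ((defect x)\<^sup>2 / (defect \<zeta>)\<^sup>2) \<le> ennreal (96 * (real k + 2) * (kernel_density k (phi_defect \<zeta> a) / (defect \<zeta>)\<^sup>2 + kernel_density k (phi_defect \<zeta> b) / (defect \<zeta>)\<^sup>2))"
      by (rule ennreal_leI)
    also have "\<dots> = ennreal (96 * (real k + 2)) * (E a \<zeta> + E b \<zeta>)"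
      unfolding E_def using kd by (subst ennreal_mult) (auto simp del: ennreal_plus simp flip: ennreal_plus)
    finally show "ennreal ((1 - (cmod (phi z \<zeta>))\<^sup>2)\<^sup>2 / (1 - (cmod \<zeta>)\<^sup>2)\<^sup>2) \<le> ennreal (96 * (real k + 2)) * (E a \<zeta> + E b \<zeta>)"
      by (simp only: defect_def x_def)
  qed
  also have "\<dots> = ennreal (96 * (real k + 2)) * ((\<integral>\<^sup>+\<zeta>. E a \<zeta> \<partial>\<mu>) + (\<integral>\<^sup>+\<zeta>. E b \<zeta> \<partial>\<mu>))"
    by (simp add: nn_integral_cmult nn_integral_add)
  also have "\<dots> \<le> ennreal (96 * (real k + 2)) * (ennreal M + ennreal M)"
    unfolding E_def by (intro mult_left_mono add_mono kernel_density_integral_le M ab) auto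
  also have "\<dots> = ennreal (96 * (real k + 2)) * 2 * ennreal M" by (simp only: mult_2 mult.assoc)
  also have "ennreal (96 * (real k + 2)) * 2 = ennreal (192 * (real k + 2))"
  proof -
    have "ennreal x * 2 = ennreal (x * 2)" if "0 \<le> x" for x
      using ennreal_mult[of x 2] that by simp
    from this[of "96 * (real k + 2)"] have "ennreal (96 * (real k + 2)) * 2 = ennreal (96 * (real k + 2) * 2)" by simp
    also have "96 * (real k + 2) * 2 = 192 * (real k + 2)" by simp
    finally show ?thesis .
  qed
  finally show "B0 \<mu> z \<le> ennreal (192 * (real k + 2)) * ennreal M" .
qed

end

section \<open>Carleson measures have bounded Berezin transform\<close>

text \<open>Closed sublevel sets exhaust a completely metrizable product space, so by Baire one of
  them has interior. A basic open set of the product topology restricts only finitely many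
  coordinates, all below some N.\<close>

lemma uniformly_bounded_on_cylinder:
  fixes Q :: "(nat \<Rightarrow> real) \<Rightarrow> ennreal"
  assumes cl: "\<And>M::nat. closed {c. Q c \<le> of_nat M}" and fin: "\<And>c. Q c < \<infinity>"
  shows "\<exists>(M::nat) c0 (N::nat). \<forall>c. (\<forall>i<N. c i = c0 i) \<longrightarrow> Q c \<le> of_nat M"
proof -
  have "\<exists>M::nat. (euclidean :: (nat \<Rightarrow> real) topology) interior_of {c. Q c \<le> of_nat M} \<noteq> {}"
  proof (rule ccontr)
    assume neg: "\<not> (\<exists>M::nat. (euclidean :: (nat \<Rightarrow> real) topology) interior_of {c. Q c \<le> of_nat M} \<noteq> {})"
    have "(euclidean :: (nat \<Rightarrow> real) topology) interior_of \<Union> (range (\<lambda>M::nat. {c. Q c \<le> of_nat M})) = {}"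
    proof (rule Baire_category_alt)
      show "completely_metrizable_space (euclidean :: (nat \<Rightarrow> real) topology) \<or> locally_compact_space (euclidean :: (nat \<Rightarrow> real) topology) \<and> regular_space (euclidean :: (nat \<Rightarrow> real) topology)"
        using completely_metrizable_space_euclidean by blast
    qed (use neg cl in auto)
    moreover have "\<Union> (range (\<lambda>M::nat. {c. Q c \<le> of_nat M})) = UNIV"
    proof (intro equalityI subsetI UNIV_I)
      fix c
      obtain M :: nat where "Q c < of_nat M"
        using ennreal_Ex_less_of_nat[of "Q c"] fin[of c] by (auto simp: infinity_ennreal_def)
      thus "c \<in> \<Union> (range (\<lambda>M::nat. {c. Q c \<le> of_nat M}))" by (auto intro: less_imp_le)
    qed
    ultimately show False by (metis UNIV_not_empty interior_of_topspace topspace_euclidean)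
  qed
  then obtain M :: nat and c0 where "c0 \<in> (euclidean :: (nat \<Rightarrow> real) topology) interior_of {c. Q c \<le> of_nat M}"
    by blast
  then obtain V where V: "openin (euclidean :: (nat \<Rightarrow> real) topology) V" "c0 \<in> V" "V \<subseteq> {c. Q c \<le> of_nat M}"
    unfolding interior_of_def by blast
  have "openin (product_topology (\<lambda>i. euclidean :: real topology) UNIV) V"
    using V(1) by (simp only: euclidean_product_topology)
  from product_topology_open_contains_basis[OF this V(2)]
  obtain X where X: "c0 \<in> Pi\<^sub>E UNIV X" "finite {i. X i \<noteq> UNIV}" "Pi\<^sub>E UNIV X \<subseteq> V"
    by auto
  obtain N where N: "\<And>i. X i \<noteq> UNIV \<Longrightarrow> i < N"
    using X(2) finite_nat_set_iff_bounded by auto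
  have "Q c \<le> of_nat M" if c: "\<forall>i<N. c i = c0 i" for c
  proof -
    have "c i \<in> X i" for i
    proof (cases "X i = UNIV")
      case False
      thus ?thesis using N[of i] c X(1) by (auto simp: PiE_iff)
    qed simp
    hence "c \<in> Pi\<^sub>E UNIV X" by (auto simp: PiE_iff)
    thus ?thesis using X(3) V(3) by auto
  qed
  thus ?thesis by blast
qed

lemma cmod_dphi_le:
  assumes a: "cmod a < 1" and w: "cmod w < 1"
  shows "cmod (dphi a w) \<le> 1 / (1 - cmod w)\<^sup>2"
proof -
  have "cmod (cnj a * w) \<le> cmod w" using a by (simp add: norm_mult mult_left_le_one_le)
  hence "1 - cmod w \<le> cmod (1 - cnj a * w)" using norm_triangle_ineq2[of 1 "cnj a * w"] by simp
  hence "(1 - cmod w)\<^sup>2 \<le> (cmod (1 - cnj a * w))\<^sup>2" using w by (intro power_mono) auto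
  moreover have "cmod (dphi a w) = defect a / (cmod (1 - cnj a * w))\<^sup>2"
    using defect_pos[OF a] by (simp add: dphi_def norm_divide norm_power)
  ultimately show ?thesis using defect_le_1[of a] defect_pos[OF a] w by (simp, intro frac_le) auto
qed

text \<open>Total mass of the push-forward identity for \<open>phi a\<close>: these kernels are unit
  vectors of \<open>A2\<close>.\<close>

lemma nn_integral_dphi_power2:
  assumes a: "cmod a < 1"
  shows "(\<integral>\<^sup>+w. ennreal ((cmod (dphi a w))\<^sup>2) \<partial>dA) = 1"
proof -
  have "emeasure dA UNIV = emeasure (distr (density dA (\<lambda>w. ennreal ((cmod (dphi a w))\<^sup>2))) borel (phi a)) UNIV"
    by (simp only: distr_dA_phi[OF a])
  also have "\<dots> = (\<integral>\<^sup>+w. ennreal ((cmod (dphi a w))\<^sup>2) \<partial>dA)"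
    by (subst emeasure_distr, simp, simp, subst emeasure_density) auto
  finally show ?thesis by (simp add: emeasure_dA_UNIV)
qed

text \<open>Up to sign, \<open>dphi (a n)\<close> is the normalized reproducing kernel at \<open>a n\<close>. Truncating the coefficients
  lets them range over all of \<open>nat \<Rightarrow> real\<close>, a complete metric space.\<close>

definition kernel_series :: "(nat \<Rightarrow> complex) \<Rightarrow> (nat \<Rightarrow> real) \<Rightarrow> complex \<Rightarrow> complex" where
  "kernel_series a c w = (\<Sum>n. of_real ((1/4) ^ n * max (-1) (min 1 (c n))) * dphi (a n) w)"

context
  fixes a :: "nat \<Rightarrow> complex" assumes a: "\<And>n. cmod (a n) < 1"
begin

lemma kernel_series_term_le:
  assumes "cmod w \<le> r" "r < 1"
  shows "cmod (of_real ((1/4) ^ n * max (-1) (min 1 (c n))) * dphi (a n) w) \<le> (1/4) ^ n * (1 / (1 - r)\<^sup>2)"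
proof -
  have "cmod (dphi (a n) w) \<le> 1 / (1 - cmod w)\<^sup>2" using cmod_dphi_le[OF a, of w n] assms by simp
  also have "\<dots> \<le> 1 / (1 - r)\<^sup>2"
    using assms by (intro divide_left_mono power_mono mult_pos_pos zero_less_power) auto
  finally have d: "cmod (dphi (a n) w) \<le> 1 / (1 - r)\<^sup>2" .
  have "cmod (of_real ((1/4) ^ n * max (-1) (min 1 (c n)))) = (1/4) ^ n * \<bar>max (-1) (min 1 (c n))\<bar>"
    by (simp only: norm_of_real abs_mult) simp
  also have "\<dots> \<le> (1/4) ^ n * 1" by (intro mult_left_mono) auto
  finally show ?thesis unfolding norm_mult[of "of_real _"] using d by (intro mult_mono) auto
qed

lemma summable_majorant: "summable (\<lambda>n. (1/4) ^ n * (K::real))"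
  by (intro summable_mult2 summable_geometric) auto

lemma kernel_series_sums:
  assumes w: "cmod w < 1"
  shows "(\<lambda>n. of_real ((1/4) ^ n * max (-1) (min 1 (c n))) * dphi (a n) w) sums kernel_series a c w"
proof -
  have "summable (\<lambda>n. of_real ((1/4) ^ n * max (-1) (min 1 (c n))) * dphi (a n) w)"
    by (rule summable_comparison_test'[OF summable_majorant[of "1 / (1 - cmod w)\<^sup>2"], of 0])
       (use kernel_series_term_le[OF order_refl w] in auto)
  thus ?thesis unfolding kernel_series_def by (rule summable_sums)
qed

lemma kernel_series_holomorphic: "kernel_series a c holomorphic_on ball 0 1"
proof (rule holomorphic_uniform_sequence[OF open_ball])
  let ?t = "\<lambda>n w. of_real ((1/4) ^ n * max (-1) (min 1 (c n))) * dphi (a n) w"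
  show "(\<lambda>w. \<Sum>n<m. ?t n w) holomorphic_on ball 0 1" for m
    unfolding dphi_def using one_minus_cnj_mult_nonzero[OF a]
    by (intro holomorphic_intros) (auto simp: less_imp_le)
  fix x :: complex assume x: "x \<in> ball 0 1"
  define d where "d = (1 - cmod x) / 2"
  have d: "0 < d" using x by (simp add: d_def)
  have cw: "cmod w \<le> 1 - d" if "w \<in> cball x d" for w
  proof -
    have "cmod w \<le> cmod x + dist x w"
      using norm_triangle_ineq[of x "w - x"] by (simp add: dist_norm norm_minus_commute)
    moreover have "cmod x = 1 - 2 * d" by (simp add: d_def field_simps)
    ultimately show ?thesis using that by simp
  qed
  have "uniform_limit (cball x d) (\<lambda>m w. \<Sum>n<m. ?t n w) (\<lambda>w. suminf (\<lambda>n. ?t n w)) sequentially"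
    by (rule Weierstrass_m_test[OF _ summable_majorant[of "1 / (1 - (1 - d))\<^sup>2"]])
       (use cw d in \<open>intro kernel_series_term_le, auto\<close>)
  thus "\<exists>d>0. cball x d \<subseteq> ball 0 1 \<and> uniform_limit (cball x d) (\<lambda>m w. \<Sum>n<m. ?t n w) (kernel_series a c) sequentially"
    using d cw unfolding kernel_series_def[abs_def] by (intro exI[of _ d]) (force simp: subset_iff)
qed

text \<open>Cauchy-Schwarz after splitting \<open>(1/4)^n\<close> into
  \<open>(1/2)^n * (1/2)^n\<close>. A geometric weight is left on the squares, whose integrals are
  all 1; the 2 is a generous bound for 4/3.\<close>

lemma kernel_series_partial_sum_le:
  "(cmod (\<Sum>n<m. of_real ((1/4) ^ n * max (-1) (min 1 (c n))) * dphi (a n) w))\<^sup>2 \<le> 2 * (\<Sum>n<m. (1/4) ^ n * (cmod (dphi (a n) w))\<^sup>2)"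
proof -
  let ?x = "\<lambda>n. cmod (dphi (a n) w)"
  have t: "cmod (of_real ((1/4) ^ n * max (-1) (min 1 (c n))) * dphi (a n) w) \<le> (1/2) ^ n * ((1/2) ^ n * ?x n)" for n
  proof -
    have "cmod (of_real ((1/4) ^ n * max (-1) (min 1 (c n)))) = (1/4) ^ n * \<bar>max (-1) (min 1 (c n))\<bar>"
      by (simp only: norm_of_real abs_mult) simp
    also have "\<dots> \<le> (1/4) ^ n * 1" by (intro mult_left_mono) auto
    also have "\<dots> = (1/2) ^ n * (1/2) ^ n" by (simp flip: power_mult_distrib)
    finally show ?thesis unfolding norm_mult[of "of_real _"] by (simp add: mult_right_mono flip: mult.assoc)
  qed
  have "cmod (\<Sum>n<m. of_real ((1/4) ^ n * max (-1) (min 1 (c n))) * dphi (a n) w) \<le> (\<Sum>n<m. (1/2) ^ n * ((1/2) ^ n * ?x n))"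
    by (rule order_trans[OF norm_sum sum_mono]) (rule t)
  hence "(cmod (\<Sum>n<m. of_real ((1/4) ^ n * max (-1) (min 1 (c n))) * dphi (a n) w))\<^sup>2 \<le> (\<Sum>n<m. (1/2) ^ n * ((1/2) ^ n * ?x n))\<^sup>2"
    by (intro power_mono) auto
  also have "\<dots> \<le> (\<Sum>n<m. ((1/2) ^ n)\<^sup>2) * (\<Sum>n<m. ((1/2) ^ n * ?x n)\<^sup>2)"
    by (rule Cauchy_Schwarz_ineq_sum)
  also have "\<dots> \<le> 2 * (\<Sum>n<m. ((1/2) ^ n * ?x n)\<^sup>2)"
  proof (rule mult_right_mono)
    have "(\<Sum>n<m. ((1/2::real) ^ n)\<^sup>2) = (\<Sum>n<m. (1/4) ^ n)"
      by (intro sum.cong refl) (simp add: power2_eq_square flip: power_mult_distrib)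
    also have "\<dots> \<le> 2" by (simp add: sum_gp_strict) (rule order_trans[of _ 0], simp_all)
    finally show "(\<Sum>n<m. ((1/2::real) ^ n)\<^sup>2) \<le> 2" .
  qed (simp add: sum_nonneg)
  also have "(\<Sum>n<m. ((1/2) ^ n * ?x n)\<^sup>2) = (\<Sum>n<m. (1/4) ^ n * (?x n)\<^sup>2)"
    by (intro sum.cong refl) (simp add: power_mult_distrib power2_eq_square flip: power_mult_distrib)
  finally show ?thesis .
qed

text \<open>Fatou on the partial sums; the unit kernels contribute at most
  \<open>2 * (1/4)^n\<close> each, in total less than 4.\<close>

lemma kernel_series_A2: "kernel_series a c \<in> A2"
proof -
  let ?p = "\<lambda>m w. \<Sum>n<m. of_real ((1/4) ^ n * max (-1) (min 1 (c n))) * dphi (a n) w"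
  have "(\<integral>\<^sup>+w. ennreal ((cmod (kernel_series a c w))\<^sup>2) \<partial>dA) = (\<integral>\<^sup>+w. liminf (\<lambda>m. ennreal ((cmod (?p m w))\<^sup>2)) \<partial>dA)"
  proof (intro nn_integral_cong_AE AE_dA_I)
    fix w :: complex assume w: "cmod w < 1"
    have "(\<lambda>m. ennreal ((cmod (?p m w))\<^sup>2)) \<longlonglongrightarrow> ennreal ((cmod (kernel_series a c w))\<^sup>2)"
      using kernel_series_sums[OF w] unfolding sums_def by (intro tendsto_intros) auto
    from lim_imp_Liminf[OF trivial_limit_sequentially this]
    show "ennreal ((cmod (kernel_series a c w))\<^sup>2) = liminf (\<lambda>m. ennreal ((cmod (?p m w))\<^sup>2))"
      by (rule sym)
  qed
  also have "\<dots> \<le> liminf (\<lambda>m. \<integral>\<^sup>+w. ennreal ((cmod (?p m w))\<^sup>2) \<partial>dA)"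
    by (intro nn_integral_liminf) measurable
  also have "\<dots> \<le> liminf (\<lambda>m::nat. 4)"
  proof (intro Liminf_mono always_eventually allI)
    fix m
    have "(\<integral>\<^sup>+w. ennreal ((cmod (?p m w))\<^sup>2) \<partial>dA) \<le> (\<integral>\<^sup>+w. (\<Sum>n<m. ennreal (2 * (1/4) ^ n) * ennreal ((cmod (dphi (a n) w))\<^sup>2)) \<partial>dA)"
    proof (intro nn_integral_mono)
      fix w
      have "ennreal ((cmod (?p m w))\<^sup>2) \<le> ennreal (\<Sum>n<m. 2 * (1/4) ^ n * (cmod (dphi (a n) w))\<^sup>2)"
        using kernel_series_partial_sum_le[where c=c] by (intro ennreal_leI) (simp add: sum_distrib_left mult.assoc)
      also have "\<dots> = (\<Sum>n<m. ennreal (2 * (1/4) ^ n * (cmod (dphi (a n) w))\<^sup>2))"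
        by (rule sum_ennreal[symmetric]) simp
      also have "\<dots> = (\<Sum>n<m. ennreal (2 * (1/4) ^ n) * ennreal ((cmod (dphi (a n) w))\<^sup>2))"
        by (intro sum.cong refl ennreal_mult) auto
      finally show "ennreal ((cmod (?p m w))\<^sup>2) \<le> \<dots>" .
    qed
    also have "\<dots> = (\<Sum>n<m. ennreal (2 * (1/4) ^ n) * (\<integral>\<^sup>+w. ennreal ((cmod (dphi (a n) w))\<^sup>2) \<partial>dA))"
      by (subst nn_integral_sum) (auto intro!: sum.cong nn_integral_cmult)
    also have "\<dots> = (\<Sum>n<m. ennreal (2 * (1/4) ^ n))"
      by (simp only: nn_integral_dphi_power2[OF a] mult_1_right)
    also have "\<dots> = ennreal (\<Sum>n<m. 2 * (1/4) ^ n)" by (rule sum_ennreal) simp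
    also have "(\<Sum>n<m. 2 * (1/4) ^ n) \<le> (4::real)"
      by (simp add: sum_gp_strict flip: sum_distrib_left) (rule order_trans[of _ 0], simp_all)
    hence "ennreal (\<Sum>n<m. 2 * (1/4) ^ n) \<le> 4" by (metis ennreal_leI ennreal_numeral zero_le_numeral)
    finally show "(\<integral>\<^sup>+w. ennreal ((cmod (?p m w))\<^sup>2) \<partial>dA) \<le> 4" .
  qed
  also have "\<dots> < \<infinity>" by (simp add: Liminf_const)
  finally show ?thesis by (simp add: A2_def kernel_series_holomorphic)
qed

text \<open>A uniform limit of functions of finitely many coordinates is continuous for the product
  topology; this will make the sublevel sets closed.\<close>

lemma kernel_series_continuous:
  assumes w: "cmod w < 1"
  shows "continuous_on UNIV (\<lambda>c. kernel_series a c w)"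
proof (rule uniform_limit_theorem)
  let ?t = "\<lambda>n c. of_real ((1/4) ^ n * max (-1) (min 1 (c n))) * dphi (a n) w :: complex"
  show "\<forall>\<^sub>F m in sequentially. continuous_on UNIV (\<lambda>c. \<Sum>n<m. ?t n c)"
    by (intro always_eventually allI continuous_intros continuous_on_product_coordinates)
  show "uniform_limit UNIV (\<lambda>m c. \<Sum>n<m. ?t n c) (\<lambda>c. kernel_series a c w) sequentially"
    unfolding kernel_series_def
    by (rule Weierstrass_m_test[OF _ summable_majorant[of "1 / (1 - cmod w)\<^sup>2"]])
       (intro kernel_series_term_le order_refl w)
qed simp

lemma measurable_kernel_series_indicator:
  "(\<lambda>w. indicator (ball 0 1) w *\<^sub>R kernel_series a c w) \<in> borel_measurable borel"
  by (intro borel_measurable_continuous_on_indicator holomorphic_on_imp_continuous_on kernel_series_holomorphic) auto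

text \<open>Changing one coordinate isolates one kernel. The values 1 and -1 are untouched by the
  truncation.\<close>

lemma kernel_series_diff:
  assumes w: "cmod w < 1" and c: "c m = 1" "c' m = -1" "\<And>n. n \<noteq> m \<Longrightarrow> c n = c' n"
  shows "kernel_series a c w - kernel_series a c' w = of_real (2 * (1/4) ^ m) * dphi (a m) w"
proof -
  let ?t = "\<lambda>c n. of_real ((1/4) ^ n * max (-1) (min 1 (c n))) * dphi (a n) w :: complex"
  have "(\<lambda>n. ?t c n - ?t c' n) sums (kernel_series a c w - kernel_series a c' w)"
    by (intro sums_diff kernel_series_sums w)
  moreover have "(\<lambda>n. ?t c n - ?t c' n) = (\<lambda>n. if n = m then of_real (2 * (1/4) ^ m) * dphi (a m) w else 0)"
    using c by (auto simp: fun_eq_iff)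
  ultimately show ?thesis
    using sums_unique2[OF _ sums_single[of m "\<lambda>_. of_real (2 * (1/4) ^ m) * dphi (a m) w"]] by simp
qed

end

context disc_measure begin

lemma B0_eq: 
  assumes "cmod a < 1"
  shows "B0 \<mu> a = (\<integral>\<^sup>+z. ennreal ((cmod (dphi a z))\<^sup>2) \<partial>\<mu>)"
  unfolding B0_def
proof (intro nn_integral_cong_AE, use AE_disc in eventually_elim)
  fix z assume z: "cmod z < 1"
  have "1 - (cmod (phi a z))\<^sup>2 = cmod (dphi a z) * defect z"
    using norm_dphi_mult_defect[OF assms z] by (simp add: phi_defect_def)
  moreover have "1 - (cmod z)\<^sup>2 = defect z" by (simp add: defect_def)
  ultimately show "ennreal ((1 - (cmod (phi a z))\<^sup>2)\<^sup>2 / (1 - (cmod z)\<^sup>2)\<^sup>2) = ennreal ((cmod (dphi a z))\<^sup>2)"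
    using defect_pos[OF z] by (simp add: power_mult_distrib)
qed

text \<open>If \<open>B0\<close> were unbounded, points \<open>a m\<close> with rapidly growing
  values would exist. Two series in the Baire cylinder that differ only in coordinate m then bound
  \<open>B0\<close> at \<open>a m\<close> by \<open>16^m * M\<close>, which is too small for m >
  M.\<close>

lemma B0sup_finite_if_Carleson:
  assumes C: "Carleson \<mu>"
  shows "B0sup \<mu> < \<infinity>"
proof (rule ccontr)
  assume "\<not> B0sup \<mu> < \<infinity>"
  hence top: "B0sup \<mu> = top" by (simp add: less_top[symmetric])
  \<comment> \<open>The factor \<open>16^m\<close> compensates the square of the coefficient
    \<open>(1/4)^m\<close>; the factor m leaves the contradiction.\<close>
  have "\<exists>z. cmod z < 1 \<and> ennreal (16 ^ m * real m) < B0 \<mu> z" for m :: nat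
  proof -
    have "ennreal (16 ^ m * real m) < (SUP z\<in>ball 0 1. B0 \<mu> z)"
      unfolding B0sup_def[symmetric] top by simp
    thus ?thesis unfolding less_SUP_iff by auto
  qed
  then obtain a where a: "\<And>m. cmod (a m) < 1" "\<And>m. ennreal (16 ^ m * real m) < B0 \<mu> (a m)"
    by metis
  define Q where "Q c = (\<integral>\<^sup>+z. ennreal ((cmod (kernel_series a c z))\<^sup>2) \<partial>\<mu>)" for c
  have Q': "Q c = (\<integral>\<^sup>+z. ennreal ((cmod (indicator (ball 0 1) z *\<^sub>R kernel_series a c z))\<^sup>2) \<partial>\<mu>)" for c
    unfolding Q_def by (intro nn_integral_cong_AE, use AE_disc in eventually_elim) simp
  note [measurable] = measurable_kernel_series_indicator[of a, OF a(1)]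
  have "\<exists>(M::nat) c0 (N::nat). \<forall>c. (\<forall>i<N. c i = c0 i) \<longrightarrow> Q c \<le> of_nat M"
  proof (rule uniformly_bounded_on_cylinder)
    show "Q c < \<infinity>" for c
      using C kernel_series_A2[of a, OF a(1)] unfolding Carleson_def Q_def by blast
    \<comment> \<open>Fatou and pointwise continuity in c make \<open>Q\<close> lower
      semicontinuous.\<close>
    show "closed {c. Q c \<le> of_nat M}" for M :: nat
      unfolding closed_sequential_limits
    proof (intro allI impI)
      fix x :: "nat \<Rightarrow> nat \<Rightarrow> real" and l
      assume "(\<forall>n. x n \<in> {c. Q c \<le> of_nat M}) \<and> x \<longlonglongrightarrow> l"
      hence x: "\<And>n. Q (x n) \<le> of_nat M" "x \<longlonglongrightarrow> l" by auto
      have "Q l = (\<integral>\<^sup>+z. liminf (\<lambda>n. ennreal ((cmod (indicator (ball 0 1) z *\<^sub>R kernel_series a (x n) z))\<^sup>2)) \<partial>\<mu>)"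
        unfolding Q_def
      proof (intro nn_integral_cong_AE, use AE_disc in eventually_elim)
        fix z assume z: "cmod z < 1"
        have "(\<lambda>n. kernel_series a (x n) z) \<longlonglongrightarrow> kernel_series a l z"
          by (rule continuous_on_tendsto_compose[OF kernel_series_continuous[of a, OF a(1) z] x(2)]) auto
        hence "(\<lambda>n. ennreal ((cmod (kernel_series a (x n) z))\<^sup>2)) \<longlonglongrightarrow> ennreal ((cmod (kernel_series a l z))\<^sup>2)"
          by (intro tendsto_intros) auto
        from lim_imp_Liminf[OF trivial_limit_sequentially this]
        show "ennreal ((cmod (kernel_series a l z))\<^sup>2) = liminf (\<lambda>n. ennreal ((cmod (indicator (ball 0 1) z *\<^sub>R kernel_series a (x n) z))\<^sup>2))"
          using z by simp
      qed
      also have "\<dots> \<le> liminf (\<lambda>n. Q (x n))"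
        unfolding Q' by (intro nn_integral_liminf) measurable
      also have "\<dots> \<le> liminf (\<lambda>n::nat. of_nat M)"
        by (intro Liminf_mono always_eventually allI x)
      also have "\<dots> = of_nat M" by (simp add: Liminf_const)
      finally show "l \<in> {c. Q c \<le> of_nat M}" by simp
    qed
  qed
  then obtain M N :: nat and c0 where M: "\<And>c. (\<forall>i<N. c i = c0 i) \<Longrightarrow> Q c \<le> of_nat M"
    by blast
  \<comment> \<open>m \<ge> N keeps both modifications of \<open>c0\<close> in the cylinder; m > M
    contradicts the final estimate.\<close>
  define m where "m = max N (Suc M)"
  define c where "c = c0(m := 1)"
  define c' where "c' = c0(m := -1)"
  have Q: "Q c \<le> of_nat M" "Q c' \<le> of_nat M" by (auto intro!: M simp: c_def c'_def m_def)
  have "ennreal (4 / 16 ^ m) * B0 \<mu> (a m) = (\<integral>\<^sup>+z. ennreal (4 / 16 ^ m) * ennreal ((cmod (dphi (a m) z))\<^sup>2) \<partial>\<mu>)"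
    unfolding B0_eq[OF a(1)] by (intro nn_integral_cmult[symmetric]) measurable
  also have "\<dots> \<le> (\<integral>\<^sup>+z. 2 * ennreal ((cmod (indicator (ball 0 1) z *\<^sub>R kernel_series a c z))\<^sup>2) + 2 * ennreal ((cmod (indicator (ball 0 1) z *\<^sub>R kernel_series a c' z))\<^sup>2) \<partial>\<mu>)"
  proof (intro nn_integral_mono_AE, use AE_disc in eventually_elim)
    fix z assume z: "cmod z < 1"
    let ?f = "kernel_series a c z" and ?g = "kernel_series a c' z"
    have d: "?f - ?g = of_real (2 * (1/4) ^ m) * dphi (a m) z"
      by (rule kernel_series_diff[of a, OF a(1) z]) (auto simp: c_def c'_def)
    have "4 / 16 ^ m * (cmod (dphi (a m) z))\<^sup>2 = (cmod (?f - ?g))\<^sup>2"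
      unfolding d norm_mult norm_of_real
      by (simp add: power_mult_distrib power_divide power_one_over flip: power_mult) (simp add: power_mult[of 4 2 m, symmetric] mult.commute[of m] power_mult)
    also have "\<dots> \<le> (cmod ?f + cmod ?g)\<^sup>2" by (intro power_mono norm_triangle_ineq4) auto
    also have "\<dots> \<le> 2 * (cmod ?f)\<^sup>2 + 2 * (cmod ?g)\<^sup>2"
      using zero_le_power2[of "cmod ?f - cmod ?g"] by (simp add: power2_eq_square algebra_simps)
    finally have "ennreal (4 / 16 ^ m * (cmod (dphi (a m) z))\<^sup>2) \<le> ennreal (2 * (cmod ?f)\<^sup>2 + 2 * (cmod ?g)\<^sup>2)"
      by (rule ennreal_leI)
    moreover have "ennreal (4 / 16 ^ m) * ennreal ((cmod (dphi (a m) z))\<^sup>2) = ennreal (4 / 16 ^ m * (cmod (dphi (a m) z))\<^sup>2)"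
      by (rule ennreal_mult[symmetric]) simp_all
    ultimately show "ennreal (4 / 16 ^ m) * ennreal ((cmod (dphi (a m) z))\<^sup>2) \<le> 2 * ennreal ((cmod (indicator (ball 0 1) z *\<^sub>R ?f))\<^sup>2) + 2 * ennreal ((cmod (indicator (ball 0 1) z *\<^sub>R ?g))\<^sup>2)"
      using z by (simp add: ennreal_mult)
  qed
  also have "\<dots> = 2 * Q c + 2 * Q c'"
  proof -
    have me: "(\<lambda>z. ennreal ((cmod (indicator (ball 0 1) z *\<^sub>R kernel_series a c z))\<^sup>2)) \<in> borel_measurable \<mu>" for c
      by measurable
    have "2 * Q c = (\<integral>\<^sup>+z. 2 * ennreal ((cmod (indicator (ball 0 1) z *\<^sub>R kernel_series a c z))\<^sup>2) \<partial>\<mu>)" for c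
      unfolding Q' by (rule nn_integral_cmult[OF me, symmetric])
    thus ?thesis by (simp only:) (intro nn_integral_add borel_measurable_times_ennreal me borel_measurable_const)
  qed
  also have "\<dots> \<le> 2 * of_nat M + 2 * of_nat M" by (intro add_mono mult_left_mono Q) auto
  also have "\<dots> = ennreal (4 * real M)"
    by (simp add: ennreal_of_nat_eq_real_of_nat ennreal_mult flip: distrib_right)
  finally have le: "ennreal (4 / 16 ^ m) * B0 \<mu> (a m) \<le> ennreal (4 * real M)" .
  have "ennreal (4 * real m) = ennreal (4 / 16 ^ m) * ennreal (16 ^ m * real m)"
    by (subst ennreal_mult[symmetric]) auto
  also have "\<dots> \<le> ennreal (4 / 16 ^ m) * B0 \<mu> (a m)"
    by (intro mult_left_mono less_imp_le a(2)) auto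
  also note le
  finally have "m \<le> M" by (simp add: ennreal_le_iff)
  thus False by (simp add: m_def)
qed

section \<open>The equivalence and the two norm estimates\<close>

lemma Tbounded_iff_Carleson: "Tbounded \<mu> k \<longleftrightarrow> Carleson \<mu>"
proof
  assume "Tbounded \<mu> k"
  then obtain M where M: "\<And>p r. cmod (Tform \<mu> k (poly p) (poly r)) \<le> M * A2norm (poly p) * A2norm (poly r)"
    unfolding Tbounded_def by blast
  have "cmod (Tform \<mu> k (poly p) (poly p)) \<le> \<bar>M\<bar>" if "A2norm (poly p) \<le> 1" for p
  proof -
    have "cmod (Tform \<mu> k (poly p) (poly p)) \<le> M * (A2norm (poly p) * A2norm (poly p))"
      using M[of p p] by (simp only: mult.assoc)
    also have "\<dots> \<le> \<bar>M\<bar> * 1"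
      using that A2norm_nonneg by (intro mult_mono mult_le_one mult_nonneg_nonneg) auto
    finally show ?thesis by simp
  qed
  from B0sup_le[of k, OF this] have "B0sup \<mu> \<le> ennreal (192 * (real k + 2)) * ennreal \<bar>M\<bar>" by simp
  also have "\<dots> < \<infinity>" by (simp add: ennreal_mult_less_top)
  finally show "Carleson \<mu>" by (rule Carleson_if_B0sup_finite)
next
  assume "Carleson \<mu>"
  hence "B0sup \<mu> = ennreal (enn2real (B0sup \<mu>))" using B0sup_finite_if_Carleson by simp
  from Tform_bound[OF this enn2real_nonneg] show "Tbounded \<mu> k" unfolding Tbounded_def by blast
qed

lemma Tnorm_bounds:
  assumes "Carleson \<mu>"
  shows "ennreal (1 / 192 / (real k + 2)) * B0sup \<mu> \<le> ennreal (Tnorm \<mu> k)"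
    and "ennreal (Tnorm \<mu> k) \<le> ennreal (4 * (real k + 2)) * B0sup \<mu>"
proof -
  define B where "B = enn2real (B0sup \<mu>)"
  have B: "B0sup \<mu> = ennreal B" "0 \<le> B" using B0sup_finite_if_Carleson[OF assms] by (simp_all add: B_def)
  define X where "X = {cmod (Tform \<mu> k (poly p) (poly r)) | p r. A2norm (poly p) \<le> 1 \<and> A2norm (poly r) \<le> 1}"
  have Tn: "Tnorm \<mu> k = Sup X" by (simp add: Tnorm_def X_def)
  have up: "x \<le> 4 * (real k + 2) * B" if x: "x \<in> X" for x
  proof -
    obtain p r where x: "x = cmod (Tform \<mu> k (poly p) (poly r))" "A2norm (poly p) \<le> 1" "A2norm (poly r) \<le> 1"
      using x unfolding X_def by blast
    have "x \<le> (4 * (real k + 2) * B) * (A2norm (poly p) * A2norm (poly r))"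
      using Tform_bound[OF B, of k p r] x(1) by (simp only: mult.assoc)
    also have "\<dots> \<le> (4 * (real k + 2) * B) * 1"
      using x B A2norm_nonneg by (intro mult_left_mono mult_le_one) auto
    finally show ?thesis by simp
  qed
  have "A2norm (poly 0) = 0" by (simp add: A2norm_def)
  hence ne: "X \<noteq> {}"
    unfolding X_def by (metis (mono_tags, lifting) empty_iff mem_Collect_eq zero_less_one less_imp_le)
  have "Tnorm \<mu> k \<le> 4 * (real k + 2) * B" unfolding Tn by (rule cSup_least[OF ne up])
  hence "ennreal (Tnorm \<mu> k) \<le> ennreal (4 * (real k + 2) * B)" by (rule ennreal_leI)
  also have "\<dots> = ennreal (4 * (real k + 2)) * B0sup \<mu>" unfolding B by (rule ennreal_mult) (use B in auto)
  finally show "ennreal (Tnorm \<mu> k) \<le> ennreal (4 * (real k + 2)) * B0sup \<mu>" .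
  \<comment> \<open>A real supremum dominates its elements only for a set bounded above; the
    Carleson hypothesis provides the bound.\<close>
  have bdd: "bdd_above X" using up by (auto simp: bdd_above_def)
  have "cmod (Tform \<mu> k (poly p) (poly p)) \<le> Tnorm \<mu> k" if "A2norm (poly p) \<le> 1" for p
    unfolding Tn using that by (intro cSup_upper bdd) (auto simp: X_def)
  from B0sup_le[of k, OF this]
  have le: "B0sup \<mu> \<le> ennreal (192 * (real k + 2)) * ennreal (Tnorm \<mu> k)" by simp
  have "ennreal (1 / 192 / (real k + 2)) * B0sup \<mu> \<le> ennreal (1 / 192 / (real k + 2)) * (ennreal (192 * (real k + 2)) * ennreal (Tnorm \<mu> k))"
    by (intro mult_left_mono le) simp
  also have "\<dots> = ennreal (1 / 192 / (real k + 2) * (192 * (real k + 2))) * ennreal (Tnorm \<mu> k)"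
    by (subst ennreal_mult[of "1 / 192 / (real k + 2)"]) (auto simp: mult.assoc)
  also have "1 / 192 / (real k + 2) * (192 * (real k + 2)) = 1" by (simp add: field_simps)
  finally show "ennreal (1 / 192 / (real k + 2)) * B0sup \<mu> \<le> ennreal (Tnorm \<mu> k)" by simp
qed

end

theorem theorem4p2:
  "\<exists>C::real. C > 0 \<and>
     (\<forall>(\<mu>::complex measure) (k::nat).
        sets \<mu> = sets borel \<and> finite_measure \<mu> \<and> emeasure \<mu> (UNIV - ball 0 1) = 0 \<longrightarrow>
        (Tbounded \<mu> k \<longleftrightarrow> Carleson \<mu>) \<and>
        (Carleson \<mu> \<longrightarrow>
           ennreal (C / (real k + 2)) * B0sup \<mu> \<le> ennreal (Tnorm \<mu> k) \<and>
           ennreal (Tnorm \<mu> k) \<le> ennreal (4 * (real k + 2)) * B0sup \<mu>))"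
proof (intro exI[of _ "1 / 192"] conjI allI impI)
  fix \<mu> :: "complex measure" and k :: nat
  assume asm: "sets \<mu> = sets borel \<and> finite_measure \<mu> \<and> emeasure \<mu> (UNIV - ball 0 1) = 0"
  interpret disc_measure \<mu>
    using asm by (intro disc_measure.intro disc_measure_axioms.intro) auto
  show "Tbounded \<mu> k \<longleftrightarrow> Carleson \<mu>" by (rule Tbounded_iff_Carleson)
  assume "Carleson \<mu>"
  thus "ennreal (1 / 192 / (real k + 2)) * B0sup \<mu> \<le> ennreal (Tnorm \<mu> k)"
    and "ennreal (Tnorm \<mu> k) \<le> ennreal (4 * (real k + 2)) * B0sup \<mu>"
    by (rule Tnorm_bounds)+
qed simp

end
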